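(* For each $n\ge1$ let $\theta\in\mathbb{R}^n$, $\hat\theta_0\in\mathbb{R}^n$ with $\|\hat\theta_0\|=\sqrt n$, and binary vectors $\delta_t\in\{0,1\}^n$ ($t\in\mathbb{N}_0$) with $\delta_0=\mathsf{1}$ be deterministic, and let $M=\frac{\lambda}{n}\theta\theta^\top+Z$ with fixed $\lambda\ge0$ and $Z\sim\mathsf{GOE}(n)$. Assume that for each $t\in\mathbb{N}_0$ the joint empirical measure of $\{(\theta_i,\hat\theta_{0i},\delta_{0i},\dots,\delta_{ti}):i\in[n]\}$ converges in quadratic Wasserstein distance, as $n\to\infty$, to a product measure $\mu\otimes\nu_t$, where $\mu$ is a probability measure on $\mathbb{R}^2$ (fixed, independent of $t$) whose two marginals have unit second moments, and $\nu_t$ is the law of the corresponding initial entries of a random binary string drawn from a probability measure $\nu$ on $\{0,1\}^{\mathbb{N}_0}$. Let $\tau(t,i)=\max\{s\in\{0,\dots,t-1\}:\delta_{si}=1\}$, $w_{ts}=\sum_{i=1}^n\mathbf{1}\{\tau(t,i)=s\}$, and for $0\le s<t$ let $p_t(s)=\nu(\{\omega:\omega_s=1,\omega_{s+1}=\dots=\omega_{t-1}=0\})$. Generate, starting from $\hat\theta_0$, $$x_t=\delta_t\circ\Big(M\hat\theta_t-\frac{1}{\sqrt n\,\|x_{t-1}\|}\sum_{s<t}w_{ts}\hat\theta_s\Big)+(\mathsf{1}-\delta_t)\circ x_{t-1},\qquad\hat\theta_{t+1}=\frac{\sqrt n}{\|x_t\|}x_t,$$ for $t=0,1,2,\dots$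 (for $t=0$ this reads $x_0=M\hat\theta_0$). Define $\rho_0=\int u\hat u\,d\mu(u,\hat u)$ and, for $t\ge1$, $$\rho_t=\frac{\lambda\sum_{s<t}\rho_sp_t(s)}{\sqrt{\sum_{s<t}(\lambda^2\rho_s^2+1)p_t(s)}}.$$ Then for each $t\in\mathbb{N}$, $\big|\frac1n\langle\theta,\hat\theta_t\rangle-\rho_t\big|\xrightarrow[n\to\infty]{\mathrm{p}}0$.
   Context: $\mathsf{GOE}(n)$: symmetric $n\times n$ random matrix with independent $\mathsf{N}(0,1/n)$ entries above the diagonal and independent $\mathsf{N}(0,2/n)$ diagonal entries. $\circ$ is the entrywise (Hadamard) product and $\mathsf{1}$ the all-ones vector. *)

theory Defs
  imports "HOL-Probability.Probability"
begin

section \<open>Finite-dimensional vectors as functions nat => real (only indices < n matter)\<close>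

definition vnorm :: "nat \<Rightarrow> (nat \<Rightarrow> real) \<Rightarrow> real" where
  "vnorm n x = sqrt (\<Sum>i<n. (x i)\<^sup>2)"

definition vinner :: "nat \<Rightarrow> (nat \<Rightarrow> real) \<Rightarrow> (nat \<Rightarrow> real) \<Rightarrow> real" where
  "vinner n x y = (\<Sum>i<n. x i * y i)"

definition matvec :: "nat \<Rightarrow> (nat \<Rightarrow> nat \<Rightarrow> real) \<Rightarrow> (nat \<Rightarrow> real) \<Rightarrow> (nat \<Rightarrow> real)" where
  "matvec n A x = (\<lambda>i. \<Sum>j<n. A i j * x j)"

definition renorm :: "nat \<Rightarrow> (nat \<Rightarrow> real) \<Rightarrow> (nat \<Rightarrow> real)" where
  "renorm n x = (\<lambda>i. sqrt (real n) / vnorm n x * x i)"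

definition tau :: "(nat \<Rightarrow> nat \<Rightarrow> bool) \<Rightarrow> nat \<Rightarrow> nat \<Rightarrow> nat" where
  "tau \<delta> t i = Max {s. s < t \<and> \<delta> s i}"

definition wts :: "nat \<Rightarrow> (nat \<Rightarrow> nat \<Rightarrow> bool) \<Rightarrow> nat \<Rightarrow> nat \<Rightarrow> nat" where
  "wts n \<delta> t s = card {i. i < n \<and> tau \<delta> t i = s}"

text \<open>AMP n M delta h0 t = (x_t, [theta_hat_0, ..., theta_hat_(t+1)]).\<close>
fun AMP :: "nat \<Rightarrow> (nat \<Rightarrow> nat \<Rightarrow> real) \<Rightarrow> (nat \<Rightarrow> nat \<Rightarrow> bool) \<Rightarrow> (nat \<Rightarrow> real) \<Rightarrow> nat
            \<Rightarrow> (nat \<Rightarrow> real) \<times> (nat \<Rightarrow> real) list" where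
  "AMP n M \<delta> h0 0 = (let x = matvec n M h0 in (x, [h0, renorm n x]))"
| "AMP n M \<delta> h0 (Suc t) =
     (case AMP n M \<delta> h0 t of (xprev, hs) \<Rightarrow>
       (let x = (\<lambda>i. if \<delta> (Suc t) i
                      then matvec n M (hs ! Suc t) i
                           - (\<Sum>s<Suc t. real (wts n \<delta> (Suc t) s) * (hs ! s) i)
                             / (sqrt (real n) * vnorm n xprev)
                      else xprev i)
        in (x, hs @ [renorm n x])))"

definition theta_hat :: "nat \<Rightarrow> (nat \<Rightarrow> nat \<Rightarrow> real) \<Rightarrow> (nat \<Rightarrow> nat \<Rightarrow> bool) \<Rightarrow> (nat \<Rightarrow> real) \<Rightarrow> nat \<Rightarrow> (nat \<Rightarrow> real)" where
  "theta_hat n M \<delta> h0 t = snd (AMP n M \<delta> h0 t) ! t"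

definition pt :: "(nat \<Rightarrow> bool) measure \<Rightarrow> nat \<Rightarrow> nat \<Rightarrow> real" where
  "pt \<nu> t s = measure \<nu> {\<omega> \<in> space \<nu>. \<omega> s \<and> (\<forall>r. s < r \<and> r < t \<longrightarrow> \<not> \<omega> r)}"

fun rhos :: "real \<Rightarrow> real \<Rightarrow> (nat \<Rightarrow> nat \<Rightarrow> real) \<Rightarrow> nat \<Rightarrow> real list" where
  "rhos lam r0 p 0 = [r0]"
| "rhos lam r0 p (Suc t) =
     (let rs = rhos lam r0 p t in
      rs @ [lam * (\<Sum>s<Suc t. rs ! s * p (Suc t) s)
            / sqrt (\<Sum>s<Suc t. (lam\<^sup>2 * (rs ! s)\<^sup>2 + 1) * p (Suc t) s)])"

definition rho :: "real \<Rightarrow> real \<Rightarrow> (nat \<Rightarrow> nat \<Rightarrow> real) \<Rightarrow> nat \<Rightarrow> real" where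
  "rho lam r0 p t = rhos lam r0 p t ! t"

definition couplings :: "'a measure \<Rightarrow> 'b measure \<Rightarrow> ('a \<times> 'b) measure set" where
  "couplings P Q = {\<pi>. sets \<pi> = sets (P \<Otimes>\<^sub>M Q) \<and> prob_space \<pi>
                       \<and> distr \<pi> P fst = P \<and> distr \<pi> Q snd = Q}"

text \<open>Squared Wasserstein-2 distance for a squared-distance cost c.\<close>
definition W2sq :: "('a \<Rightarrow> 'a \<Rightarrow> real) \<Rightarrow> 'a measure \<Rightarrow> 'a measure \<Rightarrow> ennreal" where
  "W2sq c P Q = (INF \<pi> \<in> couplings P Q. \<integral>\<^sup>+ z. ennreal (c (fst z) (snd z)) \<partial>\<pi>)"

text \<open>Points (theta_i, theta_hat0_i, (delta_0i..delta_ti)) of R^2 x {0,1}^(t+1);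
  binary coordinates stored as booleans on index set {..t}.\<close>
definition Xsp :: "nat \<Rightarrow> ((real \<times> real) \<times> (nat \<Rightarrow> bool)) measure" where
  "Xsp t = (borel :: (real \<times> real) measure) \<Otimes>\<^sub>M PiM {..t} (\<lambda>_. count_space UNIV)"

definition cost :: "nat \<Rightarrow> (real \<times> real) \<times> (nat \<Rightarrow> bool) \<Rightarrow> (real \<times> real) \<times> (nat \<Rightarrow> bool) \<Rightarrow> real" where
  "cost t z z' = (fst (fst z) - fst (fst z'))\<^sup>2 + (snd (fst z) - snd (fst z'))\<^sup>2
                 + (\<Sum>s\<le>t. (of_bool (snd z s) - of_bool (snd z' s) :: real)\<^sup>2)"

definition emp :: "nat \<Rightarrow> nat \<Rightarrow> (nat \<Rightarrow> real) \<Rightarrow> (nat \<Rightarrow> real) \<Rightarrow> (nat \<Rightarrow> nat \<Rightarrow> bool)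
                   \<Rightarrow> ((real \<times> real) \<times> (nat \<Rightarrow> bool)) measure" where
  "emp n t \<theta> h0 \<delta> = distr (measure_pmf (pmf_of_set {..<n})) (Xsp t)
      (\<lambda>i. ((\<theta> i, h0 i), restrict (\<lambda>s. \<delta> s i) {..t}))"

definition lim_meas :: "nat \<Rightarrow> (real \<times> real) measure \<Rightarrow> (nat \<Rightarrow> bool) measure
                        \<Rightarrow> ((real \<times> real) \<times> (nat \<Rightarrow> bool)) measure" where
  "lim_meas t \<mu> \<nu> = \<mu> \<Otimes>\<^sub>M distr \<nu> (PiM {..t} (\<lambda>_. count_space UNIV)) (\<lambda>\<omega>. restrict \<omega> {..t})"

end

theory Submission
  imports Defs "HOL-Library.Function_Algebras"
begin

text \<open>
  Write \<open>M\<close> as a rank-one part plus \<open>Z\<close>. All steps of the algorithm are linear except for the scalar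
  normalisations, so the iterates are combinations, with scalar coefficients that converge in
  probability, of words \<open>Z D\<^sub>1 Z D\<^sub>2 \<dots> Z D\<^sub>k v\<close> with deterministic diagonal matrices \<open>D\<^sub>i\<close>. Asymptotically
  \<open>Z\<close> acts as \<open>\<ell> + \<ell>\<^sup>*\<close> on a full Fock space, where \<open>\<ell>\<^sup>* D \<ell>\<close> is the normalised trace of \<open>D\<close>, and the
  Onsager term is exactly the \<open>\<ell>\<^sup>*\<close> part of \<open>Z\<close> applied to the current estimate. What remains is
  \<open>u\<^sub>t = \<ell> \<theta>\<^sub>t\<close>, hence \<open>\<langle>v, u\<^sub>t\<rangle> / n \<rightarrow> 0\<close> for deterministic \<open>v\<close> and
  \<open>\<langle>u\<^sub>t, A u\<^sub>t\<rangle> / n \<approx> (tr A / n) \<parallel>\<theta>\<^sub>t\<parallel>\<^sup>2 / n\<close>, and these two facts give the recursion for \<open>\<rho>\<^sub>t\<close>.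

  The second fact follows from the first by moving one \<open>Z\<close> across the inner product. For the first,
  \<open>\<ell> D\<^sub>1 \<dots> \<ell> D\<^sub>k v\<close> is compared with the sum over self-avoiding paths: products of distinct entries are
  orthogonal, and each walk that revisits a vertex loses a factor \<open>1 / n\<close>. The errors are propagated
  with the bound \<open>\<parallel>Z\<parallel>\<^sup>2 \<le> n\<^sup>\<beta>\<close> for every \<open>\<beta> > 0\<close>, which follows from moments of traces.

  Vectors are multiplied entrywise, so that a diagonal matrix is the vector of its diagonal entries.
\<close>

section \<open>Vectors and symmetric matrices\<close>

lemma sum_fun_apply [simp]: "(\<Sum>s\<in>S. f s) x = (\<Sum>s\<in>S. f s x)"
  by (induction S rule: infinite_finite_induct) auto

definition sqnorm :: "nat \<Rightarrow> (nat \<Rightarrow> real) \<Rightarrow> real" where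
  "sqnorm n x = (\<Sum>i<n. (x i)\<^sup>2)"

lemma sqnorm_nonneg [simp]: "0 \<le> sqnorm n x"
  by (simp add: sqnorm_def sum_nonneg)

lemma sqnorm_eq_vinner: "sqnorm n x = vinner n x x"
  by (simp add: sqnorm_def vinner_def power2_eq_square)

lemma sqnorm_eq_vnorm_square: "sqnorm n x = (vnorm n x)\<^sup>2"
  using sqnorm_nonneg[of n x] by (simp add: sqnorm_def vnorm_def)

lemma sqnorm_uminus [simp]: "sqnorm n (- x) = sqnorm n x"
  by (simp add: sqnorm_def)

lemma sqnorm_add_le: "sqnorm n (x + y) \<le> 2 * sqnorm n x + 2 * sqnorm n y"
proof -
  have "(a + b)\<^sup>2 \<le> 2 * a\<^sup>2 + 2 * b\<^sup>2" for a b :: real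
    using zero_le_power2[of "a - b"] by (simp add: power2_eq_square algebra_simps)
  then show ?thesis
    unfolding sqnorm_def sum_distrib_left sum.distrib[symmetric] plus_fun_apply by (intro sum_mono)
qed

lemma sqnorm_diff_le: "sqnorm n (x - y) \<le> 2 * sqnorm n x + 2 * sqnorm n y"
  using sqnorm_add_le[of n x "- y"] by simp

lemma vinner_Cauchy_Schwarz: "(vinner n x y)\<^sup>2 \<le> sqnorm n x * sqnorm n y"
  unfolding vinner_def sqnorm_def by (rule Cauchy_Schwarz_ineq_sum)

definition mean :: "nat \<Rightarrow> (nat \<Rightarrow> real) \<Rightarrow> real" where
  "mean n x = (\<Sum>i<n. x i) / real n"

lemma mean_mult: "mean n (x * y) = vinner n x y / real n"
  by (simp add: mean_def vinner_def)

lemma mean_mult_self: "mean n (x * x) = sqnorm n x / real n"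
  by (simp add: mean_mult sqnorm_eq_vinner)

lemma mean_cong: "(\<And>i. i < n \<Longrightarrow> x i = y i) \<Longrightarrow> mean n x = mean n y"
  by (simp add: mean_def)

definition contraction :: "nat \<Rightarrow> (nat \<Rightarrow> real) \<Rightarrow> bool" where
  "contraction n D \<longleftrightarrow> (\<forall>i<n. \<bar>D i\<bar> \<le> 1)"

lemma abs_mean_le_1:
  assumes "contraction n D"
  shows "\<bar>mean n D\<bar> \<le> 1"
proof -
  have "\<bar>\<Sum>i<n. D i\<bar> \<le> (\<Sum>i<n. 1)"
    using assms by (intro order_trans[OF sum_abs] sum_mono) (auto simp: contraction_def)
  then show ?thesis unfolding mean_def by (cases "n = 0") (auto simp: abs_divide)
qed

lemma square_contraction_mult_le:
  assumes "contraction n D" and "i < n"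
  shows "(D i * a)\<^sup>2 \<le> a\<^sup>2"
proof -
  have "\<bar>D i\<bar> * \<bar>a\<bar> \<le> 1 * \<bar>a\<bar>"
    using assms by (intro mult_right_mono) (auto simp: contraction_def)
  then show ?thesis by (simp add: abs_le_square_iff[symmetric] abs_mult)
qed

lemma sqnorm_contraction_le: "contraction n D \<Longrightarrow> sqnorm n (D * x) \<le> sqnorm n x"
  unfolding sqnorm_def times_fun_apply by (intro sum_mono square_contraction_mult_le) auto

definition symmetric :: "nat \<Rightarrow> (nat \<Rightarrow> nat \<Rightarrow> real) \<Rightarrow> bool" where
  "symmetric n A \<longleftrightarrow> (\<forall>i<n. \<forall>j<n. A i j = A j i)"

lemma vinner_matvec:
  assumes "symmetric n A"
  shows "vinner n x (matvec n A y) = vinner n (matvec n A x) y"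
proof -
  have "vinner n x (matvec n A y) = (\<Sum>i<n. \<Sum>j<n. x i * (A i j * y j))"
    by (simp add: vinner_def matvec_def sum_distrib_left)
  also have "\<dots> = (\<Sum>j<n. \<Sum>i<n. x i * (A i j * y j))" by (rule sum.swap)
  also have "\<dots> = (\<Sum>j<n. \<Sum>i<n. A j i * x i * y j)"
    using assms by (intro sum.cong refl) (auto simp: symmetric_def)
  also have "\<dots> = vinner n (matvec n A x) y"
    by (simp add: vinner_def matvec_def sum_distrib_right)
  finally show ?thesis .
qed

lemma vinner_matvec_pow:
  assumes "symmetric n A"
  shows "vinner n ((matvec n A ^^ k) x) ((matvec n A ^^ l) y)
      = vinner n x ((matvec n A ^^ (k + l)) y)"
proof (induction k arbitrary: l)
  case (Suc k)
  have "vinner n ((matvec n A ^^ Suc k) x) ((matvec n A ^^ l) y)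
      = vinner n ((matvec n A ^^ k) x) ((matvec n A ^^ Suc l) y)"
    by (simp add: vinner_matvec[OF assms])
  also have "\<dots> = vinner n x ((matvec n A ^^ (k + Suc l)) y)" by (rule Suc)
  finally show ?case by simp
qed simp

lemma sqnorm_matvec_pow:
  "symmetric n A \<Longrightarrow> sqnorm n ((matvec n A ^^ k) x) = vinner n x ((matvec n A ^^ (2 * k)) x)"
  unfolding sqnorm_eq_vinner mult_2 by (rule vinner_matvec_pow)

lemma matvec_cong: "(\<And>j. j < n \<Longrightarrow> x j = y j) \<Longrightarrow> matvec n A x = matvec n A y"
  by (simp add: matvec_def)

lemma matvec_0 [simp]: "matvec n A 0 = 0"
  by (simp add: matvec_def fun_eq_iff)

lemma matvec_add: "matvec n A (x + y) = matvec n A x + matvec n A y"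
  by (simp add: matvec_def fun_eq_iff distrib_left sum.distrib)

lemma matvec_scale: "matvec n A ((\<lambda>_. c) * x) = (\<lambda>_. c) * matvec n A x"
  by (simp add: matvec_def fun_eq_iff sum_distrib_left mult.left_commute)

section \<open>Walks and their edges\<close>

definition walks :: "nat \<Rightarrow> nat \<Rightarrow> nat list set" where
  "walks n k = {xs. set xs \<subseteq> {..<n} \<and> length xs = k}"

lemma finite_walks [simp]: "finite (walks n k)"
  unfolding walks_def by (rule finite_lists_length_eq) simp

lemma walks_0 [simp]: "walks n 0 = {[]}"
  by (auto simp: walks_def)

lemma Cons_in_walks [simp]: "i # xs \<in> walks n (Suc k) \<longleftrightarrow> i < n \<and> xs \<in> walks n k"
  by (auto simp: walks_def)

lemma sum_walks_Suc: "(\<Sum>xs\<in>walks n (Suc k). f xs) = (\<Sum>i<n. \<Sum>xs\<in>walks n k. f (i # xs))"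
proof -
  have "walks n (Suc k) = (\<lambda>(i, xs). i # xs) ` ({..<n} \<times> walks n k)"
    by (auto simp: walks_def image_iff length_Suc_conv)
  moreover have "inj_on (\<lambda>(i, xs). i # xs) ({..<n} \<times> walks n k)"
    by (auto simp: inj_on_def)
  ultimately have "(\<Sum>xs\<in>walks n (Suc k). f xs) = (\<Sum>p\<in>{..<n} \<times> walks n k. f (fst p # snd p))"
    by (simp add: sum.reindex case_prod_unfold)
  then show ?thesis
    by (simp add: sum.cartesian_product case_prod_unfold)
qed

lemma sum_walks_last:
  fixes g :: "nat \<Rightarrow> real"
  shows "(\<Sum>xs\<in>walks n (Suc k). g (last xs)) = real n ^ k * (\<Sum>i<n. g i)"
proof (induction k)
  case 0
  show ?case by (simp add: sum_walks_Suc[of _ n 0, simplified])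
next
  case (Suc k)
  have "(\<Sum>xs\<in>walks n (Suc k). g (last (i # xs))) = (\<Sum>xs\<in>walks n (Suc k). g (last xs))" for i
    by (rule sum.cong) (auto simp: walks_def)
  then show ?case
    by (subst sum_walks_Suc) (simp add: Suc)
qed

lemma sum_walks_hd_last:
  fixes f g :: "nat \<Rightarrow> real"
  shows "(\<Sum>xs\<in>walks n (Suc (Suc k)). f (hd xs) * g (last xs))
      = real n ^ k * (\<Sum>i<n. f i) * (\<Sum>i<n. g i)"
proof -
  have "(\<Sum>xs\<in>walks n (Suc k). g (last (i # xs))) = (\<Sum>xs\<in>walks n (Suc k). g (last xs))" for i
    by (rule sum.cong) (auto simp: walks_def)
  then show ?thesis
    unfolding sum_walks_Suc[of _ n "Suc k"] list.sel sum_distrib_left[symmetric] sum_walks_last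
    by (simp add: sum_distrib_right[symmetric] mult.assoc mult.left_commute)
qed

definition edge :: "nat \<Rightarrow> nat \<Rightarrow> nat \<times> nat" where
  "edge i j = (min i j, max i j)"

lemma edge_commute: "edge i j = edge j i"
  by (simp add: edge_def min.commute max.commute)

lemma edge_eq_iff: "edge i j = edge k l \<longleftrightarrow> (i = k \<and> j = l) \<or> (i = l \<and> j = k)"
  by (auto simp: edge_def min_def max_def)

definition edges :: "nat \<Rightarrow> (nat \<times> nat) set" where
  "edges n = {(i, j). i \<le> j \<and> j < n}"

lemma finite_edges [simp]: "finite (edges n)"
  by (rule finite_subset[of _ "{..<n} \<times> {..<n}"]) (auto simp: edges_def)

lemma edge_in_edges: "i < n \<Longrightarrow> j < n \<Longrightarrow> edge i j \<in> edges n"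
  by (auto simp: edges_def edge_def)

fun edge_count :: "nat list \<Rightarrow> nat \<times> nat \<Rightarrow> nat" where
  "edge_count (a # b # xs) e = of_bool (e = edge a b) + edge_count (b # xs) e"
| "edge_count _ e = 0"

lemma edge_count_pos_imp_edge:
  assumes "edge_count xs e > 0"
  obtains i j where "e = edge i j" "i \<in> set xs" "j \<in> set xs"
proof -
  have "\<exists>i j. e = edge i j \<and> i \<in> set xs \<and> j \<in> set xs"
    using assms
  proof (induction xs rule: induct_list012)
    case (3 a b xs)
    show ?case
    proof (cases "e = edge a b")
      case False
      then have "edge_count (b # xs) e > 0" using 3(3) by simp
      then show ?thesis using 3(2) by auto
    qed auto
  qed auto
  then show thesis using that by blast
qed

lemma edge_count_pos_imp_in_edges:
  "set xs \<subseteq> {..<n} \<Longrightarrow> edge_count xs e > 0 \<Longrightarrow> e \<in> edges n"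
  by (erule edge_count_pos_imp_edge) (auto intro: edge_in_edges)

lemma edge_count_eq_0: "a \<notin> set xs \<or> b \<notin> set xs \<Longrightarrow> edge_count xs (edge a b) = 0"
  by (rule ccontr) (auto elim!: edge_count_pos_imp_edge simp: edge_eq_iff)

lemma sum_edge_count: "set xs \<subseteq> {..<n} \<Longrightarrow> (\<Sum>e\<in>edges n. edge_count xs e) = length xs - 1"
proof (induction xs rule: induct_list012)
  case (3 a b xs)
  then have "edge a b \<in> edges n" by (auto intro: edge_in_edges)
  then show ?case
    using 3 by (simp add: sum.distrib sum.If_cases of_bool_def)
qed auto

lemma set_eq_edge_ends:
  assumes "length xs \<ge> 2"
  shows "set xs = {i. \<exists>j. edge_count xs (edge i j) > 0}"
proof
  show "{i. \<exists>j. edge_count xs (edge i j) > 0} \<subseteq> set xs"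
    by (auto elim!: edge_count_pos_imp_edge simp: edge_eq_iff)
  have "\<exists>j. edge_count xs (edge i j) > 0" if "i \<in> set xs" for i
    using assms that
  proof (induction xs rule: induct_list012)
    case (3 a b xs)
    show ?case
    proof (cases "i = a \<or> i = b")
      case True
      then have "edge_count (a # b # xs) (edge i (if i = a then b else a)) > 0"
        by (auto simp: edge_eq_iff)
      then show ?thesis by blast
    next
      case False
      then have "length (b # xs) \<ge> 2" "i \<in> set (b # xs)"
        using 3 by (cases xs; auto)+
      then obtain j where "edge_count (b # xs) (edge i j) > 0" using 3 by blast
      then have "edge_count (a # b # xs) (edge i j) > 0" by simp
      then show ?thesis by blast
    qed
  qed auto
  then show "set xs \<subseteq> {i. \<exists>j. edge_count xs (edge i j) > 0}" by blast
qed

lemma edge_count_distinct_le_1: "distinct xs \<Longrightarrow> edge_count xs e \<le> 1"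
proof (induction xs rule: induct_list012)
  case (3 a b xs)
  then have "edge_count (b # xs) (edge a b) = 0"
    by (intro edge_count_eq_0) auto
  with 3 show ?case by auto
qed auto

lemma edge_count_loop: "distinct xs \<Longrightarrow> edge_count xs (edge a a) = 0"
  by (induction xs rule: induct_list012) (auto simp: edge_eq_iff)

definition backtracks :: "nat \<Rightarrow> nat list \<Rightarrow> bool" where
  "backtracks i xs \<longleftrightarrow> (\<exists>j ys. xs = j # i # ys)"

lemma edge_count_Cons_le_1:
  assumes "distinct xs" and "\<not> backtracks i xs"
  shows "edge_count (i # xs) e \<le> 1"
proof (cases xs)
  case (Cons j ys)
  have "edge_count xs (edge i j) = 0"
  proof (cases "i = j \<or> ys = []")
    case True
    then show ?thesis using edge_count_loop[OF assms(1)] Cons by auto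
  next
    case False
    then obtain b zs where ys_eq: "ys = b # zs" by (cases ys) auto
    then have "b \<noteq> i" using assms(2) Cons by (auto simp: backtracks_def)
    moreover have "edge_count (b # zs) (edge i j) = 0"
      using assms(1) Cons ys_eq by (intro edge_count_eq_0) auto
    ultimately show ?thesis
      using False Cons ys_eq by (auto simp: edge_eq_iff)
  qed
  then show ?thesis
    using edge_count_distinct_le_1[OF assms(1), of e] Cons by auto
qed auto

lemma edge_count_backtrack:
  assumes "distinct (j # i # ys)"
  shows "edge_count (i # j # i # ys) e = (if e = edge i j then 2 else edge_count (i # ys) e)"
    and "edge_count (i # ys) (edge i j) = 0"
proof -
  show "edge_count (i # ys) (edge i j) = 0"
    using assms by (intro edge_count_eq_0) auto
  then show "edge_count (i # j # i # ys) e = (if e = edge i j then 2 else edge_count (i # ys) e)"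
    by (auto simp: edge_commute[of j i])
qed

lemma edge_count_Cons_le_2:
  assumes "distinct xs"
  shows "edge_count (i # xs) e \<le> 2"
proof (cases "backtracks i xs")
  case True
  then obtain j ys where xs_eq: "xs = j # i # ys" by (auto simp: backtracks_def)
  then have "edge_count (i # ys) e \<le> 1"
    using assms by (intro edge_count_distinct_le_1) auto
  then show ?thesis using assms edge_count_backtrack(1)[of j i ys e] unfolding xs_eq by auto
next
  case False
  then show ?thesis using edge_count_Cons_le_1[OF assms False, of e] by simp
qed

fun walk_prod :: "(nat \<Rightarrow> nat \<Rightarrow> real) \<Rightarrow> nat list \<Rightarrow> real" where
  "walk_prod A (a # b # xs) = A a b * walk_prod A (b # xs)"
| "walk_prod A _ = 1"

lemma walk_prod_eq_prod_edges:
  assumes "set xs \<subseteq> {..<n}" and "symmetric n A"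
  shows "walk_prod A xs = (\<Prod>e\<in>edges n. A (fst e) (snd e) ^ edge_count xs e)"
  using assms(1)
proof (induction xs rule: induct_list012)
  case (3 a b xs)
  have "edge a b \<in> edges n"
    using 3(3) by (auto intro: edge_in_edges)
  moreover have "A a b = A (fst (edge a b)) (snd (edge a b))"
    using 3(3) assms(2) by (auto simp: symmetric_def edge_def min_def max_def)
  moreover have "(\<Prod>e\<in>edges n. A (fst e) (snd e) ^ of_bool (e = edge a b))
      = (\<Prod>e\<in>edges n. if e = edge a b then A (fst e) (snd e) else 1)"
    by (rule prod.cong) auto
  ultimately show ?case
    using 3 by (simp add: power_add prod.distrib prod.If_cases)
qed auto

section \<open>Self-avoiding paths\<close>

definition simple_walks :: "nat \<Rightarrow> nat \<Rightarrow> nat list set" where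
  "simple_walks n k = {xs \<in> walks n k. distinct xs}"

lemma finite_simple_walks [simp]: "finite (simple_walks n k)"
  by (simp add: simple_walks_def)

lemma simple_walks_subset: "simple_walks n k \<subseteq> walks n k"
  by (auto simp: simple_walks_def)

lemma simple_walks_0 [simp]: "simple_walks n 0 = {[]}"
  by (auto simp: simple_walks_def)

lemma sum_simple_walks_Suc:
  "(\<Sum>xs\<in>simple_walks n (Suc k). f xs) = (\<Sum>i<n. \<Sum>xs | xs \<in> simple_walks n k \<and> i \<notin> set xs. f (i # xs))"
proof -
  have "{xs. xs \<in> simple_walks n k \<and> i \<notin> set xs} = {xs \<in> walks n k. distinct (i # xs)}" for i
    by (auto simp: simple_walks_def)
  then show ?thesis
    by (simp add: simple_walks_def sum.inter_filter sum_walks_Suc del: distinct.simps)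
qed

lemma sum_backtracking_walks:
  assumes "i < n"
  shows "(\<Sum>xs | xs \<in> simple_walks n (Suc (Suc k)) \<and> backtracks i xs. f xs)
    = (\<Sum>ys | ys \<in> simple_walks n k \<and> i \<notin> set ys. \<Sum>j\<in>{..<n} - set (i # ys). f (j # i # ys))"
proof -
  let ?Y = "{ys. ys \<in> simple_walks n k \<and> i \<notin> set ys}"
  have "(\<Sum>xs | xs \<in> simple_walks n (Suc (Suc k)) \<and> backtracks i xs. f xs)
      = (\<Sum>(ys, j)\<in>(SIGMA ys:?Y. {..<n} - set (i # ys)). f (j # i # ys))"
    using assms
    by (intro sum.reindex_bij_witness[where i = "\<lambda>(ys, j). j # i # ys"
          and j = "\<lambda>xs. (tl (tl xs), hd xs)"])
      (auto simp: backtracks_def simple_walks_def)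
  then show ?thesis by (simp add: sum.Sigma)
qed

lemma sum_simple_walks_last_le:
  fixes g :: "nat \<Rightarrow> real"
  assumes "\<And>i. 0 \<le> g i"
  shows "(\<Sum>xs\<in>simple_walks n (Suc k). g (last xs)) \<le> real n ^ k * (\<Sum>i<n. g i)"
  unfolding sum_walks_last[symmetric]
  by (intro sum_mono2 simple_walks_subset assms) simp

lemma sum_simple_walks_through_le:
  fixes g :: "nat \<Rightarrow> real"
  assumes g_nonneg: "\<And>i. 0 \<le> g i"
  shows "(\<Sum>i<n. \<Sum>xs | xs \<in> simple_walks n (Suc k) \<and> i \<in> set xs. g (last xs))
    \<le> real (Suc k) * real n ^ k * (\<Sum>i<n. g i)"
proof -
  have "(\<Sum>i<n. \<Sum>xs | xs \<in> simple_walks n (Suc k) \<and> i \<in> set xs. g (last xs))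
      = (\<Sum>xs\<in>simple_walks n (Suc k). \<Sum>i<n. if i \<in> set xs then g (last xs) else 0)"
    by (subst sum.swap) (simp add: sum.inter_filter)
  also have "\<dots> = (\<Sum>xs\<in>simple_walks n (Suc k). real (Suc k) * g (last xs))"
  proof (rule sum.cong)
    fix xs assume xs_simple: "xs \<in> simple_walks n (Suc k)"
    then have "(\<Sum>i<n. if i \<in> set xs then g (last xs) else 0) = (\<Sum>i\<in>set xs. g (last xs))"
      by (intro sum.mono_neutral_cong_right) (auto simp: simple_walks_def walks_def)
    then show "(\<Sum>i<n. if i \<in> set xs then g (last xs) else 0) = real (Suc k) * g (last xs)"
      using xs_simple by (simp add: simple_walks_def walks_def distinct_card)
  qed simp
  also have "\<dots> \<le> real (Suc k) * (real n ^ k * (\<Sum>i<n. g i))"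
    unfolding sum_distrib_left[symmetric]
    by (intro mult_left_mono sum_simple_walks_last_le g_nonneg) simp
  finally show ?thesis by (simp only: mult.assoc)
qed

fun weight :: "(nat \<Rightarrow> real) list \<Rightarrow> (nat \<Rightarrow> real) \<Rightarrow> nat list \<Rightarrow> real" where
  "weight [] v xs = v (hd xs)"
| "weight (D # Ds) v xs = D (hd (tl xs)) * weight Ds v (tl xs)"

lemma weight_square_le:
  assumes "\<forall>D\<in>set Ds. contraction n D" and "xs \<in> walks n (Suc (length Ds))"
  shows "(weight Ds v xs)\<^sup>2 \<le> (v (last xs))\<^sup>2"
  using assms
proof (induction Ds arbitrary: xs)
  case Nil
  then show ?case by (auto simp: walks_def length_Suc_conv)
next
  case (Cons D Ds)
  then obtain a b ys where xs_eq: "xs = a # b # ys"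
    by (auto simp: walks_def length_Suc_conv)
  have "(D b * weight Ds v (b # ys))\<^sup>2 \<le> (weight Ds v (b # ys))\<^sup>2"
    using Cons.prems xs_eq by (intro square_contraction_mult_le) auto
  also have "\<dots> \<le> (v (last (b # ys)))\<^sup>2"
    using Cons.prems xs_eq by (intro Cons.IH) auto
  finally show ?case using xs_eq by simp
qed

definition path_vec :: "nat \<Rightarrow> (nat \<Rightarrow> nat \<Rightarrow> real) \<Rightarrow> (nat \<Rightarrow> real) list \<Rightarrow> (nat \<Rightarrow> real) \<Rightarrow> nat \<Rightarrow> real"
  where
  "path_vec n A Ds v i = (\<Sum>xs | xs \<in> simple_walks n (length Ds) \<and> i \<notin> set xs.
     weight Ds v (i # xs) * walk_prod A (i # xs))"

lemma path_vec_Nil [simp]: "path_vec n A [] v = v"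
proof
  fix i
  have "{xs. xs \<in> simple_walks n 0 \<and> i \<notin> set xs} = {[]}" by auto
  then show "path_vec n A [] v i = v i" by (simp add: path_vec_def)
qed

lemma vinner_path_vec:
  "vinner n u (path_vec n A Ds v)
    = (\<Sum>xs\<in>simple_walks n (Suc (length Ds)). u (hd xs) * weight Ds v xs * walk_prod A xs)"
  by (simp add: vinner_def path_vec_def sum_simple_walks_Suc sum_distrib_left mult.assoc)

lemma matvec_path_vec:
  "matvec n A (D * path_vec n A Ds v) i
    = (\<Sum>xs\<in>simple_walks n (Suc (length Ds)). weight (D # Ds) v (i # xs) * walk_prod A (i # xs))"
  by (simp add: matvec_def path_vec_def sum_simple_walks_Suc sum_distrib_left mult_ac)

definition path_step_error ::
  "nat \<Rightarrow> (nat \<Rightarrow> nat \<Rightarrow> real) \<Rightarrow> (nat \<Rightarrow> real) \<Rightarrow> (nat \<Rightarrow> real) list \<Rightarrow> (nat \<Rightarrow> real) \<Rightarrow> nat \<Rightarrow> real" where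
  "path_step_error n A D Ds v = matvec n A (D * path_vec n A Ds v) - path_vec n A (D # Ds) v
     - (case Ds of [] \<Rightarrow> 0 | D1 # Ds1 \<Rightarrow> (\<lambda>_. mean n D) * (D1 * path_vec n A Ds1 v))"

section \<open>Orthogonal polynomials of Gaussian matrix entries\<close>

lemma sum_products_le_of_fibres:
  fixes c :: "'b \<Rightarrow> real"
  assumes finite_S: "finite S" and fibre_bound: "\<And>x. x \<in> S \<Longrightarrow> card {y \<in> S. \<kappa> y = \<kappa> x} \<le> m"
  shows "(\<Sum>x\<in>S. \<Sum>y\<in>S. if \<kappa> y = \<kappa> x then \<bar>c x * c y\<bar> else 0) \<le> real m * (\<Sum>x\<in>S. (c x)\<^sup>2)"
proof -
  have fibre: "(\<Sum>y\<in>S. if \<kappa> y = \<kappa> x then a else 0) = real (card {y \<in> S. \<kappa> y = \<kappa> x}) * a"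
    for x and a :: real
    using finite_S by (simp add: sum.inter_filter[symmetric])
  have am_gm: "\<bar>a * b\<bar> \<le> a\<^sup>2 / 2 + b\<^sup>2 / 2" for a b :: real
    using zero_le_power2[of "\<bar>a\<bar> - \<bar>b\<bar>"] by (simp add: power2_diff abs_mult)
  have "(\<Sum>x\<in>S. \<Sum>y\<in>S. if \<kappa> y = \<kappa> x then \<bar>c x * c y\<bar> else 0)
      \<le> (\<Sum>x\<in>S. \<Sum>y\<in>S. (if \<kappa> y = \<kappa> x then (c x)\<^sup>2 / 2 else 0) + (if \<kappa> x = \<kappa> y then (c y)\<^sup>2 / 2 else 0))"
    using am_gm by (intro sum_mono) auto
  also have "\<dots> = (\<Sum>x\<in>S. \<Sum>y\<in>S. if \<kappa> y = \<kappa> x then (c x)\<^sup>2 / 2 else 0)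
      + (\<Sum>y\<in>S. \<Sum>x\<in>S. if \<kappa> x = \<kappa> y then (c y)\<^sup>2 / 2 else 0)"
    unfolding sum.distrib by (subst sum.swap) simp
  also have "\<dots> = (\<Sum>x\<in>S. real (card {y \<in> S. \<kappa> y = \<kappa> x}) * (c x)\<^sup>2)"
    unfolding fibre sum.distrib[symmetric] by (simp add: mult.commute)
  also have "\<dots> \<le> (\<Sum>x\<in>S. real m * (c x)\<^sup>2)"
    using fibre_bound by (intro sum_mono mult_right_mono) auto
  finally show ?thesis by (simp add: sum_distrib_left)
qed

lemma (in prob_space) second_moment_sum_le:
  fixes f :: "'b \<Rightarrow> 'a \<Rightarrow> real"
  assumes finite_S: "finite S"
    and integrable_products: "\<And>x y. x \<in> S \<Longrightarrow> y \<in> S \<Longrightarrow> integrable M (\<lambda>\<omega>. f x \<omega> * f y \<omega>)"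
    and orthogonal: "\<And>x y. x \<in> S \<Longrightarrow> y \<in> S \<Longrightarrow> \<kappa> y \<noteq> \<kappa> x \<Longrightarrow> expectation (\<lambda>\<omega>. f x \<omega> * f y \<omega>) = 0"
    and bound: "\<And>x y. x \<in> S \<Longrightarrow> y \<in> S \<Longrightarrow> \<kappa> y = \<kappa> x \<Longrightarrow> \<bar>expectation (\<lambda>\<omega>. f x \<omega> * f y \<omega>)\<bar> \<le> B"
    and fibre_bound: "\<And>x. x \<in> S \<Longrightarrow> card {y \<in> S. \<kappa> y = \<kappa> x} \<le> m" and "B \<ge> 0"
  shows "integrable M (\<lambda>\<omega>. (\<Sum>x\<in>S. c x * f x \<omega>)\<^sup>2)"
    and "expectation (\<lambda>\<omega>. (\<Sum>x\<in>S. c x * f x \<omega>)\<^sup>2) \<le> real m * B * (\<Sum>x\<in>S. (c x)\<^sup>2)"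
proof -
  have square: "(\<Sum>x\<in>S. c x * f x \<omega>)\<^sup>2 = (\<Sum>x\<in>S. \<Sum>y\<in>S. c x * c y * (f x \<omega> * f y \<omega>))" for \<omega>
    by (simp add: power2_eq_square sum_product algebra_simps)
  show "integrable M (\<lambda>\<omega>. (\<Sum>x\<in>S. c x * f x \<omega>)\<^sup>2)"
    unfolding square using integrable_products
    by (intro Bochner_Integration.integrable_sum integrable_mult_right) auto
  have term_le: "c x * c y * expectation (\<lambda>\<omega>. f x \<omega> * f y \<omega>)
      \<le> B * (if \<kappa> y = \<kappa> x then \<bar>c x * c y\<bar> else 0)"
    if "x \<in> S" "y \<in> S" for x y
  proof (cases "\<kappa> y = \<kappa> x")
    case True
    have "c x * c y * expectation (\<lambda>\<omega>. f x \<omega> * f y \<omega>)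
        \<le> \<bar>c x * c y\<bar> * \<bar>expectation (\<lambda>\<omega>. f x \<omega> * f y \<omega>)\<bar>"
      unfolding abs_mult[symmetric] by (rule abs_ge_self)
    also have "\<dots> \<le> \<bar>c x * c y\<bar> * B"
      by (intro mult_left_mono bound that True) simp
    finally show ?thesis using True by (simp add: mult.commute)
  qed (simp add: orthogonal that)
  have "expectation (\<lambda>\<omega>. (\<Sum>x\<in>S. c x * f x \<omega>)\<^sup>2)
      = (\<Sum>x\<in>S. \<Sum>y\<in>S. c x * c y * expectation (\<lambda>\<omega>. f x \<omega> * f y \<omega>))"
    unfolding square using integrable_products
    by (subst Bochner_Integration.integral_sum)
      (auto intro!: sum.cong Bochner_Integration.integrable_sum)
  also have "\<dots> \<le> (\<Sum>x\<in>S. \<Sum>y\<in>S. B * (if \<kappa> y = \<kappa> x then \<bar>c x * c y\<bar> else 0))"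
    by (intro sum_mono term_le)
  also have "\<dots> \<le> B * (real m * (\<Sum>x\<in>S. (c x)\<^sup>2))"
    unfolding sum_distrib_left[symmetric]
    by (intro mult_left_mono sum_products_le_of_fibres finite_S fibre_bound \<open>B \<ge> 0\<close>)
  finally show "expectation (\<lambda>\<omega>. (\<Sum>x\<in>S. c x * f x \<omega>)\<^sup>2) \<le> real m * B * (\<Sum>x\<in>S. (c x)\<^sup>2)"
    by (simp only: mult_ac)
qed

fun hermite :: "real \<Rightarrow> nat \<Rightarrow> real \<Rightarrow> real" where
  "hermite s 0 z = 1"
| "hermite s (Suc 0) z = z"
| "hermite s (Suc (Suc k)) z = z * hermite s (Suc k) z - real (Suc k) * s * hermite s k z"

lemma hermite_2: "hermite s 2 z = z\<^sup>2 - s"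
  by (simp add: numeral_2_eq_2)

lemma hermite_measurable [measurable]: "hermite s k \<in> borel_measurable borel"
  by (induction s k "0 :: real" rule: hermite.induct) (simp_all add: fun_eq_iff cong: measurable_cong)

locale goe = prob_space P for P :: "'w measure" +
  fixes n :: nat and Y :: "'w \<Rightarrow> nat \<Rightarrow> nat \<Rightarrow> real"
  assumes n_pos: "n \<ge> 1"
    and symmetric_Y: "symmetric n (Y \<omega>)"
    and indep_entries: "indep_vars (\<lambda>_. borel) (\<lambda>(i, j) \<omega>. Y \<omega> i j) {(i, j). i \<le> j \<and> j < n}"
    and off_diagonal: "\<And>i j. i < j \<Longrightarrow> j < n \<Longrightarrow>
          distributed P lborel (\<lambda>\<omega>. Y \<omega> i j) (normal_density 0 (sqrt (1 / real n)))"
    and diagonal: "\<And>i. i < n \<Longrightarrow>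
          distributed P lborel (\<lambda>\<omega>. Y \<omega> i i) (normal_density 0 (sqrt (2 / real n)))"
begin

definition edge_var :: "nat \<times> nat \<Rightarrow> real" where
  "edge_var e = (if fst e = snd e then 2 else 1) / real n"

definition entry :: "nat \<times> nat \<Rightarrow> 'w \<Rightarrow> real" where
  "entry e \<omega> = Y \<omega> (fst e) (snd e)"

lemma edge_var_pos: "edge_var e > 0"
  using n_pos by (auto simp: edge_var_def)

lemma edge_var_le: "edge_var e \<le> 2 / real n"
  by (auto simp: edge_var_def divide_right_mono)

lemma entry_edge: "i < n \<Longrightarrow> j < n \<Longrightarrow> entry (edge i j) \<omega> = Y \<omega> i j"
  using symmetric_Y[of \<omega>] by (auto simp: entry_def edge_def symmetric_def min_def max_def)

lemma edge_var_edge: "i \<noteq> j \<Longrightarrow> edge_var (edge i j) = 1 / real n"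
  by (auto simp: edge_var_def edge_def min_def max_def)

lemma entry_distributed:
  assumes "e \<in> edges n"
  shows "distributed P lborel (entry e) (normal_density 0 (sqrt (edge_var e)))"
proof (cases e)
  case (Pair i j)
  then have "entry e = (\<lambda>\<omega>. Y \<omega> i j)" by (auto simp: entry_def)
  then show ?thesis
    using assms off_diagonal[of i j] diagonal[of i] Pair
    by (cases "i = j") (auto simp: edges_def edge_var_def)
qed

lemma entry_measurable [measurable]: "e \<in> edges n \<Longrightarrow> entry e \<in> borel_measurable P"
  using distributed_measurable[OF entry_distributed] by (simp cong: measurable_cong_sets)

lemma entry_power:
  assumes in_edges: "e \<in> edges n"
  shows integrable_entry_power: "integrable P (\<lambda>\<omega>. entry e \<omega> ^ k)"
    and expectation_entry_even:
      "expectation (\<lambda>\<omega>. entry e \<omega> ^ (2 * k)) = edge_var e ^ k * (fact (2 * k) / (2 ^ k * fact k))"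
    and expectation_entry_odd: "expectation (\<lambda>\<omega>. entry e \<omega> ^ (2 * k + 1)) = 0"
proof -
  have sd_pos: "sqrt (edge_var e) > 0" using edge_var_pos by simp
  have integrable_iff: "integrable P (\<lambda>\<omega>. entry e \<omega> ^ k)
      \<longleftrightarrow> integrable lborel (\<lambda>x. normal_density 0 (sqrt (edge_var e)) x * x ^ k)" for k
    by (subst distributed_integrable[OF entry_distributed[OF in_edges], of "\<lambda>x. x ^ k"]) auto
  have moment: "expectation (\<lambda>\<omega>. entry e \<omega> ^ k)
      = (\<integral>x. normal_density 0 (sqrt (edge_var e)) x * x ^ k \<partial>lborel)" for k
    by (subst distributed_integral[OF entry_distributed[OF in_edges], of "\<lambda>x. x ^ k"]) auto
  show "integrable P (\<lambda>\<omega>. entry e \<omega> ^ k)"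
    unfolding integrable_iff using integrable_normal_moment[OF sd_pos, of 0 k] by simp
  show "expectation (\<lambda>\<omega>. entry e \<omega> ^ (2 * k)) = edge_var e ^ k * (fact (2 * k) / (2 ^ k * fact k))"
    unfolding moment using integral_normal_moment_even[OF sd_pos, of 0 k] edge_var_pos[of e]
    by (simp add: power_divide)
  show "expectation (\<lambda>\<omega>. entry e \<omega> ^ (2 * k + 1)) = 0"
    unfolding moment using integral_normal_moment_odd[OF sd_pos, of 0 k] by simp
qed

lemma entry_low_moments:
  assumes in_edges: "e \<in> edges n"
  shows "expectation (entry e) = 0" "expectation (\<lambda>\<omega>. (entry e \<omega>)\<^sup>2) = edge_var e"
    "expectation (\<lambda>\<omega>. entry e \<omega> ^ 3) = 0" "expectation (\<lambda>\<omega>. entry e \<omega> ^ 4) = 3 * (edge_var e)\<^sup>2"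
  using expectation_entry_odd[OF in_edges, of 0] expectation_entry_even[OF in_edges, of 1]
    expectation_entry_odd[OF in_edges, of 1] expectation_entry_even[OF in_edges, of 2]
  by (auto simp: fact_numeral power2_eq_square)

lemma prod_entries:
  fixes f :: "nat \<times> nat \<Rightarrow> real \<Rightarrow> real"
  assumes "\<And>e. e \<in> edges n \<Longrightarrow> f e \<in> borel_measurable borel"
    and integrable_factors: "\<And>e. e \<in> edges n \<Longrightarrow> integrable P (\<lambda>\<omega>. f e (entry e \<omega>))"
  shows integrable_prod_entries: "integrable P (\<lambda>\<omega>. \<Prod>e\<in>edges n. f e (entry e \<omega>))"
    and expectation_prod_entries:
      "expectation (\<lambda>\<omega>. \<Prod>e\<in>edges n. f e (entry e \<omega>))
        = (\<Prod>e\<in>edges n. expectation (\<lambda>\<omega>. f e (entry e \<omega>)))"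
proof -
  have "indep_vars (\<lambda>_. borel) entry (edges n)"
    using indep_entries by (simp add: entry_def[abs_def] edges_def case_prod_unfold)
  from indep_vars_compose2[OF this assms(1)]
  have indep: "indep_vars (\<lambda>_. borel) (\<lambda>e \<omega>. f e (entry e \<omega>)) (edges n)" by simp
  show "integrable P (\<lambda>\<omega>. \<Prod>e\<in>edges n. f e (entry e \<omega>))"
    by (rule indep_vars_integrable[OF finite_edges indep]) (rule integrable_factors)
  show "expectation (\<lambda>\<omega>. \<Prod>e\<in>edges n. f e (entry e \<omega>))
      = (\<Prod>e\<in>edges n. expectation (\<lambda>\<omega>. f e (entry e \<omega>)))"
    by (rule indep_vars_lebesgue_integral[OF finite_edges indep]) (rule integrable_factors)
qed

lemma hermite_moments:
  assumes in_edges: "e \<in> edges n" and "k \<le> 2" "l \<le> 2"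
  shows integrable_hermite_mult:
      "integrable P (\<lambda>\<omega>. hermite (edge_var e) k (entry e \<omega>) * hermite (edge_var e) l (entry e \<omega>))"
    and expectation_hermite_orthogonal: "k \<noteq> l \<Longrightarrow>
      expectation (\<lambda>\<omega>. hermite (edge_var e) k (entry e \<omega>) * hermite (edge_var e) l (entry e \<omega>)) = 0"
    and expectation_hermite_square:
      "expectation (\<lambda>\<omega>. hermite (edge_var e) k (entry e \<omega>) * hermite (edge_var e) k (entry e \<omega>))
        \<le> (3 / real n) ^ k"
proof -
  note integrable_powers [simp] = integrable_entry_power[OF in_edges]
    integrable_entry_power[OF in_edges, of 1, simplified]
  note moments = entry_low_moments[OF in_edges]
  have k_cases: "k = 0 \<or> k = Suc 0 \<or> k = 2" and l_cases: "l = 0 \<or> l = Suc 0 \<or> l = 2"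
    using assms by auto
  have products: "z * (z\<^sup>2 - s) = z ^ 3 - s * z" "(z\<^sup>2 - s) * z = z ^ 3 - s * z" "z * z = z\<^sup>2"
    "(z\<^sup>2 - s) * (z\<^sup>2 - s) = z ^ 4 - 2 * s * z\<^sup>2 + s\<^sup>2" "(z\<^sup>2 - s)\<^sup>2 = z ^ 4 - 2 * s * z\<^sup>2 + s\<^sup>2"
      for z s :: real
    by (simp_all add: algebra_simps power2_eq_square power3_eq_cube power4_eq_xxxx)
  show "integrable P (\<lambda>\<omega>. hermite (edge_var e) k (entry e \<omega>) * hermite (edge_var e) l (entry e \<omega>))"
    using k_cases l_cases by (auto simp: hermite_2 products)
  show "k \<noteq> l \<Longrightarrow> expectation (\<lambda>\<omega>. hermite (edge_var e) k (entry e \<omega>) * hermite (edge_var e) l (entry e \<omega>)) = 0"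
    using k_cases l_cases moments by (auto simp: hermite_2 products prob_space)
  have real_n_pos: "real n > 0" using n_pos by simp
  have "(edge_var e)\<^sup>2 \<le> (2 / real n)\<^sup>2"
    using edge_var_le[of e] edge_var_pos[of e] by (intro power_mono) auto
  then have variance_2: "2 * (edge_var e)\<^sup>2 \<le> (3 / real n)\<^sup>2"
    using real_n_pos by (simp add: power_divide field_simps)
  have variance_1: "edge_var e \<le> 3 / real n"
    using edge_var_le[of e] real_n_pos by (auto simp: field_simps)
  show "expectation (\<lambda>\<omega>. hermite (edge_var e) k (entry e \<omega>) * hermite (edge_var e) k (entry e \<omega>))
      \<le> (3 / real n) ^ k"
    using k_cases
  proof (elim disjE)
    assume "k = 2"
    moreover have "expectation (\<lambda>\<omega>. entry e \<omega> ^ 4 - 2 * edge_var e * (entry e \<omega>)\<^sup>2 + (edge_var e)\<^sup>2)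
        = 2 * (edge_var e)\<^sup>2"
      using moments by (simp add: prob_space) (simp add: power2_eq_square)
    ultimately show ?thesis using variance_2 by (simp add: hermite_2 products)
  qed (use moments variance_1 in \<open>simp_all add: products prob_space\<close>)
qed

definition hermite_prod :: "(nat \<times> nat \<Rightarrow> nat) \<Rightarrow> 'w \<Rightarrow> real" where
  "hermite_prod k \<omega> = (\<Prod>e\<in>edges n. hermite (edge_var e) (k e) (entry e \<omega>))"

lemma measurable_hermite_prod [measurable]: "hermite_prod k \<in> borel_measurable P"
  unfolding hermite_prod_def[abs_def] by measurable

lemma hermite_prod_moments:
  assumes "\<forall>e. k e \<le> 2" "\<forall>e. l e \<le> 2"
  shows integrable_hermite_prod_mult: "integrable P (\<lambda>\<omega>. hermite_prod k \<omega> * hermite_prod l \<omega>)"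
    and expectation_hermite_prod_orthogonal:
      "\<exists>e\<in>edges n. k e \<noteq> l e \<Longrightarrow> expectation (\<lambda>\<omega>. hermite_prod k \<omega> * hermite_prod l \<omega>) = 0"
    and expectation_hermite_prod_square:
      "expectation (\<lambda>\<omega>. hermite_prod k \<omega> * hermite_prod k \<omega>) \<le> (3 / real n) ^ (\<Sum>e\<in>edges n. k e)"
proof -
  let ?h = "\<lambda>k l e z. hermite (edge_var e) (k e) z * hermite (edge_var e) (l e) z"
  have mult_eq: "hermite_prod k \<omega> * hermite_prod l \<omega> = (\<Prod>e\<in>edges n. ?h k l e (entry e \<omega>))" for k l \<omega>
    by (simp add: hermite_prod_def prod.distrib)
  have expectation_eq: "expectation (\<lambda>\<omega>. hermite_prod k \<omega> * hermite_prod l \<omega>)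
      = (\<Prod>e\<in>edges n. expectation (\<lambda>\<omega>. ?h k l e (entry e \<omega>)))"
    if "\<forall>e. k e \<le> 2" "\<forall>e. l e \<le> 2" for k l
    unfolding mult_eq using that
    by (auto intro!: expectation_prod_entries[of "?h k l"] integrable_hermite_mult)
  show "integrable P (\<lambda>\<omega>. hermite_prod k \<omega> * hermite_prod l \<omega>)"
    unfolding mult_eq using assms
    by (auto intro!: integrable_prod_entries[of "?h k l"] integrable_hermite_mult)
  show "expectation (\<lambda>\<omega>. hermite_prod k \<omega> * hermite_prod l \<omega>) = 0" if "\<exists>e\<in>edges n. k e \<noteq> l e"
    unfolding expectation_eq[OF assms] using that assms
    by (auto intro!: prod_zero bexI expectation_hermite_orthogonal)
  show "expectation (\<lambda>\<omega>. hermite_prod k \<omega> * hermite_prod k \<omega>) \<le> (3 / real n) ^ (\<Sum>e\<in>edges n. k e)"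
    unfolding expectation_eq[OF assms(1) assms(1)] power_sum
    using assms by (intro prod_mono) (auto intro!: expectation_hermite_square)
qed

lemma walk_prod_eq_hermite_prod:
  assumes "set xs \<subseteq> {..<n}" and "\<And>e. edge_count xs e \<le> 1"
  shows "walk_prod (Y \<omega>) xs = hermite_prod (edge_count xs) \<omega>"
proof -
  have "walk_prod (Y \<omega>) xs = (\<Prod>e\<in>edges n. Y \<omega> (fst e) (snd e) ^ edge_count xs e)"
    by (rule walk_prod_eq_prod_edges[OF assms(1) symmetric_Y])
  also have "\<dots> = hermite_prod (edge_count xs) \<omega>"
    unfolding hermite_prod_def
  proof (rule prod.cong)
    fix e
    have "edge_count xs e = 0 \<or> edge_count xs e = Suc 0" using assms(2)[of e] by auto
    then show "Y \<omega> (fst e) (snd e) ^ edge_count xs e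
        = hermite (edge_var e) (edge_count xs e) (entry e \<omega>)"
      by (auto simp: entry_def)
  qed simp
  finally show ?thesis .
qed

lemma walk_prod_backtrack:
  assumes distinct: "distinct (j # i # ys)" and in_range: "set (j # i # ys) \<subseteq> {..<n}"
  shows "walk_prod (Y \<omega>) (i # j # i # ys)
    = hermite_prod (edge_count (i # j # i # ys)) \<omega> + 1 / real n * walk_prod (Y \<omega>) (i # ys)"
proof -
  let ?e = "edge i j"
  let ?rest = "\<lambda>e. hermite (edge_var e) (edge_count (i # ys) e) (entry e \<omega>)"
  have in_edges: "?e \<in> edges n" using in_range by (auto intro: edge_in_edges)
  have Y_sym: "Y \<omega> j i = Y \<omega> i j" using in_range symmetric_Y[of \<omega>] by (auto simp: symmetric_def)
  have "(\<Prod>e\<in>edges n - {?e}. ?rest e) = hermite_prod (edge_count (i # ys)) \<omega>"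
    using prod.remove[OF finite_edges in_edges, of ?rest]
    by (simp add: hermite_prod_def edge_count_backtrack(2)[OF distinct])
  also have "\<dots> = walk_prod (Y \<omega>) (i # ys)"
    using distinct in_range
    by (intro walk_prod_eq_hermite_prod[symmetric] edge_count_distinct_le_1) auto
  finally have rest_eq: "(\<Prod>e\<in>edges n - {?e}. ?rest e) = walk_prod (Y \<omega>) (i # ys)" .
  have "hermite_prod (edge_count (i # j # i # ys)) \<omega>
      = hermite (edge_var ?e) 2 (entry ?e \<omega>) * (\<Prod>e\<in>edges n - {?e}. ?rest e)"
    unfolding hermite_prod_def
    by (subst prod.remove[OF finite_edges in_edges])
      (auto simp: edge_count_backtrack[OF distinct] simp del: edge_count.simps intro!: prod.cong)
  also have "\<dots> = ((Y \<omega> i j)\<^sup>2 - 1 / real n) * walk_prod (Y \<omega>) (i # ys)"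
    using distinct in_range by (simp add: rest_eq hermite_2 entry_edge edge_var_edge)
  finally show ?thesis
    by (simp add: Y_sym algebra_simps power2_eq_square del: edge_count.simps)
qed

lemma walk_prod_Cons_eq_hermite_prod:
  assumes "distinct xs" and in_range: "set (i # xs) \<subseteq> {..<n}"
  shows "walk_prod (Y \<omega>) (i # xs) = hermite_prod (edge_count (i # xs)) \<omega>
    + (if backtracks i xs then 1 / real n * walk_prod (Y \<omega>) (tl xs) else 0)"
proof (cases "backtracks i xs")
  case True
  then obtain j ys where xs_eq: "xs = j # i # ys" by (auto simp: backtracks_def)
  show ?thesis using walk_prod_backtrack[of j i ys \<omega>] assms True unfolding xs_eq by auto
next
  case False
  then show ?thesis
    using walk_prod_eq_hermite_prod[OF in_range edge_count_Cons_le_1[OF assms(1)]] by simp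
qed

end

section \<open>Second moments of walk sums\<close>

lemma card_same_edge_count_le:
  assumes subset_walks: "\<Gamma> \<subseteq> walks n k" and xs_in: "xs \<in> \<Gamma>"
    and vertices: "\<And>ys. ys \<in> \<Gamma> \<Longrightarrow> edge_count ys = edge_count xs \<Longrightarrow> set ys = set xs"
  shows "card {ys \<in> \<Gamma>. edge_count ys = edge_count xs} \<le> k ^ k"
proof -
  have length_walk: "length ys = k" if "ys \<in> \<Gamma>" for ys
    using subset_walks that by (auto simp: walks_def)
  have "{ys \<in> \<Gamma>. edge_count ys = edge_count xs} \<subseteq> {ys. set ys \<subseteq> set xs \<and> length ys = k}"
    using vertices length_walk by blast
  then have "card {ys \<in> \<Gamma>. edge_count ys = edge_count xs}
      \<le> card {ys. set ys \<subseteq> set xs \<and> length ys = k}"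
    by (intro card_mono finite_lists_length_eq) simp_all
  also have "\<dots> = card (set xs) ^ k" by (rule card_lists_length_eq) simp
  also have "\<dots> \<le> k ^ k"
    using card_length[of xs] length_walk[OF xs_in] by (intro power_mono) auto
  finally show ?thesis .
qed

definition walk_const :: "nat \<Rightarrow> real" where
  "walk_const k = real (Suc k ^ Suc k) * 3 ^ k"

lemma walk_const_nonneg [simp]: "0 \<le> walk_const k"
  by (simp add: walk_const_def)

context goe
begin

lemma expectation_hermite_prod_walks:
  assumes xs_le: "set xs \<subseteq> {..<n}" "\<And>e. edge_count xs e \<le> 2"
    and ys_le: "set ys \<subseteq> {..<n}" "\<And>e. edge_count ys e \<le> 2"
  defines "E \<equiv> expectation (\<lambda>\<omega>. hermite_prod (edge_count xs) \<omega> * hermite_prod (edge_count ys) \<omega>)"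
  shows "edge_count ys \<noteq> edge_count xs \<Longrightarrow> E = 0"
    and "edge_count ys = edge_count xs \<Longrightarrow> \<bar>E\<bar> \<le> (3 / real n) ^ (length xs - 1)"
proof -
  assume "edge_count ys \<noteq> edge_count xs"
  then obtain e where count_neq: "edge_count xs e \<noteq> edge_count ys e" by fastforce
  then have "edge_count xs e > 0 \<or> edge_count ys e > 0" by auto
  then have "e \<in> edges n" using edge_count_pos_imp_in_edges xs_le(1) ys_le(1) by blast
  then show "E = 0"
    unfolding E_def
    using count_neq xs_le(2) ys_le(2) by (intro expectation_hermite_prod_orthogonal) auto
next
  assume same_count: "edge_count ys = edge_count xs"
  have "0 \<le> E" unfolding E_def same_count by (intro integral_nonneg_AE) simp
  moreover have "E \<le> (3 / real n) ^ (length xs - 1)"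
    unfolding E_def same_count sum_edge_count[OF xs_le(1), symmetric]
    using xs_le(2) by (intro expectation_hermite_prod_square) auto
  ultimately show "\<bar>E\<bar> \<le> (3 / real n) ^ (length xs - 1)" by simp
qed

text \<open>Distinct edge counts give orthogonal polynomials, and the edge count of a walk determines its
  vertex set, hence the walk up to boundedly many choices.\<close>

lemma second_moment_walk_sum:
  assumes subset_walks: "\<Gamma> \<subseteq> walks n (Suc k)"
    and count_le_2: "\<And>xs e. xs \<in> \<Gamma> \<Longrightarrow> edge_count xs e \<le> 2"
    and vertices: "\<And>xs ys. xs \<in> \<Gamma> \<Longrightarrow> ys \<in> \<Gamma> \<Longrightarrow> edge_count ys = edge_count xs \<Longrightarrow> set ys = set xs"
  shows "integrable P (\<lambda>\<omega>. (\<Sum>xs\<in>\<Gamma>. c xs * hermite_prod (edge_count xs) \<omega>)\<^sup>2)"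
    and "expectation (\<lambda>\<omega>. (\<Sum>xs\<in>\<Gamma>. c xs * hermite_prod (edge_count xs) \<omega>)\<^sup>2)
      \<le> walk_const k / real n ^ k * (\<Sum>xs\<in>\<Gamma>. (c xs)\<^sup>2)"
proof -
  let ?E = "\<lambda>xs ys. expectation (\<lambda>\<omega>. hermite_prod (edge_count xs) \<omega> * hermite_prod (edge_count ys) \<omega>)"
  have walk: "set xs \<subseteq> {..<n}" "length xs - 1 = k" if "xs \<in> \<Gamma>" for xs
    using subset_walks that by (auto simp: walks_def)
  have finite_\<Gamma>: "finite \<Gamma>" using subset_walks finite_walks finite_subset by blast
  have integrable_products: "integrable P
      (\<lambda>\<omega>. hermite_prod (edge_count xs) \<omega> * hermite_prod (edge_count ys) \<omega>)"
    if "xs \<in> \<Gamma>" "ys \<in> \<Gamma>" for xs ys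
    using that count_le_2 by (intro integrable_hermite_prod_mult) auto
  have orthogonal: "?E xs ys = 0" if "xs \<in> \<Gamma>" "ys \<in> \<Gamma>" "edge_count ys \<noteq> edge_count xs" for xs ys
    using that walk(1) count_le_2 by (intro expectation_hermite_prod_walks(1)) auto
  have bound: "\<bar>?E xs ys\<bar> \<le> (3 / real n) ^ k"
    if "xs \<in> \<Gamma>" "ys \<in> \<Gamma>" "edge_count ys = edge_count xs" for xs ys
    using expectation_hermite_prod_walks(2)[of xs ys] that walk count_le_2 by simp
  have fibre_bound: "card {ys \<in> \<Gamma>. edge_count ys = edge_count xs} \<le> Suc k ^ Suc k" if "xs \<in> \<Gamma>" for xs
    using subset_walks that by (rule card_same_edge_count_le) (rule vertices[OF that])
  have nonneg: "0 \<le> (3 / real n) ^ k" by simp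
  note moment = second_moment_sum_le[of \<Gamma> "\<lambda>xs. hermite_prod (edge_count xs)" edge_count,
      OF finite_\<Gamma> integrable_products orthogonal bound fibre_bound nonneg]
  show "integrable P (\<lambda>\<omega>. (\<Sum>xs\<in>\<Gamma>. c xs * hermite_prod (edge_count xs) \<omega>)\<^sup>2)"
    by (rule moment(1))
  have "real (Suc k ^ Suc k) * (3 / real n) ^ k = walk_const k / real n ^ k"
    by (simp add: walk_const_def power_divide)
  then show "expectation (\<lambda>\<omega>. (\<Sum>xs\<in>\<Gamma>. c xs * hermite_prod (edge_count xs) \<omega>)\<^sup>2)
      \<le> walk_const k / real n ^ k * (\<Sum>xs\<in>\<Gamma>. (c xs)\<^sup>2)"
    by (elim subst) (rule moment(2))
qed

lemma second_moment_walk_sum_Cons: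
  assumes S_simple: "S \<subseteq> simple_walks n k" and i_range: "i < n"
  shows "integrable P (\<lambda>\<omega>. (\<Sum>xs\<in>S. c xs * hermite_prod (edge_count (i # xs)) \<omega>)\<^sup>2)"
    and "expectation (\<lambda>\<omega>. (\<Sum>xs\<in>S. c xs * hermite_prod (edge_count (i # xs)) \<omega>)\<^sup>2)
      \<le> walk_const k / real n ^ k * (\<Sum>xs\<in>S. (c xs)\<^sup>2)"
proof -
  have subset_walks: "(#) i ` S \<subseteq> walks n (Suc k)"
    using S_simple i_range by (auto simp: simple_walks_def)
  have count_le_2: "edge_count xs e \<le> 2" if "xs \<in> (#) i ` S" for xs e
    using that S_simple by (auto simp: simple_walks_def intro: edge_count_Cons_le_2)
  have vertices: "set ys = set xs"
    if "xs \<in> (#) i ` S" "ys \<in> (#) i ` S" "edge_count ys = edge_count xs" for xs ys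
  proof (cases k)
    case 0
    then show ?thesis using that S_simple by auto
  next
    case (Suc l)
    then have "length xs \<ge> 2" "length ys \<ge> 2" using that(1,2) subset_walks by (auto simp: walks_def)
    then show ?thesis using that(3) by (simp add: set_eq_edge_ends)
  qed
  have reindex: "(\<Sum>xs\<in>(#) i ` S. f (tl xs) xs) = (\<Sum>xs\<in>S. f xs (i # xs))"
    for f :: "nat list \<Rightarrow> nat list \<Rightarrow> real"
    by (subst sum.reindex) auto
  note moment = second_moment_walk_sum[OF subset_walks count_le_2 vertices, of "\<lambda>xs. c (tl xs)",
      unfolded reindex[of "\<lambda>x xs. c x * hermite_prod (edge_count xs) _"] reindex[of "\<lambda>x xs. (c x)\<^sup>2"]]
  show "integrable P (\<lambda>\<omega>. (\<Sum>xs\<in>S. c xs * hermite_prod (edge_count (i # xs)) \<omega>)\<^sup>2)"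
    by (rule moment(1))
  show "expectation (\<lambda>\<omega>. (\<Sum>xs\<in>S. c xs * hermite_prod (edge_count (i # xs)) \<omega>)\<^sup>2)
      \<le> walk_const k / real n ^ k * (\<Sum>xs\<in>S. (c xs)\<^sup>2)"
    by (rule moment(2))
qed

lemma second_moment_walk_vector:
  fixes c :: "nat \<Rightarrow> nat list \<Rightarrow> real"
  assumes S_simple: "\<And>i. S i \<subseteq> simple_walks n k"
  defines "X \<equiv> \<lambda>\<omega> i. \<Sum>xs\<in>S i. c i xs * hermite_prod (edge_count (i # xs)) \<omega>"
  shows "integrable P (\<lambda>\<omega>. sqnorm n (X \<omega>))"
    and "expectation (\<lambda>\<omega>. sqnorm n (X \<omega>)) \<le> walk_const k / real n ^ k * (\<Sum>i<n. \<Sum>xs\<in>S i. (c i xs)\<^sup>2)"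
proof -
  note moment = second_moment_walk_sum_Cons[OF S_simple]
  show "integrable P (\<lambda>\<omega>. sqnorm n (X \<omega>))"
    unfolding sqnorm_def X_def using moment(1) by (intro Bochner_Integration.integrable_sum) auto
  have "expectation (\<lambda>\<omega>. sqnorm n (X \<omega>)) = (\<Sum>i<n. expectation (\<lambda>\<omega>. (X \<omega> i)\<^sup>2))"
    unfolding sqnorm_def X_def using moment(1) by (intro Bochner_Integration.integral_sum) auto
  also have "\<dots> \<le> (\<Sum>i<n. walk_const k / real n ^ k * (\<Sum>xs\<in>S i. (c i xs)\<^sup>2))"
    unfolding X_def by (intro sum_mono moment(2)) auto
  finally show "expectation (\<lambda>\<omega>. sqnorm n (X \<omega>))
      \<le> walk_const k / real n ^ k * (\<Sum>i<n. \<Sum>xs\<in>S i. (c i xs)\<^sup>2)"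
    by (simp only: sum_distrib_left)
qed

lemma second_moment_vinner_path_vec:
  assumes contractions: "\<forall>D\<in>set Ds. contraction n D" and nonempty: "Ds \<noteq> []"
  shows "integrable P (\<lambda>\<omega>. (vinner n u (path_vec n (Y \<omega>) Ds v))\<^sup>2)"
    and "expectation (\<lambda>\<omega>. (vinner n u (path_vec n (Y \<omega>) Ds v))\<^sup>2)
      \<le> walk_const (length Ds) * sqnorm n u * sqnorm n v / real n"
proof -
  obtain l where length_Ds: "length Ds = Suc l" using nonempty by (cases Ds) auto
  let ?k = "length Ds"
  let ?G = "simple_walks n (Suc ?k)"
  let ?c = "\<lambda>xs. u (hd xs) * weight Ds v xs"
  have walk: "set xs \<subseteq> {..<n}" "length xs \<ge> 2" "edge_count xs e \<le> 1" if "xs \<in> ?G" for xs e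
    using that length_Ds edge_count_distinct_le_1 by (auto simp: simple_walks_def walks_def)
  have expand: "vinner n u (path_vec n (Y \<omega>) Ds v) = (\<Sum>xs\<in>?G. ?c xs * hermite_prod (edge_count xs) \<omega>)"
    for \<omega>
    unfolding vinner_path_vec
    using walk by (intro sum.cong refl) (simp add: walk_prod_eq_hermite_prod)
  have vertices: "set ys = set xs" if "xs \<in> ?G" "ys \<in> ?G" "edge_count ys = edge_count xs" for xs ys
    using that walk by (simp add: set_eq_edge_ends)
  have count_le_2: "edge_count xs e \<le> 2" if "xs \<in> ?G" for xs e using walk(3)[OF that, of e] by simp
  note moment = second_moment_walk_sum[where c = ?c, OF simple_walks_subset count_le_2 vertices]
  show "integrable P (\<lambda>\<omega>. (vinner n u (path_vec n (Y \<omega>) Ds v))\<^sup>2)"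
    unfolding expand by (rule moment(1))
  have "(\<Sum>xs\<in>?G. (?c xs)\<^sup>2) \<le> (\<Sum>xs\<in>?G. (u (hd xs))\<^sup>2 * (v (last xs))\<^sup>2)"
    unfolding power_mult_distrib
    using simple_walks_subset
    by (intro sum_mono mult_left_mono weight_square_le[OF contractions]) auto
  also have "\<dots> \<le> (\<Sum>xs\<in>walks n (Suc ?k). (u (hd xs))\<^sup>2 * (v (last xs))\<^sup>2)"
    by (intro sum_mono2 simple_walks_subset) auto
  also have "\<dots> = real n ^ l * sqnorm n u * sqnorm n v"
    unfolding length_Ds sqnorm_def by (rule sum_walks_hd_last)
  finally have coeffs: "(\<Sum>xs\<in>?G. (?c xs)\<^sup>2) \<le> real n ^ l * sqnorm n u * sqnorm n v" .
  have "expectation (\<lambda>\<omega>. (vinner n u (path_vec n (Y \<omega>) Ds v))\<^sup>2)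
      \<le> walk_const ?k / real n ^ ?k * (\<Sum>xs\<in>?G. (?c xs)\<^sup>2)"
    unfolding expand by (rule moment(2))
  also have "\<dots> \<le> walk_const ?k / real n ^ ?k * (real n ^ l * sqnorm n u * sqnorm n v)"
    by (intro mult_left_mono coeffs) auto
  also have "\<dots> = walk_const ?k * sqnorm n u * sqnorm n v / real n"
    using n_pos by (simp add: length_Ds)
  finally show "expectation (\<lambda>\<omega>. (vinner n u (path_vec n (Y \<omega>) Ds v))\<^sup>2)
      \<le> walk_const ?k * sqnorm n u * sqnorm n v / real n" .
qed

definition loop_part :: "(nat \<Rightarrow> real) \<Rightarrow> (nat \<Rightarrow> real) list \<Rightarrow> (nat \<Rightarrow> real) \<Rightarrow> 'w \<Rightarrow> nat \<Rightarrow> real" where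
  "loop_part D Ds v \<omega> i = (\<Sum>xs | xs \<in> simple_walks n (Suc (length Ds)) \<and> i \<in> set xs.
     weight (D # Ds) v (i # xs) * hermite_prod (edge_count (i # xs)) \<omega>)"

text \<open>\<open>mean n D\<close> sums over all vertices, but a backtracking step can only use the vertices that do not
  lie on the rest of the path.\<close>

fun overcount :: "(nat \<Rightarrow> real) \<Rightarrow> (nat \<Rightarrow> real) list \<Rightarrow> (nat \<Rightarrow> real) \<Rightarrow> 'w \<Rightarrow> nat \<Rightarrow> real" where
  "overcount D [] v \<omega> i = 0"
| "overcount D (D1 # Ds) v \<omega> i = (\<Sum>ys | ys \<in> simple_walks n (length Ds) \<and> i \<notin> set ys.
     (\<Sum>j\<in>set (i # ys). D j) / real n * (D1 i * weight Ds v (i # ys))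
       * hermite_prod (edge_count (i # ys)) \<omega>)"

lemma sum_backtracking_eq:
  assumes i_range: "i < n"
  shows "(\<Sum>xs | xs \<in> simple_walks n (Suc (Suc (length Ds))) \<and> backtracks i xs.
      weight (D # D1 # Ds) v (i # xs) * (1 / real n * walk_prod (Y \<omega>) (tl xs)))
    = mean n D * (D1 i * path_vec n (Y \<omega>) Ds v i) - overcount D (D1 # Ds) v \<omega> i"
proof -
  let ?Y = "{ys. ys \<in> simple_walks n (length Ds) \<and> i \<notin> set ys}"
  let ?t = "\<lambda>ys. D1 i * weight Ds v (i # ys) * walk_prod (Y \<omega>) (i # ys)"
  have "(\<Sum>xs | xs \<in> simple_walks n (Suc (Suc (length Ds))) \<and> backtracks i xs.
      weight (D # D1 # Ds) v (i # xs) * (1 / real n * walk_prod (Y \<omega>) (tl xs)))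
    = (\<Sum>ys\<in>?Y. \<Sum>j\<in>{..<n} - set (i # ys). D j * ?t ys / real n)"
    by (simp add: sum_backtracking_walks[OF i_range] mult.assoc)
  also have "\<dots> = (\<Sum>ys\<in>?Y. (mean n D - (\<Sum>j\<in>set (i # ys). D j) / real n) * ?t ys)"
  proof (rule sum.cong)
    fix ys assume "ys \<in> ?Y"
    then have "set (i # ys) \<subseteq> {..<n}" using i_range by (auto simp: simple_walks_def walks_def)
    then have "(\<Sum>j\<in>{..<n} - set (i # ys). D j) = (\<Sum>j<n. D j) - (\<Sum>j\<in>set (i # ys). D j)"
      by (intro sum_diff) auto
    then show "(\<Sum>j\<in>{..<n} - set (i # ys). D j * ?t ys / real n)
        = (mean n D - (\<Sum>j\<in>set (i # ys). D j) / real n) * ?t ys"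
      unfolding sum_divide_distrib[symmetric] sum_distrib_right[symmetric]
      by (simp only: mean_def diff_divide_distrib[symmetric] times_divide_eq_left)
  qed simp
  also have "\<dots> = (\<Sum>ys\<in>?Y. mean n D * ?t ys)
      - (\<Sum>ys\<in>?Y. (\<Sum>j\<in>set (i # ys). D j) / real n * ?t ys)"
    by (simp only: left_diff_distrib sum_subtractf)
  also have "(\<Sum>ys\<in>?Y. (\<Sum>j\<in>set (i # ys). D j) / real n * ?t ys) = overcount D (D1 # Ds) v \<omega> i"
    unfolding overcount.simps
  proof (intro sum.cong refl)
    fix ys assume "ys \<in> ?Y"
    then have "walk_prod (Y \<omega>) (i # ys) = hermite_prod (edge_count (i # ys)) \<omega>"
      using i_range
      by (intro walk_prod_eq_hermite_prod edge_count_distinct_le_1)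
        (auto simp: simple_walks_def walks_def)
    then show "(\<Sum>j\<in>set (i # ys). D j) / real n * ?t ys = (\<Sum>j\<in>set (i # ys). D j) / real n
        * (D1 i * weight Ds v (i # ys)) * hermite_prod (edge_count (i # ys)) \<omega>"
      by simp
  qed
  finally show ?thesis by (simp add: path_vec_def sum_distrib_left mult.assoc)
qed

lemma matvec_path_vec_eq:
  assumes i_range: "i < n"
  shows "matvec n (Y \<omega>) (D * path_vec n (Y \<omega>) Ds v) i
      = path_vec n (Y \<omega>) (D # Ds) v i + loop_part D Ds v \<omega> i
    + (\<Sum>xs | xs \<in> simple_walks n (Suc (length Ds)) \<and> backtracks i xs.
        weight (D # Ds) v (i # xs) * (1 / real n * walk_prod (Y \<omega>) (tl xs)))"
proof -
  let ?W = "simple_walks n (Suc (length Ds))"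
  let ?t = "\<lambda>xs. weight (D # Ds) v (i # xs)"
  let ?b = "\<lambda>xs. 1 / real n * walk_prod (Y \<omega>) (tl xs)"
  have "(\<Sum>xs\<in>?W. ?t xs * walk_prod (Y \<omega>) (i # xs))
      = (\<Sum>xs | xs \<in> ?W \<and> i \<notin> set xs. ?t xs * walk_prod (Y \<omega>) (i # xs))
        + (\<Sum>xs | xs \<in> ?W \<and> i \<in> set xs. ?t xs * walk_prod (Y \<omega>) (i # xs))"
    by (subst sum.union_disjoint[symmetric]) (auto intro!: sum.cong)
  also have "(\<Sum>xs | xs \<in> ?W \<and> i \<in> set xs. ?t xs * walk_prod (Y \<omega>) (i # xs))
      = (\<Sum>xs | xs \<in> ?W \<and> i \<in> set xs. ?t xs * hermite_prod (edge_count (i # xs)) \<omega>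
          + (if backtracks i xs then ?t xs * ?b xs else 0))"
    using i_range by (intro sum.cong refl)
      (auto simp: walk_prod_Cons_eq_hermite_prod simple_walks_def walks_def distrib_left
        simp del: weight.simps)
  also have "\<dots> = loop_part D Ds v \<omega> i + (\<Sum>xs | xs \<in> ?W \<and> backtracks i xs. ?t xs * ?b xs)"
    unfolding sum.distrib loop_part_def
    by (intro arg_cong2[where f = "(+)"] refl sum.mono_neutral_cong_right)
      (auto simp: backtracks_def)
  finally show ?thesis by (simp add: matvec_path_vec path_vec_def)
qed

lemma path_step_error_eq:
  assumes "i < n"
  shows "path_step_error n (Y \<omega>) D Ds v i = loop_part D Ds v \<omega> i - overcount D Ds v \<omega> i"
proof (cases Ds)
  case Nil
  have "(\<Sum>xs | xs \<in> simple_walks n (Suc 0) \<and> backtracks i xs. f xs) = 0" for f :: "nat list \<Rightarrow> real"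
    by (rule sum.neutral) (auto simp: backtracks_def simple_walks_def walks_def)
  then show ?thesis
    using Nil matvec_path_vec_eq[OF assms, of \<omega> D "[]" v] by (simp add: path_step_error_def)
next
  case (Cons D1 Ds1)
  then show ?thesis
    unfolding Cons path_step_error_def minus_apply list.case times_fun_apply
      matvec_path_vec_eq[OF assms] list.size add_0_right add_Suc_right sum_backtracking_eq[OF assms]
    by simp
qed

lemma loop_part_second_moment:
  assumes contractions: "\<forall>D\<in>set (D # Ds). contraction n D"
  shows "integrable P (\<lambda>\<omega>. sqnorm n (loop_part D Ds v \<omega>))"
    and "expectation (\<lambda>\<omega>. sqnorm n (loop_part D Ds v \<omega>))
      \<le> walk_const (Suc (length Ds)) * real (Suc (length Ds)) * sqnorm n v / real n"
proof -
  let ?k = "length Ds"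
  let ?S = "\<lambda>i. {xs. xs \<in> simple_walks n (Suc ?k) \<and> i \<in> set xs}"
  note moment = second_moment_walk_vector[where S = ?S and c = "\<lambda>i xs. weight (D # Ds) v (i # xs)"
    and k = "Suc ?k"]
  show "integrable P (\<lambda>\<omega>. sqnorm n (loop_part D Ds v \<omega>))"
    using moment(1) by (auto simp: loop_part_def[abs_def])
  have "(weight (D # Ds) v (i # xs))\<^sup>2 \<le> (v (last xs))\<^sup>2" if "i < n" "xs \<in> ?S i" for i xs
    using weight_square_le[OF contractions, of "i # xs" v] that
    by (auto simp: simple_walks_def walks_def split: if_splits)
  then have "(\<Sum>i<n. \<Sum>xs\<in>?S i. (weight (D # Ds) v (i # xs))\<^sup>2) \<le> (\<Sum>i<n. \<Sum>xs\<in>?S i. (v (last xs))\<^sup>2)"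
    by (intro sum_mono) auto
  also have "\<dots> \<le> real (Suc ?k) * real n ^ ?k * sqnorm n v"
    unfolding sqnorm_def by (rule sum_simple_walks_through_le) simp
  finally have coeffs: "(\<Sum>i<n. \<Sum>xs\<in>?S i. (weight (D # Ds) v (i # xs))\<^sup>2)
      \<le> real (Suc ?k) * real n ^ ?k * sqnorm n v" .
  have "expectation (\<lambda>\<omega>. sqnorm n (loop_part D Ds v \<omega>))
      \<le> walk_const (Suc ?k) / real n ^ Suc ?k * (\<Sum>i<n. \<Sum>xs\<in>?S i. (weight (D # Ds) v (i # xs))\<^sup>2)"
    unfolding loop_part_def[abs_def] by (rule moment(2)) auto
  also have "\<dots> \<le> walk_const (Suc ?k) / real n ^ Suc ?k * (real (Suc ?k) * real n ^ ?k * sqnorm n v)"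
    by (intro mult_left_mono coeffs) auto
  also have "\<dots> = walk_const (Suc ?k) * real (Suc ?k) * sqnorm n v / real n"
    using n_pos by simp
  finally show "expectation (\<lambda>\<omega>. sqnorm n (loop_part D Ds v \<omega>))
      \<le> walk_const (Suc ?k) * real (Suc ?k) * sqnorm n v / real n" .
qed

lemma overcount_coefficient_square_le:
  assumes contractions: "\<forall>D\<in>set (D # D1 # Ds). contraction n D"
    and walk: "i # ys \<in> walks n (Suc (length Ds))"
  shows "((\<Sum>j\<in>set (i # ys). D j) / real n * (D1 i * weight Ds v (i # ys)))\<^sup>2
    \<le> (real (Suc (length Ds)) / real n)\<^sup>2 * (v (last (i # ys)))\<^sup>2"
proof -
  have "\<bar>\<Sum>j\<in>set (i # ys). D j\<bar> \<le> (\<Sum>j\<in>set (i # ys). 1)"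
    using contractions walk
    by (intro order_trans[OF sum_abs] sum_mono) (auto simp: contraction_def walks_def)
  also have "\<dots> \<le> real (Suc (length Ds))"
    using card_length[of "i # ys"] walk by (simp add: walks_def)
  finally have "((\<Sum>j\<in>set (i # ys). D j) / real n)\<^sup>2 \<le> (real (Suc (length Ds)) / real n)\<^sup>2"
    unfolding abs_le_square_iff[symmetric] by (simp add: divide_right_mono)
  moreover have "(D1 i * weight Ds v (i # ys))\<^sup>2 \<le> (v (last (i # ys)))\<^sup>2"
    using contractions walk
    by (intro order_trans[OF square_contraction_mult_le weight_square_le]) auto
  ultimately show ?thesis
    unfolding power_mult_distrib[of "_ / _"] by (intro mult_mono) auto
qed

lemma overcount_second_moment:
  assumes contractions: "\<forall>D\<in>set (D # D1 # Ds). contraction n D"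
  shows "integrable P (\<lambda>\<omega>. sqnorm n (overcount D (D1 # Ds) v \<omega>))"
    and "expectation (\<lambda>\<omega>. sqnorm n (overcount D (D1 # Ds) v \<omega>))
      \<le> walk_const (length Ds) * (real (Suc (length Ds)))\<^sup>2 * sqnorm n v / real n"
proof -
  let ?k = "length Ds"
  let ?S = "\<lambda>i. {ys. ys \<in> simple_walks n ?k \<and> i \<notin> set ys}"
  let ?c = "\<lambda>i ys. (\<Sum>j\<in>set (i # ys). D j) / real n * (D1 i * weight Ds v (i # ys))"
  let ?r = "(real (Suc ?k) / real n)\<^sup>2"
  note moment = second_moment_walk_vector[where S = ?S and c = ?c and k = ?k]
  show "integrable P (\<lambda>\<omega>. sqnorm n (overcount D (D1 # Ds) v \<omega>))"
    unfolding overcount.simps[abs_def] by (rule moment(1)) auto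
  have "(?c i ys)\<^sup>2 \<le> ?r * (v (last (i # ys)))\<^sup>2" if "i < n" "ys \<in> ?S i" for i ys
    using that
    by (intro overcount_coefficient_square_le[OF contractions]) (auto simp: simple_walks_def)
  then have "(\<Sum>i<n. \<Sum>ys\<in>?S i. (?c i ys)\<^sup>2) \<le> (\<Sum>i<n. \<Sum>ys\<in>?S i. ?r * (v (last (i # ys)))\<^sup>2)"
    by (intro sum_mono) auto
  also have "\<dots> = ?r * (\<Sum>xs\<in>simple_walks n (Suc ?k). (v (last xs))\<^sup>2)"
    by (simp only: sum_simple_walks_Suc sum_distrib_left)
  also have "\<dots> \<le> ?r * (real n ^ ?k * sqnorm n v)"
    unfolding sqnorm_def by (intro mult_left_mono sum_simple_walks_last_le) auto
  finally have coeffs: "(\<Sum>i<n. \<Sum>ys\<in>?S i. (?c i ys)\<^sup>2) \<le> ?r * (real n ^ ?k * sqnorm n v)" .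
  have "expectation (\<lambda>\<omega>. sqnorm n (overcount D (D1 # Ds) v \<omega>))
      \<le> walk_const ?k / real n ^ ?k * (\<Sum>i<n. \<Sum>ys\<in>?S i. (?c i ys)\<^sup>2)"
    unfolding overcount.simps[abs_def] by (rule moment(2)) auto
  also have "\<dots> \<le> walk_const ?k / real n ^ ?k * (?r * (real n ^ ?k * sqnorm n v))"
    by (intro mult_left_mono coeffs) auto
  also have "\<dots> = walk_const ?k * (real (Suc ?k))\<^sup>2 * sqnorm n v / (real n * real n)"
    using n_pos by (simp add: power2_eq_square)
  also have "\<dots> \<le> walk_const ?k * (real (Suc ?k))\<^sup>2 * sqnorm n v / (real n * 1)"
    using n_pos by (intro divide_left_mono mult_left_mono) auto
  finally show "expectation (\<lambda>\<omega>. sqnorm n (overcount D (D1 # Ds) v \<omega>))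
      \<le> walk_const ?k * (real (Suc ?k))\<^sup>2 * sqnorm n v / real n" by simp
qed

end

definition step_const :: "nat \<Rightarrow> real" where
  "step_const k = 2 * walk_const (Suc k) * real (Suc k) + 2 * walk_const (k - 1) * (real k)\<^sup>2"

lemma step_const_nonneg: "0 \<le> step_const k"
  by (simp add: step_const_def)

lemma (in goe) path_step_error_second_moment:
  assumes contractions: "\<forall>D\<in>set (D # Ds). contraction n D"
  shows "integrable P (\<lambda>\<omega>. sqnorm n (path_step_error n (Y \<omega>) D Ds v))"
    and "expectation (\<lambda>\<omega>. sqnorm n (path_step_error n (Y \<omega>) D Ds v))
      \<le> step_const (length Ds) * sqnorm n v / real n"
proof -
  let ?l = "\<lambda>\<omega>. loop_part D Ds v \<omega>" and ?o = "\<lambda>\<omega>. overcount D Ds v \<omega>"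
  note loop = loop_part_second_moment[OF contractions, of v]
  have overcount: "integrable P (\<lambda>\<omega>. sqnorm n (?o \<omega>))"
    "expectation (\<lambda>\<omega>. sqnorm n (?o \<omega>))
      \<le> walk_const (length Ds - 1) * (real (length Ds))\<^sup>2 * sqnorm n v / real n"
    using contractions overcount_second_moment[where v = v] by (cases Ds; auto simp: sqnorm_def)+
  have bound: "integrable P (\<lambda>\<omega>. 2 * sqnorm n (?l \<omega>) + 2 * sqnorm n (?o \<omega>))"
    using loop(1) overcount(1) by simp
  have error_eq: "sqnorm n (path_step_error n (Y \<omega>) D Ds v) = sqnorm n (?l \<omega> - ?o \<omega>)" for \<omega>
    by (simp add: sqnorm_def path_step_error_eq)
  have measurable_error: "(\<lambda>\<omega>. sqnorm n (path_step_error n (Y \<omega>) D Ds v)) \<in> borel_measurable P"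
    unfolding error_eq unfolding sqnorm_def minus_apply loop_part_def by (cases Ds) simp_all
  show integrable_error: "integrable P (\<lambda>\<omega>. sqnorm n (path_step_error n (Y \<omega>) D Ds v))"
    by (rule Bochner_Integration.integrable_bound[OF bound measurable_error])
      (simp add: error_eq sqnorm_diff_le)
  have "expectation (\<lambda>\<omega>. sqnorm n (path_step_error n (Y \<omega>) D Ds v))
      \<le> expectation (\<lambda>\<omega>. 2 * sqnorm n (?l \<omega>) + 2 * sqnorm n (?o \<omega>))"
    by (rule integral_mono[OF integrable_error bound]) (simp add: error_eq sqnorm_diff_le)
  also have "\<dots> = 2 * expectation (\<lambda>\<omega>. sqnorm n (?l \<omega>)) + 2 * expectation (\<lambda>\<omega>. sqnorm n (?o \<omega>))"
    using loop(1) overcount(1) by simp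
  also have "\<dots> \<le> 2 * (walk_const (Suc (length Ds)) * real (Suc (length Ds)) * sqnorm n v / real n)
      + 2 * (walk_const (length Ds - 1) * (real (length Ds))\<^sup>2 * sqnorm n v / real n)"
    by (intro add_mono mult_left_mono loop(2) overcount(2)) auto
  also have "\<dots> = step_const (length Ds) * sqnorm n v / real n"
    by (simp only: step_const_def distrib_right add_divide_distrib times_divide_eq_right mult.assoc)
  finally show "expectation (\<lambda>\<omega>. sqnorm n (path_step_error n (Y \<omega>) D Ds v))
      \<le> step_const (length Ds) * sqnorm n v / real n" .
qed

section \<open>Trace moments\<close>

lemma matvec_pow_walks:
  "(matvec n A ^^ m) x i = (\<Sum>xs\<in>walks n m. walk_prod A (i # xs) * x (last (i # xs)))"
proof (induction m arbitrary: i)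
  case (Suc m)
  have "(matvec n A ^^ Suc m) x i
      = (\<Sum>j<n. A i j * (\<Sum>xs\<in>walks n m. walk_prod A (j # xs) * x (last (j # xs))))"
    by (simp add: matvec_def Suc[abs_def] del: last.simps)
  also have "\<dots> = (\<Sum>j<n. \<Sum>xs\<in>walks n m. walk_prod A (i # j # xs) * x (last (i # j # xs)))"
    by (simp add: sum_distrib_left mult.assoc)
  finally show ?case by (simp only: sum_walks_Suc)
qed simp

definition unit_vec :: "nat \<Rightarrow> nat \<Rightarrow> real" where
  "unit_vec j i = of_bool (i = j)"

lemma sum_unit_vec: "i < n \<Longrightarrow> (\<Sum>j<n. unit_vec j i * f j) = f i"
  by (simp add: unit_vec_def)

lemma vinner_unit_vec: "j < n \<Longrightarrow> vinner n (unit_vec j) x = x j"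
  by (simp add: unit_vec_def vinner_def)

lemma matvec_pow_expand:
  "i < n \<Longrightarrow> (matvec n A ^^ m) x i = (\<Sum>j<n. (matvec n A ^^ m) (unit_vec j) i * x j)"
proof (induction m arbitrary: i)
  case 0
  then show ?case by (simp add: sum_unit_vec)
next
  case (Suc m)
  have "(matvec n A ^^ Suc m) x i = (\<Sum>k<n. A i k * (\<Sum>j<n. (matvec n A ^^ m) (unit_vec j) k * x j))"
    using Suc.IH by (simp add: matvec_def[of n A "(matvec n A ^^ m) x"])
  also have "\<dots> = (\<Sum>j<n. \<Sum>k<n. A i k * (matvec n A ^^ m) (unit_vec j) k * x j)"
    unfolding sum_distrib_left mult.assoc by (rule sum.swap)
  also have "\<dots> = (\<Sum>j<n. (matvec n A ^^ Suc m) (unit_vec j) i * x j)"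
    by (simp add: matvec_def sum_distrib_right)
  finally show ?case .
qed

definition trace_pow :: "nat \<Rightarrow> (nat \<Rightarrow> nat \<Rightarrow> real) \<Rightarrow> nat \<Rightarrow> real" where
  "trace_pow n A k = (\<Sum>j<n. (matvec n A ^^ k) (unit_vec j) j)"

lemma trace_pow_walks:
  "trace_pow n A k = (\<Sum>xs\<in>walks n (Suc k). of_bool (last xs = hd xs) * walk_prod A xs)"
  unfolding trace_pow_def sum_walks_Suc matvec_pow_walks unit_vec_def by (simp add: mult.commute)

lemma trace_pow_even:
  assumes "symmetric n A"
  shows "trace_pow n A (2 * m) = (\<Sum>j<n. sqnorm n ((matvec n A ^^ m) (unit_vec j)))"
  by (simp add: trace_pow_def sqnorm_matvec_pow[OF assms] vinner_unit_vec)

lemma trace_pow_even_nonneg: "symmetric n A \<Longrightarrow> 0 \<le> trace_pow n A (2 * m)"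
  by (simp add: trace_pow_even sum_nonneg)

lemma sqnorm_matvec_pow_le:
  assumes "symmetric n A"
  shows "sqnorm n ((matvec n A ^^ m) x) \<le> sqnorm n x * trace_pow n A (2 * m)"
proof -
  let ?G = "\<lambda>i j. (matvec n A ^^ m) (unit_vec j) i"
  have "sqnorm n ((matvec n A ^^ m) x) = (\<Sum>i<n. (\<Sum>j<n. ?G i j * x j)\<^sup>2)"
    by (simp add: sqnorm_def matvec_pow_expand[where x = x])
  also have "\<dots> \<le> (\<Sum>i<n. (\<Sum>j<n. (?G i j)\<^sup>2) * sqnorm n x)"
    unfolding sqnorm_def by (intro sum_mono Cauchy_Schwarz_ineq_sum)
  also have "\<dots> = sqnorm n x * (\<Sum>i<n. \<Sum>j<n. (?G i j)\<^sup>2)"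
    unfolding sum_distrib_right[symmetric] by (rule mult.commute)
  also have "(\<Sum>i<n. \<Sum>j<n. (?G i j)\<^sup>2) = trace_pow n A (2 * m)"
    unfolding trace_pow_even[OF assms] sqnorm_def by (rule sum.swap)
  finally show ?thesis .
qed

lemma sqnorm_matvec_power_le:
  assumes symmetric: "symmetric n A"
  shows "sqnorm n (matvec n A x) ^ (2 ^ r)
      \<le> sqnorm n x ^ (2 ^ r - 1) * sqnorm n ((matvec n A ^^ (2 ^ r)) x)"
proof (induction r)
  case (Suc r)
  let ?N = "\<lambda>k. sqnorm n ((matvec n A ^^ k) x)"
  have log_convex: "(?N k)\<^sup>2 \<le> ?N 0 * ?N (2 * k)" for k
    using vinner_Cauchy_Schwarz[of n x "(matvec n A ^^ (2 * k)) x"]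
    by (simp add: sqnorm_matvec_pow[OF symmetric, of k])
  have "?N 1 ^ (2 ^ Suc r) = (?N 1 ^ (2 ^ r))\<^sup>2" by (simp add: power_mult[symmetric] mult.commute)
  also have "\<dots> \<le> (?N 0 ^ (2 ^ r - 1) * ?N (2 ^ r))\<^sup>2"
    using Suc by (intro power_mono) auto
  also have "\<dots> = ?N 0 ^ (2 * (2 ^ r - 1)) * (?N (2 ^ r))\<^sup>2"
    by (simp add: power_mult_distrib power_mult[symmetric] mult.commute)
  also have "\<dots> \<le> ?N 0 ^ (2 * (2 ^ r - 1)) * (?N 0 * ?N (2 * 2 ^ r))"
    by (intro mult_left_mono log_convex) auto
  also have "\<dots> = ?N 0 ^ Suc (2 * (2 ^ r - 1)) * ?N (2 ^ Suc r)" by (simp add: mult_ac)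
  also have "Suc (2 * (2 ^ r - 1)) = 2 ^ Suc r - (1::nat)"
    using one_le_power[of "2::nat" r] unfolding power_Suc by linarith
  finally show ?case by simp
qed simp

lemma sqnorm_matvec_le_of_trace_pow:
  assumes symmetric: "symmetric n A" and trace: "trace_pow n A (2 * 2 ^ r) \<le> b ^ (2 ^ r)" and "b \<ge> 0"
  shows "sqnorm n (matvec n A x) \<le> b * sqnorm n x"
proof -
  have "sqnorm n (matvec n A x) ^ (2 ^ r)
      \<le> sqnorm n x ^ (2 ^ r - 1) * sqnorm n ((matvec n A ^^ (2 ^ r)) x)"
    by (rule sqnorm_matvec_power_le[OF symmetric])
  also have "\<dots> \<le> sqnorm n x ^ (2 ^ r - 1) * (sqnorm n x * trace_pow n A (2 * 2 ^ r))"
    by (intro mult_left_mono sqnorm_matvec_pow_le symmetric) auto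
  also have "\<dots> = sqnorm n x ^ (2 ^ r) * trace_pow n A (2 * 2 ^ r)"
    using power_minus_mult[of "2 ^ r" "sqnorm n x"] by simp
  also have "\<dots> \<le> sqnorm n x ^ (2 ^ r) * b ^ (2 ^ r)"
    by (intro mult_left_mono trace) simp
  also have "\<dots> = (b * sqnorm n x) ^ (2 ^ r)" by (simp add: power_mult_distrib)
  finally show ?thesis
    using \<open>b \<ge> 0\<close> by (subst (asm) power_mono_iff) auto
qed

lemma finite_traversed_edges: "finite {e. edge_count xs e > 0}"
proof (rule finite_subset)
  show "{e. edge_count xs e > 0} \<subseteq> (\<lambda>(i, j). edge i j) ` (set xs \<times> set xs)"
    by (force elim: edge_count_pos_imp_edge)
qed simp

lemma card_vertices_le: "xs \<noteq> [] \<Longrightarrow> card (set xs) \<le> Suc (card {e. edge_count xs e > 0})"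
proof (induction xs rule: induct_list012)
  case (3 a b xs)
  show ?case
  proof (cases "a \<in> set (b # xs)")
    case True
    then have "set (a # b # xs) = set (b # xs)" by auto
    moreover have "card {e. edge_count (b # xs) e > 0} \<le> card {e. edge_count (a # b # xs) e > 0}"
      by (intro card_mono finite_traversed_edges) auto
    ultimately show ?thesis using 3 by simp
  next
    case False
    have "edge_count (b # xs) (edge a b) = 0" using False by (intro edge_count_eq_0) auto
    moreover have "{e. edge_count (a # b # xs) e > 0}
        = insert (edge a b) {e. edge_count (b # xs) e > 0}" by auto
    ultimately have "card {e. edge_count (a # b # xs) e > 0}
        = Suc (card {e. edge_count (b # xs) e > 0})"
      using finite_traversed_edges by (simp del: edge_count.simps)
    moreover have "card (set (a # b # xs)) = Suc (card (set (b # xs)))" using False by simp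
    ultimately show ?thesis using 3(2) by simp
  qed
qed auto

lemma card_vertices_le_of_even:
  assumes xs_walk: "xs \<in> walks n (Suc (2 * m))" and even: "\<And>e. even (edge_count xs e)"
  shows "card (set xs) \<le> Suc m"
proof -
  let ?E = "{e. edge_count xs e > 0}"
  have walk: "set xs \<subseteq> {..<n}" "length xs = Suc (2 * m)" using xs_walk by (auto simp: walks_def)
  have "edge_count xs e \<ge> 2" if "e \<in> ?E" for e
    using even[of e] that by (auto elim!: evenE)
  then have "2 * card ?E \<le> (\<Sum>e\<in>?E. edge_count xs e)"
    using sum_mono[of ?E "\<lambda>_. 2" "edge_count xs"] by simp
  also have "\<dots> \<le> (\<Sum>e\<in>edges n. edge_count xs e)"
    using edge_count_pos_imp_in_edges[OF walk(1)] by (intro sum_mono2) auto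
  also have "\<dots> = 2 * m" using sum_edge_count[OF walk(1)] walk(2) by simp
  finally have "card ?E \<le> m" by simp
  then show ?thesis using card_vertices_le[of xs] walk(2) by (cases xs) auto
qed

lemma card_walks_few_vertices:
  assumes "n \<ge> 1"
  shows "card {xs \<in> walks n k. card (set xs) \<le> r} \<le> n ^ r * r ^ k"
proof -
  let ?L = "\<lambda>ys. {xs. set xs \<subseteq> set ys \<and> length xs = k}"
  have "{xs \<in> walks n k. card (set xs) \<le> r} \<subseteq> (\<Union>ys\<in>walks n r. ?L ys)"
  proof
    fix xs assume xs_in: "xs \<in> {xs \<in> walks n k. card (set xs) \<le> r}"
    let ?ys = "sorted_list_of_set (set xs) @ replicate (r - card (set xs)) 0"
    have "?ys \<in> walks n r" using xs_in assms by (auto simp: walks_def)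
    then show "xs \<in> (\<Union>ys\<in>walks n r. ?L ys)"
      using xs_in by (intro UN_I[of ?ys]) (auto simp: walks_def)
  qed
  then have "card {xs \<in> walks n k. card (set xs) \<le> r} \<le> card (\<Union>ys\<in>walks n r. ?L ys)"
    by (intro card_mono finite_UN_I) (auto intro: finite_lists_length_eq)
  also have "\<dots> \<le> (\<Sum>ys\<in>walks n r. card (?L ys))"
    by (rule card_UN_le) simp
  also have "\<dots> \<le> (\<Sum>ys\<in>walks n r. r ^ k)"
  proof (rule sum_mono)
    fix ys assume "ys \<in> walks n r"
    then have "card (set ys) \<le> r" using card_length[of ys] by (auto simp: walks_def)
    then show "card (?L ys) \<le> r ^ k"
      by (subst card_lists_length_eq) (auto intro: power_mono)
  qed
  also have "\<dots> = n ^ r * r ^ k"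
    using card_lists_length_eq[of "{..<n}" r] by (simp add: walks_def)
  finally show ?thesis .
qed

definition trace_const :: "nat \<Rightarrow> real" where
  "trace_const m = real (Suc m ^ Suc (2 * m)) * (2 * fact (2 * m)) ^ m"

context goe
begin

lemma walk_prod_eq_prod_entries:
  "set xs \<subseteq> {..<n} \<Longrightarrow> walk_prod (Y \<omega>) xs = (\<Prod>e\<in>edges n. entry e \<omega> ^ edge_count xs e)"
  unfolding entry_def by (rule walk_prod_eq_prod_edges[OF _ symmetric_Y])

lemma walk_prod_moments:
  assumes "set xs \<subseteq> {..<n}"
  shows integrable_walk_prod: "integrable P (\<lambda>\<omega>. walk_prod (Y \<omega>) xs)"
    and expectation_walk_prod:
      "expectation (\<lambda>\<omega>. walk_prod (Y \<omega>) xs)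
        = (\<Prod>e\<in>edges n. expectation (\<lambda>\<omega>. entry e \<omega> ^ edge_count xs e))"
  unfolding walk_prod_eq_prod_entries[OF assms]
  by (auto intro!: integrable_prod_entries expectation_prod_entries integrable_entry_power)

lemma expectation_walk_prod_odd:
  assumes "set xs \<subseteq> {..<n}" and "odd (edge_count xs e)"
  shows "expectation (\<lambda>\<omega>. walk_prod (Y \<omega>) xs) = 0"
proof -
  have in_edges: "e \<in> edges n"
    using assms edge_count_pos_imp_in_edges[of xs n e] by (auto elim: oddE)
  moreover obtain a where "edge_count xs e = 2 * a + 1" using assms(2) by (elim oddE)
  ultimately show ?thesis
    unfolding expectation_walk_prod[OF assms(1)]
    by (intro prod_zero bexI[of _ e]) (simp_all only: finite_edges expectation_entry_odd)
qed

lemma expectation_entry_even_bounds: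
  assumes in_edges: "e \<in> edges n" and "a \<le> m"
  shows "0 \<le> expectation (\<lambda>\<omega>. entry e \<omega> ^ (2 * a))"
    and "expectation (\<lambda>\<omega>. entry e \<omega> ^ (2 * a)) \<le> (2 * fact (2 * m) / real n) ^ a"
proof -
  show "0 \<le> expectation (\<lambda>\<omega>. entry e \<omega> ^ (2 * a))"
    using edge_var_pos[of e] by (simp add: expectation_entry_even[OF in_edges])
  have "fact (2 * a) / (2 ^ a * fact a) \<le> (fact (2 * m) ^ a :: real)"
  proof (cases "a = 0")
    case False
    have "(1::real) \<le> 2 ^ a * fact a"
      using mult_mono[of 1 "2 ^ a" 1 "fact a :: real"] by (simp add: fact_ge_1)
    then have "fact (2 * a) / (2 ^ a * fact a) \<le> (fact (2 * a) / 1 :: real)"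
      by (intro divide_left_mono) auto
    also have "\<dots> \<le> fact (2 * m)" using \<open>a \<le> m\<close> by (simp add: fact_mono)
    also have "\<dots> \<le> fact (2 * m) ^ a" using False by (intro self_le_power) (auto simp: fact_ge_1)
    finally show ?thesis .
  qed simp
  then have "edge_var e ^ a * (fact (2 * a) / (2 ^ a * fact a)) \<le> (2 / real n) ^ a * fact (2 * m) ^ a"
    using edge_var_pos[of e] edge_var_le[of e]
    by (intro mult_mono power_mono) (auto simp: less_imp_le)
  then show "expectation (\<lambda>\<omega>. entry e \<omega> ^ (2 * a)) \<le> (2 * fact (2 * m) / real n) ^ a"
    by (simp add: expectation_entry_even[OF in_edges] power_mult_distrib[symmetric])
qed

text \<open>The expectation vanishes unless every edge is traversed an even number of times, and then a walk
  with \<open>2 * m\<close> steps has at most \<open>m + 1\<close> vertices.\<close>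

lemma expectation_walk_prod_le:
  assumes xs_walk: "xs \<in> walks n (Suc (2 * m))"
  shows "expectation (\<lambda>\<omega>. walk_prod (Y \<omega>) xs)
      \<le> (if card (set xs) \<le> Suc m then (2 * fact (2 * m) / real n) ^ m else 0)"
proof (cases "\<exists>e. odd (edge_count xs e)")
  case True
  then have "expectation (\<lambda>\<omega>. walk_prod (Y \<omega>) xs) = 0"
    using xs_walk by (auto simp: walks_def expectation_walk_prod_odd)
  then show ?thesis by simp
next
  case False
  have walk: "set xs \<subseteq> {..<n}" "length xs = Suc (2 * m)" using xs_walk by (auto simp: walks_def)
  let ?a = "\<lambda>e. edge_count xs e div 2"
  have even: "even (edge_count xs e)" for e using False by blast
  then have half: "edge_count xs e = 2 * ?a e" for e by simp
  have "2 * (\<Sum>e\<in>edges n. ?a e) = (\<Sum>e\<in>edges n. edge_count xs e)"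
    using half by (simp add: sum_distrib_left)
  also have "\<dots> = 2 * m" using sum_edge_count[OF walk(1)] walk(2) by simp
  finally have total: "(\<Sum>e\<in>edges n. ?a e) = m" by simp
  have "expectation (\<lambda>\<omega>. walk_prod (Y \<omega>) xs) = (\<Prod>e\<in>edges n. expectation (\<lambda>\<omega>. entry e \<omega> ^ (2 * ?a e)))"
    using half by (simp add: expectation_walk_prod[OF walk(1)])
  also have "\<dots> \<le> (\<Prod>e\<in>edges n. (2 * fact (2 * m) / real n) ^ ?a e)"
  proof (rule prod_mono)
    fix e assume in_edges: "e \<in> edges n"
    then have "?a e \<le> m" using member_le_sum[of e "edges n" ?a] total by simp
    then show "0 \<le> expectation (\<lambda>\<omega>. entry e \<omega> ^ (2 * ?a e)) \<and>
        expectation (\<lambda>\<omega>. entry e \<omega> ^ (2 * ?a e)) \<le> (2 * fact (2 * m) / real n) ^ ?a e"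
      using expectation_entry_even_bounds[OF in_edges] by simp
  qed
  also have "\<dots> = (2 * fact (2 * m) / real n) ^ m" by (simp only: power_sum[symmetric] total)
  finally show ?thesis using card_vertices_le_of_even[OF xs_walk even] by simp
qed

lemma expectation_trace_pow:
  shows "integrable P (\<lambda>\<omega>. trace_pow n (Y \<omega>) (2 * m))"
    and "expectation (\<lambda>\<omega>. trace_pow n (Y \<omega>) (2 * m)) \<le> trace_const m * real n"
proof -
  let ?W = "walks n (Suc (2 * m))"
  let ?B = "(2 * fact (2 * m) / real n) ^ m"
  have integrable_walk: "integrable P (\<lambda>\<omega>. walk_prod (Y \<omega>) xs)" if "xs \<in> ?W" for xs
    using that by (intro integrable_walk_prod) (auto simp: walks_def)
  show "integrable P (\<lambda>\<omega>. trace_pow n (Y \<omega>) (2 * m))"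
    unfolding trace_pow_walks using integrable_walk
    by (intro Bochner_Integration.integrable_sum integrable_mult_right) auto
  have "expectation (\<lambda>\<omega>. trace_pow n (Y \<omega>) (2 * m))
      = (\<Sum>xs\<in>?W. of_bool (last xs = hd xs) * expectation (\<lambda>\<omega>. walk_prod (Y \<omega>) xs))"
    unfolding trace_pow_walks using integrable_walk by (subst Bochner_Integration.integral_sum) auto
  also have "\<dots> \<le> (\<Sum>xs\<in>?W. if card (set xs) \<le> Suc m then ?B else 0)"
  proof (rule sum_mono)
    fix xs assume "xs \<in> ?W"
    then show "of_bool (last xs = hd xs) * expectation (\<lambda>\<omega>. walk_prod (Y \<omega>) xs)
        \<le> (if card (set xs) \<le> Suc m then ?B else 0)"
      using expectation_walk_prod_le[of xs m] by (auto split: if_splits)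
  qed
  also have "\<dots> = real (card {xs \<in> ?W. card (set xs) \<le> Suc m}) * ?B"
    by (simp add: sum.inter_filter[symmetric])
  also have "\<dots> \<le> real (n ^ Suc m * Suc m ^ Suc (2 * m)) * ?B"
    using n_pos by (intro mult_right_mono of_nat_mono card_walks_few_vertices) auto
  also have "\<dots> = trace_const m * real n"
    using n_pos unfolding trace_const_def by (simp add: power_divide field_simps)
  finally show "expectation (\<lambda>\<omega>. trace_pow n (Y \<omega>) (2 * m)) \<le> trace_const m * real n" .
qed

end

section \<open>Convergence in probability\<close>

text \<open>Convergence in probability as a filter: a property holds eventually iff it holds outside
  events of arbitrarily small probability. No measurability of the property is required.\<close>

definition prob_filter :: "'w measure \<Rightarrow> (nat \<times> 'w) filter" where
  "prob_filter P = Abs_filter (\<lambda>Q. \<forall>\<eta>>0. \<forall>\<^sub>F n in sequentially.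
     \<exists>B\<in>sets P. measure P B \<le> \<eta> \<and> (\<forall>\<omega>\<in>space P - B. Q (n, \<omega>)))"

context prob_space
begin

lemma eventually_prob_filter:
  "eventually Q (prob_filter M) \<longleftrightarrow> (\<forall>\<eta>>0. \<forall>\<^sub>F n in sequentially.
     \<exists>B\<in>sets M. measure M B \<le> \<eta> \<and> (\<forall>\<omega>\<in>space M - B. Q (n, \<omega>)))"
  unfolding prob_filter_def
proof (rule eventually_Abs_filter, rule is_filter.intro, goal_cases)
  case 1
  show ?case by (intro allI impI always_eventually bexI[of _ "{}"]) auto
next
  case (2 Q R)
  show ?case
  proof (intro allI impI)
    fix \<eta> :: real assume "\<eta> > 0"
    then have "\<eta> / 2 > 0" by simp
    then have "\<forall>\<^sub>F n in sequentially. \<exists>B\<in>sets M. measure M B \<le> \<eta> / 2 \<and> (\<forall>\<omega>\<in>space M - B. Q (n, \<omega>))"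
      and "\<forall>\<^sub>F n in sequentially. \<exists>B\<in>sets M. measure M B \<le> \<eta> / 2 \<and> (\<forall>\<omega>\<in>space M - B. R (n, \<omega>))"
      using 2 by blast+
    then show "\<forall>\<^sub>F n in sequentially. \<exists>B\<in>sets M.
        measure M B \<le> \<eta> \<and> (\<forall>\<omega>\<in>space M - B. Q (n, \<omega>) \<and> R (n, \<omega>))"
    proof eventually_elim
      case (elim n)
      then obtain B C where bad_Q: "B \<in> sets M" "measure M B \<le> \<eta> / 2" "\<forall>\<omega>\<in>space M - B. Q (n, \<omega>)"
        and bad_R: "C \<in> sets M" "measure M C \<le> \<eta> / 2" "\<forall>\<omega>\<in>space M - C. R (n, \<omega>)" by blast
      have "measure M (B \<union> C) \<le> \<eta>"
        using measure_Un_le[OF bad_Q(1) bad_R(1)] bad_Q(2) bad_R(2) by linarith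
      then show ?case using bad_Q bad_R by (intro bexI[of _ "B \<union> C"]) auto
    qed
  qed
next
  case (3 Q R)
  show ?case
  proof (intro allI impI)
    fix \<eta> :: real assume "\<eta> > 0"
    with 3(2) have "\<forall>\<^sub>F n in sequentially. \<exists>B\<in>sets M. measure M B \<le> \<eta> \<and> (\<forall>\<omega>\<in>space M - B. Q (n, \<omega>))"
      by blast
    then show "\<forall>\<^sub>F n in sequentially. \<exists>B\<in>sets M. measure M B \<le> \<eta> \<and> (\<forall>\<omega>\<in>space M - B. R (n, \<omega>))"
      by eventually_elim (use 3(1) in blast)
  qed
qed

lemma filterlim_fst_prob_filter: "filterlim fst sequentially (prob_filter M)"
  unfolding filterlim_iff eventually_prob_filter
proof (intro allI impI)
  fix Q and \<eta> :: real assume "eventually Q sequentially" "\<eta> > 0"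
  from this(1) show "\<forall>\<^sub>F n in sequentially. \<exists>B\<in>sets M.
      measure M B \<le> \<eta> \<and> (\<forall>\<omega>\<in>space M - B. Q (fst (n, \<omega>)))"
    by eventually_elim (use \<open>\<eta> > 0\<close> in \<open>auto intro!: bexI[of _ "{}"]\<close>)
qed

lemma tendsto_0_Markov:
  fixes X :: "nat \<times> 'a \<Rightarrow> real"
  assumes integrable_X: "\<And>n. n \<ge> 1 \<Longrightarrow> integrable M (\<lambda>\<omega>. X (n, \<omega>))"
    and nonneg: "\<And>n \<omega>. n \<ge> 1 \<Longrightarrow> 0 \<le> X (n, \<omega>)"
    and expectation_le: "\<And>n. n \<ge> 1 \<Longrightarrow> expectation (\<lambda>\<omega>. X (n, \<omega>)) \<le> r n" and r_tendsto_0: "r \<longlonglongrightarrow> 0"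
  shows "(X \<longlongrightarrow> 0) (prob_filter M)"
proof (rule tendstoI)
  fix \<epsilon> :: real assume \<epsilon>: "\<epsilon> > 0"
  show "\<forall>\<^sub>F x in prob_filter M. dist (X x) 0 < \<epsilon>"
    unfolding eventually_prob_filter
  proof (intro allI impI)
    fix \<eta> :: real assume "\<eta> > 0"
    then have "\<forall>\<^sub>F n in sequentially. r n < \<epsilon> * \<eta>" using r_tendsto_0 \<epsilon> by (intro order_tendstoD) auto
    then show "\<forall>\<^sub>F n in sequentially. \<exists>B\<in>sets M.
        measure M B \<le> \<eta> \<and> (\<forall>\<omega>\<in>space M - B. dist (X (n, \<omega>)) 0 < \<epsilon>)"
      using eventually_ge_at_top[of 1]
    proof eventually_elim
      case (elim n)
      note [measurable] = integrable_X[OF elim(2)]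
      let ?B = "{\<omega> \<in> space M. X (n, \<omega>) \<ge> \<epsilon>}"
      have "measure M ?B \<le> expectation (\<lambda>\<omega>. X (n, \<omega>)) / \<epsilon>"
        using nonneg[OF elim(2)] \<epsilon>
        by (intro integral_Markov_inequality_measure[OF integrable_X[OF elim(2)], of "{}"]) auto
      also have "\<dots> \<le> \<eta>"
        using expectation_le[OF elim(2)] elim(1) \<epsilon> by (simp add: field_simps)
      finally have "measure M ?B \<le> \<eta>" .
      moreover have "?B \<in> sets M" by measurable
      ultimately show ?case using nonneg[OF elim(2)] by (intro bexI[of _ ?B]) auto
    qed
  qed
qed

lemma tendsto_prob_filterD:
  fixes X :: "nat \<times> 'a \<Rightarrow> real"
  assumes X_tendsto: "(X \<longlongrightarrow> l) (prob_filter M)" and "\<epsilon> > 0"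
  shows "(\<lambda>n. measure M {\<omega> \<in> space M. \<bar>X (n, \<omega>) - l\<bar> > \<epsilon>}) \<longlonglongrightarrow> 0"
proof (rule tendstoI)
  fix \<eta> :: real assume "\<eta> > 0"
  then have "\<eta> / 2 > 0" by simp
  moreover have "\<forall>\<^sub>F x in prob_filter M. dist (X x) l < \<epsilon>" using X_tendsto \<open>\<epsilon> > 0\<close> by (rule tendstoD)
  ultimately have "\<forall>\<^sub>F n in sequentially. \<exists>B\<in>sets M.
      measure M B \<le> \<eta> / 2 \<and> (\<forall>\<omega>\<in>space M - B. dist (X (n, \<omega>)) l < \<epsilon>)"
    unfolding eventually_prob_filter by blast
  then show "\<forall>\<^sub>F n in sequentially. dist (measure M {\<omega> \<in> space M. \<bar>X (n, \<omega>) - l\<bar> > \<epsilon>}) 0 < \<eta>"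
  proof eventually_elim
    case (elim n)
    then obtain B where bad_set: "B \<in> sets M" "measure M B \<le> \<eta> / 2"
      "\<forall>\<omega>\<in>space M - B. dist (X (n, \<omega>)) l < \<epsilon>"
      by blast
    have "measure M {\<omega> \<in> space M. \<bar>X (n, \<omega>) - l\<bar> > \<epsilon>} \<le> measure M B"
      using bad_set by (intro finite_measure_mono) (force simp: dist_real_def)+
    also have "\<dots> < \<eta>" using bad_set \<open>\<eta> > 0\<close> by simp
    finally show ?case by simp
  qed
qed

end

lemma tendsto_0_of_square:
  fixes f :: "'b \<Rightarrow> real"
  assumes "((\<lambda>x. (f x)\<^sup>2) \<longlongrightarrow> 0) F"
  shows "(f \<longlongrightarrow> 0) F"
  using tendsto_real_sqrt[OF assms] by (simp add: tendsto_rabs_zero_iff)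

section \<open>Sequences of matrices and vectors\<close>

definition contractions :: "(nat \<Rightarrow> nat \<Rightarrow> real) \<Rightarrow> bool" where
  "contractions D \<longleftrightarrow> (\<forall>n. contraction n (D n))"

definition norm_bounded :: "(nat \<Rightarrow> nat \<Rightarrow> real) \<Rightarrow> bool" where
  "norm_bounded v \<longleftrightarrow> (\<exists>K\<ge>0. \<forall>n. sqnorm n (v n) \<le> K * real n)"

lemma norm_bounded_contractions_mult:
  "contractions D \<Longrightarrow> norm_bounded v \<Longrightarrow> norm_bounded (D * v)"
  unfolding norm_bounded_def contractions_def times_fun_apply[of D]
  by (meson sqnorm_contraction_le order_trans)

locale matrix_sequence =
  fixes F :: "'x filter" and N :: "'x \<Rightarrow> nat" and Z :: "'x \<Rightarrow> nat \<Rightarrow> nat \<Rightarrow> real"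
  assumes N_at_top: "filterlim N at_top F"
    and symmetric_Z: "symmetric (N x) (Z x)"
begin

definition lift :: "(nat \<Rightarrow> nat \<Rightarrow> real) \<Rightarrow> 'x \<Rightarrow> nat \<Rightarrow> real" where
  "lift v x = v (N x)"

definition scalar :: "('x \<Rightarrow> real) \<Rightarrow> 'x \<Rightarrow> nat \<Rightarrow> real" where
  "scalar c x = (\<lambda>_. c x)"

definition avg :: "('x \<Rightarrow> nat \<Rightarrow> real) \<Rightarrow> 'x \<Rightarrow> real" where
  "avg X x = mean (N x) (X x)"

definition Zmul :: "('x \<Rightarrow> nat \<Rightarrow> real) \<Rightarrow> 'x \<Rightarrow> nat \<Rightarrow> real" where
  "Zmul X x = matvec (N x) (Z x) (X x)"

lemma tendsto_N: "f \<longlonglongrightarrow> l \<Longrightarrow> ((\<lambda>x. f (N x)) \<longlongrightarrow> l) F"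
  by (rule filterlim_compose[OF _ N_at_top])

lemma eventually_N_ge_1: "\<forall>\<^sub>F x in F. N x \<ge> 1"
  using N_at_top unfolding filterlim_at_top by blast

lemma tendsto_avg_lift: "(\<lambda>n. mean n (v n)) \<longlonglongrightarrow> l \<Longrightarrow> (avg (lift v) \<longlongrightarrow> l) F"
  unfolding avg_def[abs_def] lift_def by (rule tendsto_N)

lemma lift_0 [simp]: "lift 0 = 0" and lift_1 [simp]: "lift 1 = 1"
  by (simp_all add: lift_def fun_eq_iff)

lemma lift_mult: "lift (u * v) = lift u * lift v"
  by (simp add: lift_def fun_eq_iff)

lemma avg_add: "avg (X + Y) x = avg X x + avg Y x"
  by (simp add: avg_def mean_def sum.distrib add_divide_distrib)

lemma avg_diff: "avg (X - Y) x = avg X x - avg Y x"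
  by (simp add: avg_def mean_def sum_subtractf diff_divide_distrib)

lemma avg_sum: "avg (\<Sum>s\<in>S. X s) x = (\<Sum>s\<in>S. avg (X s) x)"
  unfolding avg_def mean_def sum_fun_apply sum_divide_distrib by (rule sum.swap)

lemma avg_scalar: "avg (scalar c * X) x = c x * avg X x"
  by (simp add: avg_def mean_def scalar_def sum_distrib_left)

lemma avg_square_nonneg: "0 \<le> avg (X * X) x"
  by (simp add: avg_def mean_mult_self)

lemma avg_Cauchy_Schwarz: "(avg (X * Y) x)\<^sup>2 \<le> avg (X * X) x * avg (Y * Y) x"
  using divide_right_mono[OF vinner_Cauchy_Schwarz[of "N x" "X x" "Y x"], of "(real (N x))\<^sup>2"]
  by (simp add: avg_def mean_mult sqnorm_eq_vinner power_divide power2_eq_square)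

lemma Zmul_add: "Zmul (X + Y) = Zmul X + Zmul Y"
  by (simp add: Zmul_def fun_eq_iff matvec_add)

lemma Zmul_scalar: "Zmul (scalar c * X) = scalar c * Zmul X"
  by (simp add: Zmul_def fun_eq_iff scalar_def matvec_scale)

lemma Zmul_0 [simp]: "Zmul 0 = 0"
  by (simp add: Zmul_def fun_eq_iff)

lemma Zmul_diff: "Zmul (X - Y) = Zmul X - Zmul Y"
  using Zmul_add[of "X - Y" Y] by simp

lemma Zmul_sum: "Zmul (\<Sum>s\<in>S. X s) = (\<Sum>s\<in>S. Zmul (X s))"
  unfolding Zmul_def matvec_def sum_fun_apply sum_distrib_left fun_eq_iff by (intro allI sum.swap)

lemma avg_Zmul: "avg (Zmul X * Y) x = avg (X * Zmul Y) x"
  by (simp add: avg_def mean_mult Zmul_def vinner_matvec[OF symmetric_Z])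

definition agree :: "('x \<Rightarrow> nat \<Rightarrow> real) \<Rightarrow> ('x \<Rightarrow> nat \<Rightarrow> real) \<Rightarrow> bool" (infix "\<simeq>" 50) where
  "X \<simeq> Y \<longleftrightarrow> (\<forall>x. \<forall>i<N x. X x i = Y x i)"

lemma agree_mult: "X \<simeq> X' \<Longrightarrow> Y \<simeq> Y' \<Longrightarrow> X * Y \<simeq> X' * Y'"
  by (simp add: agree_def)

lemma agree_refl [simp]: "X \<simeq> X"
  by (simp add: agree_def)

lemma agree_sym: "X \<simeq> Y \<Longrightarrow> Y \<simeq> X"
  by (simp add: agree_def)

lemma avg_cong: "X \<simeq> Y \<Longrightarrow> avg X = avg Y"
  unfolding avg_def agree_def by (auto intro!: mean_cong simp: fun_eq_iff)

lemma Zmul_cong: "X \<simeq> Y \<Longrightarrow> Zmul X = Zmul Y"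
  by (rule ext) (auto simp: Zmul_def agree_def intro: matvec_cong)

text \<open>The vector \<open>\<ell> D\<^sub>1 \<ell> D\<^sub>2 \<dots> \<ell> D\<^sub>k v\<close>, where \<open>Z = \<ell> + \<ell>\<^sup>*\<close> is thought of as a sum of
  creation and annihilation operators on the full Fock space, so that \<open>\<ell>\<^sup>* D \<ell>\<close> is the scalar
  \<open>avg D\<close>.\<close>

fun free :: "(nat \<Rightarrow> nat \<Rightarrow> real) list \<Rightarrow> (nat \<Rightarrow> nat \<Rightarrow> real) \<Rightarrow> 'x \<Rightarrow> nat \<Rightarrow> real" where
  "free [] v = lift v"
| "free [D] v = Zmul (lift D * lift v)"
| "free (D # D1 # w) v
    = Zmul (lift D * free (D1 # w) v) - scalar (avg (lift D)) * (lift D1 * free w v)"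

text \<open>Requiring the bound for every \<open>\<beta> > 0\<close> makes the class stable under multiplication by a matrix
  whose norm is only controlled up to arbitrarily small powers of the dimension.\<close>

definition small :: "('x \<Rightarrow> nat \<Rightarrow> real) \<Rightarrow> bool" where
  "small X \<longleftrightarrow> (\<forall>\<beta>>0. ((\<lambda>x. sqnorm (N x) (X x) / real (N x) powr \<beta>) \<longlongrightarrow> 0) F)"

lemma small_0 [simp]: "small 0"
  by (simp add: small_def sqnorm_def)

lemma small_of_sqnorm_le:
  assumes "small X" "small Y"
    and W_le: "\<And>x. sqnorm (N x) (W x) \<le> 2 * sqnorm (N x) (X x) + 2 * sqnorm (N x) (Y x)"
  shows "small W"
  unfolding small_def
proof (intro allI impI)
  fix \<beta> :: real assume "\<beta> > 0"
  let ?f = "\<lambda>X x. sqnorm (N x) (X x) / real (N x) powr \<beta>"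
  have "((\<lambda>x. 2 * ?f X x + 2 * ?f Y x) \<longlongrightarrow> 2 * 0 + 2 * 0) F"
    using assms(1,2) \<open>\<beta> > 0\<close> unfolding small_def by (intro tendsto_intros) auto
  then have bound_tendsto_0: "((\<lambda>x. 2 * ?f X x + 2 * ?f Y x) \<longlongrightarrow> 0) F" by simp
  have "?f W x \<le> 2 * ?f X x + 2 * ?f Y x" for x
    using divide_right_mono[OF W_le[of x], of "real (N x) powr \<beta>"] by (simp add: add_divide_distrib)
  then show "(?f W \<longlongrightarrow> 0) F"
    by (intro tendsto_sandwich[OF _ _ tendsto_const bound_tendsto_0] always_eventually) auto
qed

lemma small_add: "small X \<Longrightarrow> small Y \<Longrightarrow> small (X + Y)"
  by (rule small_of_sqnorm_le[of X Y]) (simp_all add: sqnorm_add_le)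

lemma small_diff: "small X \<Longrightarrow> small Y \<Longrightarrow> small (X - Y)"
  by (rule small_of_sqnorm_le[of X Y]) (simp_all add: sqnorm_diff_le)

lemma small_contraction_mult:
  assumes "small X" and "\<And>x. contraction (N x) (C x)"
  shows "small (C * X)"
proof (rule small_of_sqnorm_le[OF assms(1) small_0])
  fix x
  have "sqnorm (N x) ((C * X) x) \<le> sqnorm (N x) (X x)"
    using sqnorm_contraction_le[OF assms(2)] by simp
  then show "sqnorm (N x) ((C * X) x) \<le> 2 * sqnorm (N x) (X x) + 2 * sqnorm (N x) (0 x)"
    using sqnorm_nonneg[of "N x" "X x"] sqnorm_nonneg[of "N x" "0 x"] by linarith
qed

lemma contraction_lift: "contractions D \<Longrightarrow> contraction (N x) (lift D x)"
  by (simp add: contractions_def lift_def)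

lemma contraction_avg_mult:
  assumes "contractions D" "contractions E"
  shows "contraction (N x) ((scalar (avg (lift D)) * lift E) x)"
proof -
  have "\<bar>avg (lift D) x\<bar> \<le> 1"
    using abs_mean_le_1[OF contraction_lift[OF assms(1)]] by (simp add: avg_def)
  then show ?thesis
    using contraction_lift[OF assms(2), of x] mult_mono[of "\<bar>avg (lift D) x\<bar>" 1 "\<bar>lift E x _\<bar>" 1]
    by (auto simp: contraction_def scalar_def abs_mult)
qed

lemma small_Zmul:
  assumes small_X: "small X"
    and norm_bound: "\<And>\<beta>. \<beta> > 0 \<Longrightarrow>
      \<forall>\<^sub>F x in F. \<forall>y. sqnorm (N x) (matvec (N x) (Z x) y) \<le> real (N x) powr \<beta> * sqnorm (N x) y"
  shows "small (Zmul X)"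
  unfolding small_def
proof (intro allI impI)
  fix \<beta> :: real assume "\<beta> > 0"
  then have half_pos: "\<beta> / 2 > 0" by simp
  then have ratio_tendsto_0: "((\<lambda>x. sqnorm (N x) (X x) / real (N x) powr (\<beta> / 2)) \<longlongrightarrow> 0) F"
    using small_X unfolding small_def by blast
  have "\<forall>\<^sub>F x in F. sqnorm (N x) (Zmul X x) / real (N x) powr \<beta>
      \<le> sqnorm (N x) (X x) / real (N x) powr (\<beta> / 2)"
    using norm_bound[OF half_pos] eventually_N_ge_1
  proof eventually_elim
    case (elim x)
    let ?p = "real (N x) powr (\<beta> / 2)"
    have "real (N x) powr \<beta> = ?p * ?p" "?p > 0"
      using elim by (simp_all add: powr_add[symmetric])
    moreover have "sqnorm (N x) (Zmul X x) \<le> ?p * sqnorm (N x) (X x)"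
      using elim by (simp add: Zmul_def)
    ultimately show ?case by (simp add: field_simps)
  qed
  then show "((\<lambda>x. sqnorm (N x) (Zmul X x) / real (N x) powr \<beta>) \<longlongrightarrow> 0) F"
    by (intro tendsto_sandwich[OF _ _ tendsto_const ratio_tendsto_0]) auto
qed

lemma avg_mult_small_tendsto_0:
  assumes u_bounded: "norm_bounded u" and small_X: "small X"
  shows "(avg (lift u * X) \<longlongrightarrow> 0) F"
proof (rule tendsto_0_of_square)
  obtain K where u_le: "K \<ge> 0" "\<And>n. sqnorm n (u n) \<le> K * real n"
    using u_bounded by (auto simp: norm_bounded_def)
  have "((\<lambda>x. K * (sqnorm (N x) (X x) / real (N x) powr 1)) \<longlongrightarrow> K * 0) F"
    using small_X unfolding small_def
    by (intro tendsto_mult tendsto_const) (blast intro: zero_less_one)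
  then have bound_tendsto_0: "((\<lambda>x. K * avg (X * X) x) \<longlongrightarrow> 0) F"
    by (simp add: avg_def mean_mult_self)
  have "(avg (lift u * X) x)\<^sup>2 \<le> K * avg (X * X) x" for x
  proof -
    have "avg (lift u * lift u) x \<le> K"
      using u_le by (cases "N x = 0") (auto simp: avg_def lift_def mean_mult_self divide_le_eq)
    then have "avg (lift u * lift u) x * avg (X * X) x \<le> K * avg (X * X) x"
      by (intro mult_right_mono avg_square_nonneg)
    then show ?thesis using avg_Cauchy_Schwarz order_trans by blast
  qed
  then show "((\<lambda>x. (avg (lift u * X) x)\<^sup>2) \<longlongrightarrow> 0) F"
    by (intro tendsto_sandwich[OF _ _ tendsto_const bound_tendsto_0] always_eventually) auto
qed

definition path :: "(nat \<Rightarrow> nat \<Rightarrow> real) list \<Rightarrow> (nat \<Rightarrow> nat \<Rightarrow> real) \<Rightarrow> 'x \<Rightarrow> nat \<Rightarrow> real" where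
  "path w v x = path_vec (N x) (Z x) (map (\<lambda>D. D (N x)) w) (v (N x))"

definition step_error ::
  "(nat \<Rightarrow> nat \<Rightarrow> real) \<Rightarrow> (nat \<Rightarrow> nat \<Rightarrow> real) list \<Rightarrow> (nat \<Rightarrow> nat \<Rightarrow> real) \<Rightarrow> 'x \<Rightarrow> nat \<Rightarrow> real" where
  "step_error D w v x = path_step_error (N x) (Z x) (D (N x)) (map (\<lambda>D. D (N x)) w) (v (N x))"

lemma path_Nil: "path [] v = lift v"
  by (simp add: path_def lift_def fun_eq_iff)

lemma Zmul_path_Nil: "Zmul (lift D * path [] v) = path [D] v + step_error D [] v"
  by (simp add: fun_eq_iff Zmul_def path_def step_error_def path_step_error_def lift_def)

lemma Zmul_path_Cons:
  "Zmul (lift D * path (D1 # w) v)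
    = path (D # D1 # w) v + scalar (avg (lift D)) * (lift D1 * path w v) + step_error D (D1 # w) v"
  by (simp add: fun_eq_iff Zmul_def path_def step_error_def path_step_error_def lift_def scalar_def
    avg_def)

end

section \<open>Self-avoiding paths approximate free products\<close>

locale goe_sequence = prob_space P for P :: "'w measure" +
  fixes Z :: "nat \<Rightarrow> 'w \<Rightarrow> nat \<Rightarrow> nat \<Rightarrow> real"
  assumes goe: "n \<ge> 1 \<Longrightarrow> goe P n (Z n)"

sublocale goe_sequence \<subseteq> matrix_sequence "prob_filter P" fst "case_prod Z"
proof
  show "filterlim fst at_top (prob_filter P)" by (rule filterlim_fst_prob_filter)
  fix x :: "nat \<times> 'w"
  show "symmetric (fst x) (case_prod Z x)"
    using goe.symmetric_Y[OF goe[of "fst x"]]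
    by (cases "fst x = 0") (auto simp: symmetric_def split: prod.splits)
qed

context goe_sequence
begin

lemma trace_pow_tendsto_0:
  assumes "c > 1"
  shows "((\<lambda>(n, \<omega>). trace_pow n (Z n \<omega>) (2 * m) / real n powr c) \<longlongrightarrow> 0) (prob_filter P)"
proof (rule tendsto_0_Markov[where r = "\<lambda>n. trace_const m * real n powr (1 - c)"],
    unfold prod.case)
  fix n :: nat assume n_ge_1: "n \<ge> 1"
  interpret goe P n "Z n" using n_ge_1 by (rule goe)
  show "integrable P (\<lambda>\<omega>. trace_pow n (Z n \<omega>) (2 * m) / real n powr c)"
    using expectation_trace_pow(1)[of m] by simp
  show "0 \<le> trace_pow n (Z n \<omega>) (2 * m) / real n powr c" for \<omega>
    by (simp add: trace_pow_even_nonneg symmetric_Y)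
  have "expectation (\<lambda>\<omega>. trace_pow n (Z n \<omega>) (2 * m) / real n powr c)
      \<le> trace_const m * real n / real n powr c"
    using expectation_trace_pow(2)[of m] by (simp add: divide_right_mono)
  also have "\<dots> = trace_const m * real n powr (1 - c)"
    using n_ge_1 by (simp add: powr_diff)
  finally show "expectation (\<lambda>\<omega>. trace_pow n (Z n \<omega>) (2 * m) / real n powr c)
      \<le> trace_const m * real n powr (1 - c)" .
next
  have "(\<lambda>n. real n powr (1 - c)) \<longlonglongrightarrow> 0"
    using assms by (intro tendsto_neg_powr filterlim_real_sequentially) auto
  then show "(\<lambda>n. trace_const m * real n powr (1 - c)) \<longlonglongrightarrow> 0"
    by (rule tendsto_mult_right_zero)
qed

lemma operator_norm_bound:
  assumes "\<beta> > 0"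
  shows "\<forall>\<^sub>F x in prob_filter P. \<forall>y.
    sqnorm (fst x) (matvec (fst x) (case_prod Z x) y) \<le> real (fst x) powr \<beta> * sqnorm (fst x) y"
proof -
  obtain r :: nat where r_large: "1 / \<beta> < 2 ^ r" using real_arch_pow[of 2 "1 / \<beta>"] by auto
  then have "\<beta> * 2 ^ r > 1" using assms by (simp add: field_simps)
  from order_tendstoD(2)[OF trace_pow_tendsto_0[OF this, of "2 ^ r"] zero_less_one]
  show ?thesis
    using eventually_N_ge_1
  proof eventually_elim
    case (elim x)
    obtain n \<omega> where x_eq: "x = (n, \<omega>)" by (cases x)
    have "trace_pow n (Z n \<omega>) (2 * 2 ^ r) \<le> real n powr (\<beta> * 2 ^ r)"
      using elim by (simp add: x_eq)
    also have "\<dots> = (real n powr \<beta>) ^ (2 ^ r)"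
      using elim by (simp add: x_eq powr_realpow[symmetric] powr_powr)
    finally show ?case
      using symmetric_Z[of x] by (auto simp: x_eq intro: sqnorm_matvec_le_of_trace_pow)
  qed
qed

lemma small_step_error:
  assumes contractions: "contractions D" "\<forall>D\<in>set w. contractions D" and v_bounded: "norm_bounded v"
  shows "small (step_error D w v)"
  unfolding small_def
proof (intro allI impI)
  fix \<beta> :: real assume \<beta>: "\<beta> > 0"
  obtain K where v_le: "\<And>n. sqnorm n (v n) \<le> K * real n"
    using v_bounded by (auto simp: norm_bounded_def)
  let ?C = "step_const (length w)"
  let ?e = "\<lambda>n \<omega>. sqnorm n (path_step_error n (Z n \<omega>) (D n) (map (\<lambda>D. D n) w) (v n))"
  have "((\<lambda>(n, \<omega>). ?e n \<omega> / real n powr \<beta>) \<longlongrightarrow> 0) (prob_filter P)"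
  proof (rule tendsto_0_Markov[where r = "\<lambda>n. ?C * K * real n powr (- \<beta>)"],
      unfold prod.case)
    fix n :: nat assume n_ge_1: "n \<ge> 1"
    interpret goe P n "Z n" using n_ge_1 by (rule goe)
    have "\<forall>C\<in>set (D n # map (\<lambda>D. D n) w). contraction n C"
      using contractions by (auto simp: contractions_def)
    note moment = path_step_error_second_moment[OF this, of "v n"]
    show "integrable P (\<lambda>\<omega>. ?e n \<omega> / real n powr \<beta>)"
      using moment(1) by simp
    show "0 \<le> ?e n \<omega> / real n powr \<beta>" for \<omega>
      by simp
    have "expectation (\<lambda>\<omega>. ?e n \<omega>) \<le> ?C * sqnorm n (v n) / real n"
      using moment(2) by simp
    also have "\<dots> \<le> ?C * (K * real n) / real n"
      by (intro divide_right_mono mult_left_mono v_le step_const_nonneg) simp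
    also have "\<dots> = ?C * K" using n_ge_1 by simp
    finally have "expectation (\<lambda>\<omega>. ?e n \<omega>) / real n powr \<beta> \<le> ?C * K / real n powr \<beta>"
      by (intro divide_right_mono) auto
    then show "expectation (\<lambda>\<omega>. ?e n \<omega> / real n powr \<beta>) \<le> ?C * K * real n powr - \<beta>"
      by (simp add: powr_minus divide_inverse)
  next
    have "(\<lambda>n. real n powr - \<beta>) \<longlonglongrightarrow> 0"
      using \<beta> by (intro tendsto_neg_powr filterlim_real_sequentially) auto
    then show "(\<lambda>n. ?C * K * real n powr (- \<beta>)) \<longlonglongrightarrow> 0"
      by (rule tendsto_mult_right_zero)
  qed
  then show "((\<lambda>x. sqnorm (fst x) (step_error D w v x) / real (fst x) powr \<beta>) \<longlongrightarrow> 0) (prob_filter P)"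
    unfolding step_error_def by (simp add: case_prod_unfold)
qed

lemma small_free_diff_path:
  assumes "\<forall>D\<in>set w. contractions D" and v_bounded: "norm_bounded v"
  shows "small (free w v - path w v)"
  using assms(1)
proof (induction w rule: induct_list012)
  case 1
  show "small (free [] v - path [] v)" by (simp add: path_Nil)
next
  case (2 D)
  have "free [D] v - path [D] v = step_error D [] v"
    using Zmul_path_Nil[of D v] by (simp add: path_Nil)
  then show ?case using 2 v_bounded by (simp add: small_step_error)
next
  case (3 D D1 w)
  let ?d = "\<lambda>w. free w v - path w v"
  let ?c = "scalar (avg (lift D)) * lift D1"
  have contractions: "contractions D" "contractions D1" "\<forall>D\<in>set (D1 # w). contractions D"
    using 3(3) by auto
  have small_tails: "small (?d w)" "small (?d (D1 # w))"
    by (rule 3(1), use 3(3) in simp) (rule 3(2)[OF contractions(3)])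
  have "small (Zmul (lift D * ?d (D1 # w)))"
    using small_tails(2) by (rule small_Zmul[OF small_contraction_mult operator_norm_bound])
      (rule contraction_lift[OF contractions(1)])
  moreover have "small (?c * ?d w)"
    using small_tails(1)
    by (rule small_contraction_mult) (rule contraction_avg_mult[OF contractions(1,2)])
  moreover have "small (step_error D (D1 # w) v)"
    by (rule small_step_error[OF contractions(1,3) v_bounded])
  moreover have "?d (D # D1 # w) = Zmul (lift D * ?d (D1 # w)) - ?c * ?d w + step_error D (D1 # w) v"
    using Zmul_path_Cons[of D D1 w v] by (simp add: right_diff_distrib Zmul_diff mult.assoc)
  ultimately show ?case by (simp only: small_add small_diff)
qed

lemma avg_path_tendsto_0:
  assumes contractions: "\<forall>D\<in>set w. contractions D" "w \<noteq> []" and u_bounded: "norm_bounded u"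
    and v_bounded: "norm_bounded v"
  shows "(avg (lift u * path w v) \<longlongrightarrow> 0) (prob_filter P)"
proof (rule tendsto_0_of_square)
  obtain K where v_le: "K \<ge> 0" "\<And>n. sqnorm n (v n) \<le> K * real n"
    using v_bounded by (auto simp: norm_bounded_def)
  obtain L where u_le: "L \<ge> 0" "\<And>n. sqnorm n (u n) \<le> L * real n"
    using u_bounded by (auto simp: norm_bounded_def)
  let ?C = "walk_const (length w)"
  let ?p = "\<lambda>n \<omega>. path_vec n (Z n \<omega>) (map (\<lambda>D. D n) w) (v n)"
  have "((\<lambda>(n, \<omega>). (vinner n (u n) (?p n \<omega>) / real n)\<^sup>2) \<longlongrightarrow> 0) (prob_filter P)"
  proof (rule tendsto_0_Markov[where r = "\<lambda>n. ?C * L * K * (1 / real n)"],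
      unfold prod.case)
    fix n :: nat assume n_ge_1: "n \<ge> 1"
    interpret goe P n "Z n" using n_ge_1 by (rule goe)
    have "\<forall>C\<in>set (map (\<lambda>D. D n) w). contraction n C" "map (\<lambda>D. D n) w \<noteq> []"
      using contractions by (auto simp: contractions_def)
    note moment = second_moment_vinner_path_vec[OF this, of "u n" "v n"]
    show "integrable P (\<lambda>\<omega>. (vinner n (u n) (?p n \<omega>) / real n)\<^sup>2)"
      using moment(1) by (simp add: power_divide)
    have "expectation (\<lambda>\<omega>. (vinner n (u n) (?p n \<omega>))\<^sup>2)
        \<le> ?C * sqnorm n (u n) * sqnorm n (v n) / real n"
      using moment(2) by simp
    also have "\<dots> \<le> ?C * (L * real n) * (K * real n) / real n"
      using v_le u_le by (intro divide_right_mono mult_mono) auto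
    finally have "expectation (\<lambda>\<omega>. (vinner n (u n) (?p n \<omega>))\<^sup>2) / (real n)\<^sup>2
        \<le> ?C * (L * real n) * (K * real n) / real n / (real n)\<^sup>2"
      by (intro divide_right_mono) auto
    also have "\<dots> = ?C * L * K * (1 / real n)" using n_ge_1 by (simp add: power2_eq_square)
    finally show "expectation (\<lambda>\<omega>. (vinner n (u n) (?p n \<omega>) / real n)\<^sup>2) \<le> ?C * L * K * (1 / real n)"
      by (simp add: power_divide)
  next
    show "(\<lambda>n. ?C * L * K * (1 / real n)) \<longlonglongrightarrow> 0"
      by (rule tendsto_mult_right_zero[OF lim_1_over_n])
  qed simp
  then show "((\<lambda>x. (avg (lift u * path w v) x)\<^sup>2) \<longlongrightarrow> 0) (prob_filter P)"
    unfolding avg_def times_fun_apply mean_mult lift_def path_def by (simp add: case_prod_unfold)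
qed

lemma avg_free_tendsto_0:
  assumes "\<forall>D\<in>set w. contractions D" "w \<noteq> []" and "norm_bounded u" and "norm_bounded v"
  shows "(avg (lift u * free w v) \<longlongrightarrow> 0) (prob_filter P)"
proof -
  have "((\<lambda>x. avg (lift u * path w v) x + avg (lift u * (free w v - path w v)) x)
      \<longlongrightarrow> 0 + 0) (prob_filter P)"
    using assms
    by (intro tendsto_add avg_path_tendsto_0 avg_mult_small_tendsto_0 small_free_diff_path) auto
  then show ?thesis by (simp add: avg_add[symmetric] distrib_left[symmetric])
qed

end

section \<open>Asymptotic freeness\<close>

locale asymptotically_free = matrix_sequence F N Z for F :: "'x filter" and N Z +
  assumes free_limit: "\<lbrakk>\<forall>D\<in>set w. contractions D; w \<noteq> []; norm_bounded u; norm_bounded v\<rbrakk>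
    \<Longrightarrow> (avg (lift u * free w v) \<longlongrightarrow> 0) F"
begin

lemma avg_Zmul_mult_free:
  "avg (Zmul X * (lift A * free (E # w) v)) x
    = avg (X * free (A # E # w) v) x + avg (lift A) x * avg (X * (lift E * free w v)) x"
proof -
  have "Zmul (lift A * free (E # w) v)
      = free (A # E # w) v + scalar (avg (lift A)) * (lift E * free w v)"
    by simp
  then show ?thesis
    by (simp only: avg_Zmul distrib_left avg_add mult.left_commute[of X "scalar _"] avg_scalar)
qed

text \<open>The isometry relation \<open>\<ell>\<^sup>* A \<ell> = avg A\<close>. Moving one factor of the matrix across the inner
  product turns the claim for \<open>D1 # w\<close> into an instance of the claim for \<open>w\<close>.\<close>

lemma avg_free_mult_free:
  assumes "\<forall>C\<in>set (D # A # E # w @ w'). contractions C"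
    and bounded: "norm_bounded v" "norm_bounded v'"
  shows "((\<lambda>x. avg (free (D # w) v * (lift A * free (E # w') v')) x
    - avg (lift A) x * avg (lift D * free w v * (lift E * free w' v')) x) \<longlongrightarrow> 0) F"
  using assms(1)
proof (induction w arbitrary: D A E w')
  case Nil
  have "avg (free [D] v * (lift A * free (E # w') v')) x
      - avg (lift A) x * avg (lift D * free [] v * (lift E * free w' v')) x
    = avg (lift (D * v) * free (A # E # w') v') x" for x
    by (simp add: avg_Zmul_mult_free lift_mult del: free.simps(3))
  then show ?case
    using Nil bounded by (simp only:) (intro free_limit norm_bounded_contractions_mult, auto)
next
  case (Cons D1 w)
  let ?f = "lift A * free (E # w') v'" and ?g = "free (D1 # w) v"
  have "avg (free (D # D1 # w) v * ?f) x
      - avg (lift A) x * avg (lift D * ?g * (lift E * free w' v')) x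
    = avg (?g * (lift D * free (A # E # w') v')) x
      - avg (lift D) x * avg (lift D1 * free w v * ?f) x" for x
  proof -
    have "avg (free (D # D1 # w) v * ?f) x
        = avg (Zmul (lift D * ?g) * ?f) x - avg (lift D) x * avg (lift D1 * free w v * ?f) x"
      by (simp only: free.simps left_diff_distrib avg_diff mult.assoc[of "scalar _"] avg_scalar)
    then show ?thesis
      by (simp add: avg_Zmul_mult_free mult.left_commute[of _ "lift D"] mult.assoc[of "lift D"]
        del: free.simps)
  qed
  then show ?case
    using Cons.prems by (simp only:) (intro Cons.IH, auto)
qed

text \<open>\<open>creation h u\<close> expresses that \<open>u = \<ell> h\<close>.\<close>

inductive creation :: "('x \<Rightarrow> nat \<Rightarrow> real) \<Rightarrow> ('x \<Rightarrow> nat \<Rightarrow> real) \<Rightarrow> bool" where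
  creation_free: "contractions D \<Longrightarrow> \<forall>D\<in>set w. contractions D \<Longrightarrow> norm_bounded v \<Longrightarrow>
    creation (lift D * free w v) (free (D # w) v)"
| creation_scalar: "(c \<longlongrightarrow> l) F \<Longrightarrow> creation h u \<Longrightarrow> creation (scalar c * h) (scalar c * u)"
| creation_add: "creation h u \<Longrightarrow> creation h' u' \<Longrightarrow> creation (h + h') (u + u')"
| creation_cong: "creation h u \<Longrightarrow> h \<simeq> h' \<Longrightarrow> u \<simeq> u' \<Longrightarrow> creation h' u'"

lemma creation_0: "creation 0 0"
proof -
  have "contractions 0" by (simp add: contractions_def contraction_def)
  moreover have "norm_bounded 0" by (auto simp: norm_bounded_def sqnorm_def intro: exI[of _ 0])
  ultimately show ?thesis using creation_free[of 0 "[]" 0] by simp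
qed

lemma creation_sum:
  "(\<And>s. s < t \<Longrightarrow> creation (h s) (u s)) \<Longrightarrow> creation (\<Sum>s<t. h s) (\<Sum>s<t. u s)" for t :: nat
proof (induction t)
  case 0
  show "creation (\<Sum>s<0. h s) (\<Sum>s<0. u s)" by (simp add: creation_0)
next
  case (Suc t)
  have "creation (\<Sum>s<t. h s) (\<Sum>s<t. u s)" by (rule Suc.IH) (simp add: Suc.prems)
  then show "creation (\<Sum>s<Suc t. h s) (\<Sum>s<Suc t. u s)"
    unfolding sum.lessThan_Suc by (rule creation_add) (simp add: Suc.prems)
qed

lemma creation_bilinear_limit:
  assumes "creation h u"
    and free_limit: "\<And>D w v. contractions D \<Longrightarrow> \<forall>D\<in>set w. contractions D \<Longrightarrow> norm_bounded v \<Longrightarrow>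
      ((\<lambda>x. avg (free (D # w) v * y) x - c x * avg (lift D * free w v * z) x) \<longlongrightarrow> 0) F"
  shows "((\<lambda>x. avg (u * y) x - c x * avg (h * z) x) \<longlongrightarrow> 0) F"
  using assms(1)
proof induction
  case (creation_free D w v)
  then show ?case by (rule free_limit)
next
  case (creation_scalar d l h u)
  have "d x * (avg (u * y) x - c x * avg (h * z) x)
      = avg (scalar d * u * y) x - c x * avg (scalar d * h * z) x" for x
    by (simp only: mult.assoc[of "scalar d"] avg_scalar right_diff_distrib
      mult.left_commute[of "c x"])
  moreover have "((\<lambda>x. d x * (avg (u * y) x - c x * avg (h * z) x)) \<longlongrightarrow> l * 0) F"
    by (intro tendsto_mult creation_scalar)
  ultimately show "((\<lambda>x. avg (scalar d * u * y) x - c x * avg (scalar d * h * z) x) \<longlongrightarrow> 0) F"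
    by simp
next
  case (creation_add h u h' u')
  have "((\<lambda>x. avg (u * y) x - c x * avg (h * z) x + (avg (u' * y) x - c x * avg (h' * z) x))
      \<longlongrightarrow> 0 + 0) F"
    by (rule tendsto_add[OF creation_add.IH])
  then show "((\<lambda>x. avg ((u + u') * y) x - c x * avg ((h + h') * z) x) \<longlongrightarrow> 0) F"
    by (simp add: distrib_right avg_add algebra_simps)
next
  case (creation_cong h u h' u')
  have "avg (u' * y) = avg (u * y)" "avg (h' * z) = avg (h * z)"
    using creation_cong.hyps by (auto intro!: avg_cong agree_mult intro: agree_sym)
  moreover have "((\<lambda>x. avg (u * y) x - c x * avg (h * z) x) \<longlongrightarrow> 0) F"
    by (rule creation_cong.IH)
  ultimately show "((\<lambda>x. avg (u' * y) x - c x * avg (h' * z) x) \<longlongrightarrow> 0) F"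
    by simp
qed

lemma creation_limit:
  assumes "creation h u" and "norm_bounded y"
  shows "(avg (lift y * u) \<longlongrightarrow> 0) F"
proof -
  have "((\<lambda>x. avg (u * lift y) x - 0 * avg (h * 0) x) \<longlongrightarrow> 0) F"
    by (rule creation_bilinear_limit[OF assms(1), where c = "\<lambda>_. 0"])
      (use assms(2) in \<open>auto simp: mult.commute[of _ "lift y"]
        simp del: free.simps intro!: free_limit\<close>)
  then show ?thesis by (simp add: mult.commute)
qed

lemma creation_isometry:
  assumes creation_h: "creation h u" and creation_h': "creation h' u'"
    and contraction_A: "contractions A"
  shows "((\<lambda>x. avg (u * (lift A * u')) x - avg (lift A) x * avg (h * h') x) \<longlongrightarrow> 0) F"
proof (rule creation_bilinear_limit[OF creation_h])
  fix D w v assume word: "contractions D" "\<forall>D\<in>set w. contractions D" "norm_bounded v"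
  have "((\<lambda>x. avg (u' * (lift A * free (D # w) v)) x - avg (lift A) x * avg (h' * (lift D * free w v)) x) \<longlongrightarrow> 0) F"
    using word contraction_A
    by (intro creation_bilinear_limit[OF creation_h'] avg_free_mult_free) auto
  then show "((\<lambda>x. avg (free (D # w) v * (lift A * u')) x - avg (lift A) x * avg (lift D * free w v * h') x) \<longlongrightarrow> 0) F"
    by (simp only: mult_ac)
qed

lemma creation_Zmul:
  assumes "creation h u" and contraction_E: "contractions E"
  shows "creation (lift E * u) (Zmul (lift E * u) - scalar (avg (lift E)) * h)"
  using assms(1)
proof induction
  case (creation_free D w v)
  then have "creation (lift E * free (D # w) v) (free (E # D # w) v)"
    using contraction_E by (intro creation.creation_free) auto
  then show "creation (lift E * free (D # w) v)
      (Zmul (lift E * free (D # w) v) - scalar (avg (lift E)) * (lift D * free w v))"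
    by simp
next
  case (creation_scalar c l h u)
  have "creation (scalar c * (lift E * u)) (scalar c * (Zmul (lift E * u) - scalar (avg (lift E)) * h))"
    by (rule creation.creation_scalar[OF creation_scalar(1) creation_scalar.IH])
  then show "creation (lift E * (scalar c * u))
      (Zmul (lift E * (scalar c * u)) - scalar (avg (lift E)) * (scalar c * h))"
    by (simp add: mult.left_commute[of _ "scalar c"] Zmul_scalar right_diff_distrib)
next
  case (creation_add h u h' u')
  have "creation (lift E * u + lift E * u')
      ((Zmul (lift E * u) - scalar (avg (lift E)) * h)
        + (Zmul (lift E * u') - scalar (avg (lift E)) * h'))"
    by (rule creation.creation_add[OF creation_add.IH])
  then show "creation (lift E * (u + u'))
      (Zmul (lift E * (u + u')) - scalar (avg (lift E)) * (h + h'))"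
    by (simp add: distrib_left Zmul_add add_diff_add)
next
  case (creation_cong h u h' u')
  have "lift E * u \<simeq> lift E * u'" using creation_cong.hyps by (intro agree_mult) auto
  moreover have "Zmul (lift E * u) - scalar (avg (lift E)) * h
      \<simeq> Zmul (lift E * u') - scalar (avg (lift E)) * h'"
    using creation_cong.hyps Zmul_cong[OF \<open>lift E * u \<simeq> lift E * u'\<close>] by (simp add: agree_def)
  ultimately show ?case by (rule creation.creation_cong[OF creation_cong.IH])
qed

end

sublocale goe_sequence \<subseteq> asymptotically_free "prob_filter P" fst "case_prod Z"
  by unfold_locales (rule avg_free_tendsto_0)

section \<open>The AMP recursion\<close>

lemma tau_Suc_True: "\<delta> t i \<Longrightarrow> tau \<delta> (Suc t) i = t"
  unfolding tau_def by (rule Max_eqI) auto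

lemma tau_Suc_False: "\<not> \<delta> t i \<Longrightarrow> tau \<delta> (Suc t) i = tau \<delta> t i"
  unfolding tau_def by (rule arg_cong[of _ _ Max]) (auto simp: less_Suc_eq)

lemma tau_less: "\<delta> 0 i \<Longrightarrow> tau \<delta> (Suc t) i < Suc t"
  by (induction t) (metis less_SucI less_Suc_eq tau_Suc_False tau_Suc_True)+

lemma tau_eq_iff:
  assumes "\<delta> 0 i" and "s < Suc t"
  shows "tau \<delta> (Suc t) i = s \<longleftrightarrow> \<delta> s i \<and> (\<forall>r. s < r \<and> r < Suc t \<longrightarrow> \<not> \<delta> r i)"
proof -
  have "tau \<delta> (Suc t) i = s \<longleftrightarrow> s \<in> {s. s < Suc t \<and> \<delta> s i} \<and> (\<forall>r\<in>{s. s < Suc t \<and> \<delta> s i}. r \<le> s)"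
    unfolding tau_def using assms(1) by (intro Max_eq_iff) auto
  then show ?thesis using assms(2) by (auto simp: not_less[symmetric])
qed

definition last_update :: "(nat \<Rightarrow> nat \<Rightarrow> nat \<Rightarrow> bool) \<Rightarrow> nat \<Rightarrow> nat \<Rightarrow> nat \<Rightarrow> nat \<Rightarrow> real" where
  "last_update \<delta> t s n i = of_bool (tau (\<delta> n) t i = s)"

lemma contractions_last_update: "contractions (last_update \<delta> t s)"
  by (auto simp: contractions_def contraction_def last_update_def)

lemma mean_last_update: "mean n (last_update \<delta> t s n) = real (wts n (\<delta> n) t s) / real n"
proof -
  have "(\<Sum>i<n. last_update \<delta> t s n i) = real (card ({..<n} \<inter> {i. tau (\<delta> n) t i = s}))"
    unfolding last_update_def by (subst sum_of_bool_eq) auto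
  also have "{..<n} \<inter> {i. tau (\<delta> n) t i = s} = {i. i < n \<and> tau (\<delta> n) t i = s}" by auto
  finally show ?thesis by (simp add: mean_def wts_def)
qed

lemma sum_last_update_mult:
  assumes "\<delta> n 0 i"
  shows "(\<Sum>s<Suc t. last_update \<delta> (Suc t) s n i * f s) = f (tau (\<delta> n) (Suc t) i)"
proof -
  have "(\<Sum>s<Suc t. last_update \<delta> (Suc t) s n i * f s)
      = (\<Sum>s<Suc t. if s = tau (\<delta> n) (Suc t) i then f s else 0)"
    unfolding last_update_def by (intro sum.cong refl) auto
  then show ?thesis using tau_less[of "\<delta> n" i t] assms by (simp add: sum.delta del: sum.lessThan_Suc)
qed

lemma AMP_nth: "s \<le> Suc t \<Longrightarrow> snd (AMP n M \<delta> h0 t) ! s = theta_hat n M \<delta> h0 s"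
  and length_AMP: "length (snd (AMP n M \<delta> h0 t)) = Suc (Suc t)"
proof -
  have length: "length (snd (AMP n M \<delta> h0 t)) = Suc (Suc t)" for t
    by (induction t) (auto simp: Let_def split: prod.splits)
  then show "length (snd (AMP n M \<delta> h0 t)) = Suc (Suc t)" .
  have append: "\<exists>y. snd (AMP n M \<delta> h0 (Suc t)) = snd (AMP n M \<delta> h0 t) @ [y]" for t
    by (auto simp: Let_def split: prod.splits)
  have stable: "snd (AMP n M \<delta> h0 (t + k)) ! s = snd (AMP n M \<delta> h0 t) ! s" if "s \<le> Suc t" for s t k
  proof (induction k)
    case (Suc k)
    obtain y where "snd (AMP n M \<delta> h0 (Suc (t + k))) = snd (AMP n M \<delta> h0 (t + k)) @ [y]"
      using append by blast
    then show ?case using Suc that length[of "t + k"] by (simp add: nth_append)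
  qed simp
  show "snd (AMP n M \<delta> h0 t) ! s = theta_hat n M \<delta> h0 s" if "s \<le> Suc t"
    using that stable[of s s "t - s"] stable[of s t 1]
    by (cases "s \<le> t") (auto simp: theta_hat_def le_Suc_eq)
qed

lemma theta_hat_0: "theta_hat n M \<delta> h0 0 = h0"
  by (simp add: theta_hat_def Let_def)

lemma theta_hat_Suc: "theta_hat n M \<delta> h0 (Suc t) = renorm n (fst (AMP n M \<delta> h0 t))"
proof -
  have "snd (AMP n M \<delta> h0 t) ! Suc t = renorm n (fst (AMP n M \<delta> h0 t))"
    using length_AMP[of n M \<delta> h0 "t - 1"]
    by (cases t) (auto simp: Let_def nth_append split: prod.splits)
  then show ?thesis using AMP_nth[of "Suc t" t n M \<delta> h0] by simp
qed

lemma fst_AMP_0: "fst (AMP n M \<delta> h0 0) = matvec n M h0"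
  by (simp add: Let_def)

lemma fst_AMP_Suc: "fst (AMP n M \<delta> h0 (Suc t)) i =
   (if \<delta> (Suc t) i then matvec n M (theta_hat n M \<delta> h0 (Suc t)) i
      - (\<Sum>s<Suc t. real (wts n \<delta> (Suc t) s) * theta_hat n M \<delta> h0 s i)
         / (sqrt (real n) * vnorm n (fst (AMP n M \<delta> h0 t)))
    else fst (AMP n M \<delta> h0 t) i)"
proof -
  have "(\<Sum>s<Suc t. real (wts n \<delta> (Suc t) s) * (snd (AMP n M \<delta> h0 t) ! s) i)
      = (\<Sum>s<Suc t. real (wts n \<delta> (Suc t) s) * theta_hat n M \<delta> h0 s i)"
    by (intro sum.cong refl) (simp add: AMP_nth)
  note onsager = this
  have current: "snd (AMP n M \<delta> h0 t) ! Suc t = theta_hat n M \<delta> h0 (Suc t)"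
    by (rule AMP_nth) simp
  show ?thesis
    unfolding onsager[symmetric] current[symmetric]
    by (simp add: Let_def split: prod.splits del: sum.lessThan_Suc)
qed

lemma length_rhos: "length (rhos lam r0 p t) = Suc t"
  by (induction t) (auto simp: Let_def)

lemma rhos_nth: "s \<le> t \<Longrightarrow> rhos lam r0 p t ! s = rho lam r0 p s"
proof (induction t)
  case (Suc t)
  show ?case
  proof (cases "s = Suc t")
    case False
    then have "s \<le> t" using Suc by simp
    then show ?thesis using Suc length_rhos[of lam r0 p t] by (simp add: Let_def nth_append)
  qed (simp add: rho_def)
qed (simp add: rho_def)

lemma rho_0: "rho lam r0 p 0 = r0"
  by (simp add: rho_def)

lemma rho_Suc: "rho lam r0 p (Suc t) = lam * (\<Sum>s<Suc t. rho lam r0 p s * p (Suc t) s)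
   / sqrt (\<Sum>s<Suc t. (lam\<^sup>2 * (rho lam r0 p s)\<^sup>2 + 1) * p (Suc t) s)"
proof -
  let ?r = "rhos lam r0 p t"
  have "rho lam r0 p (Suc t) = lam * (\<Sum>s<Suc t. ?r ! s * p (Suc t) s)
   / sqrt (\<Sum>s<Suc t. (lam\<^sup>2 * (?r ! s)\<^sup>2 + 1) * p (Suc t) s)"
    using length_rhos[of lam r0 p t] by (simp add: rho_def Let_def nth_append del: sum.lessThan_Suc)
  also have "(\<Sum>s<Suc t. ?r ! s * p (Suc t) s) = (\<Sum>s<Suc t. rho lam r0 p s * p (Suc t) s)"
    by (intro sum.cong refl) (simp add: rhos_nth)
  also have "(\<Sum>s<Suc t. (lam\<^sup>2 * (?r ! s)\<^sup>2 + 1) * p (Suc t) s)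
      = (\<Sum>s<Suc t. (lam\<^sup>2 * (rho lam r0 p s)\<^sup>2 + 1) * p (Suc t) s)"
    by (intro sum.cong refl) (simp add: rhos_nth)
  finally show ?thesis .
qed

section \<open>State evolution\<close>

lemma norm_bounded_of_tendsto:
  assumes "(\<lambda>n. mean n (v n * v n)) \<longlonglongrightarrow> l"
  shows "norm_bounded v"
proof -
  have "Bseq (\<lambda>n. mean n (v n * v n))"
    using assms by (intro convergent_imp_Bseq) (rule convergentI)
  then obtain K where mean_le: "K > 0" "\<And>n. norm (mean n (v n * v n)) \<le> K"
    by (elim BseqE) blast
  have "sqnorm n (v n) \<le> K * real n" for n
    using mean_le(2)[of n] by (cases "n = 0") (auto simp: mean_mult_self sqnorm_def field_simps)
  then show ?thesis using mean_le(1) by (auto simp: norm_bounded_def intro!: exI[of _ K])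
qed

locale amp = asymptotically_free F N Z for F :: "'x filter" and N Z +
  fixes \<theta> h0 :: "nat \<Rightarrow> nat \<Rightarrow> real" and \<delta> :: "nat \<Rightarrow> nat \<Rightarrow> nat \<Rightarrow> bool"
    and lam r0 :: real and p :: "nat \<Rightarrow> nat \<Rightarrow> real"
  assumes h0_norm: "n \<ge> 1 \<Longrightarrow> vnorm n (h0 n) = sqrt (real n)"
    and \<delta>_0: "i < n \<Longrightarrow> \<delta> n 0 i"
    and update_limit: "s \<le> t \<Longrightarrow> (\<lambda>n. mean n (last_update \<delta> (Suc t) s n)) \<longlonglongrightarrow> p (Suc t) s"
    and signal_update_limit: "s \<le> t \<Longrightarrow>
      (\<lambda>n. mean n (last_update \<delta> (Suc t) s n * (\<theta> n * \<theta> n))) \<longlonglongrightarrow> p (Suc t) s"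
    and initial_overlap_limit: "(\<lambda>n. mean n (\<theta> n * h0 n)) \<longlonglongrightarrow> r0"
begin

definition spiked :: "'x \<Rightarrow> nat \<Rightarrow> nat \<Rightarrow> real" where
  "spiked x = (\<lambda>i j. lam / real (N x) * \<theta> (N x) i * \<theta> (N x) j + Z x i j)"

definition estimate :: "nat \<Rightarrow> 'x \<Rightarrow> nat \<Rightarrow> real" where
  "estimate t x = theta_hat (N x) (spiked x) (\<delta> (N x)) (h0 (N x)) t"

definition iterate :: "nat \<Rightarrow> 'x \<Rightarrow> nat \<Rightarrow> real" where
  "iterate t x = fst (AMP (N x) (spiked x) (\<delta> (N x)) (h0 (N x)) t)"

definition gain :: "nat \<Rightarrow> 'x \<Rightarrow> real" where
  "gain t x = sqrt (real (N x)) / vnorm (N x) (iterate t x)"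

definition overlap :: "nat \<Rightarrow> 'x \<Rightarrow> real" where
  "overlap t = avg (lift \<theta> * estimate t)"

abbreviation updated :: "nat \<Rightarrow> nat \<Rightarrow> 'x \<Rightarrow> nat \<Rightarrow> real" where
  "updated t s \<equiv> lift (last_update \<delta> t s)"

text \<open>The Onsager term is \<open>\<ell>\<^sup>*\<close> applied to \<open>estimate t\<close>, so that \<open>noise t\<close> is \<open>\<ell>\<close> applied to
  \<open>estimate t\<close>.\<close>

definition onsager :: "nat \<Rightarrow> 'x \<Rightarrow> nat \<Rightarrow> real" where
  "onsager t = (case t of 0 \<Rightarrow> 0
     | Suc r \<Rightarrow> scalar (gain r) * (\<Sum>s<t. scalar (avg (updated t s)) * estimate s))"

definition noise :: "nat \<Rightarrow> 'x \<Rightarrow> nat \<Rightarrow> real" where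
  "noise t = Zmul (estimate t) - onsager t"

definition observation :: "nat \<Rightarrow> 'x \<Rightarrow> nat \<Rightarrow> real" where
  "observation t = scalar (\<lambda>x. lam * overlap t x) * lift \<theta> + noise t"

lemma estimate_0: "estimate 0 = lift h0"
  by (simp add: estimate_def lift_def theta_hat_0 fun_eq_iff)

lemma estimate_Suc: "estimate (Suc t) = scalar (gain t) * iterate t"
  by (simp add: estimate_def iterate_def gain_def scalar_def theta_hat_Suc renorm_def fun_eq_iff)

lemma gain_eq: "gain t x = 1 / sqrt (avg (iterate t * iterate t) x)"
  by (simp add: gain_def avg_def mean_mult_self sqnorm_def vnorm_def real_sqrt_divide)

lemma matvec_spiked:
  "matvec (N x) (spiked x) (X x) i = lam * avg (lift \<theta> * X) x * \<theta> (N x) i + Zmul X x i"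
proof -
  have "matvec (N x) (spiked x) (X x) i
      = (\<Sum>j<N x. lam / real (N x) * \<theta> (N x) i * (\<theta> (N x) j * X x j) + Z x i j * X x j)"
    unfolding matvec_def spiked_def by (intro sum.cong refl) (simp add: algebra_simps)
  also have "\<dots> = lam / real (N x) * \<theta> (N x) i * vinner (N x) (\<theta> (N x)) (X x) + Zmul X x i"
    by (simp only: sum.distrib sum_distrib_left[symmetric] vinner_def matvec_def Zmul_def)
  finally show ?thesis by (simp add: avg_def mean_mult lift_def)
qed

lemma onsager_Suc_eq:
  assumes "i < N x"
  shows "(\<Sum>s<Suc t. real (wts (N x) (\<delta> (N x)) (Suc t) s) * estimate s x i)
      / (sqrt (real (N x)) * vnorm (N x) (iterate t x)) = onsager (Suc t) x i"
proof -
  have "sqrt (real (N x)) * sqrt (real (N x)) = real (N x)" "sqrt (real (N x)) > 0"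
    using assms by auto
  then have scale: "1 / (sqrt (real (N x)) * vnorm (N x) (iterate t x)) = gain t x / real (N x)"
    unfolding gain_def by (metis (no_types, lifting) divide_divide_eq_left divide_self_if less_irrefl
        mult.commute nonzero_divide_mult_cancel_left)
  have "onsager (Suc t) x i
      = (\<Sum>s<Suc t. real (wts (N x) (\<delta> (N x)) (Suc t) s) * estimate s x i) * (gain t x / real (N x))"
    unfolding onsager_def nat.case times_fun_apply sum_fun_apply sum_distrib_left sum_distrib_right
    by (intro sum.cong refl) (simp add: scalar_def avg_def lift_def mean_last_update)
  then show ?thesis unfolding scale[symmetric] by simp
qed

lemma iterate_eq_observation:
  "i < N x \<Longrightarrow> iterate t x i = observation (tau (\<delta> (N x)) (Suc t) i) x i"
proof (induction t)
  case 0
  have "tau (\<delta> (N x)) (Suc 0) i = 0" using \<delta>_0[OF 0] by (rule tau_Suc_True)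
  moreover have "iterate 0 x i = matvec (N x) (spiked x) (estimate 0 x) i"
    by (simp only: iterate_def fst_AMP_0 estimate_def theta_hat_0)
  ultimately show ?case
    by (simp add: matvec_spiked observation_def noise_def onsager_def scalar_def overlap_def lift_def)
next
  case (Suc t)
  have iterate_Suc: "iterate (Suc t) x i = (if \<delta> (N x) (Suc t) i
      then matvec (N x) (spiked x) (estimate (Suc t) x) i - onsager (Suc t) x i else iterate t x i)"
    unfolding onsager_Suc_eq[OF Suc.prems, symmetric]
    unfolding iterate_def estimate_def by (rule fst_AMP_Suc)
  show ?case
  proof (cases "\<delta> (N x) (Suc t) i")
    case True
    then show ?thesis
      by (simp add: iterate_Suc tau_Suc_True matvec_spiked observation_def noise_def scalar_def overlap_def
        lift_def)
  next
    case False
    then show ?thesis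
      using Suc by (simp add: iterate_Suc tau_Suc_False[of "\<delta> (N x)", OF False])
  qed
qed

lemma sum_updated_mult:
  assumes "i < N x"
  shows "(\<Sum>s<Suc t. updated (Suc t) s * X s) x i = X (tau (\<delta> (N x)) (Suc t) i) x i"
  using sum_last_update_mult[of \<delta> "N x" i t "\<lambda>s. X s x i"] \<delta>_0[OF assms]
  by (simp add: lift_def del: sum.lessThan_Suc)

lemma avg_mult_iterate:
  "avg (Y * iterate t) x = (\<Sum>s<Suc t. avg (updated (Suc t) s * (Y * observation s)) x)"
proof -
  have "Y * iterate t \<simeq> (\<Sum>s<Suc t. updated (Suc t) s * (Y * observation s))"
    unfolding agree_def
    by (simp add: sum_updated_mult iterate_eq_observation del: sum.lessThan_Suc sum_fun_apply)
  then show ?thesis by (simp add: avg_cong avg_sum del: sum.lessThan_Suc)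
qed

lemma avg_iterate_square:
  "avg (iterate t * iterate t) x
    = (\<Sum>s<Suc t. avg (updated (Suc t) s * (observation s * observation s)) x)"
proof -
  have "iterate t * iterate t \<simeq> (\<Sum>s<Suc t. updated (Suc t) s * (observation s * observation s))"
    unfolding agree_def
    by (simp add: sum_updated_mult iterate_eq_observation del: sum.lessThan_Suc sum_fun_apply)
  then show ?thesis by (simp add: avg_cong avg_sum del: sum.lessThan_Suc)
qed

lemma estimate_Suc_agree:
  "estimate (Suc t) \<simeq> scalar (gain t) * (\<Sum>s<Suc t. updated (Suc t) s * observation s)"
  unfolding agree_def
  by (simp add: estimate_Suc sum_updated_mult iterate_eq_observation
      del: sum.lessThan_Suc sum_fun_apply)

lemma p_nonneg: "s \<le> t \<Longrightarrow> 0 \<le> p (Suc t) s"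
  by (rule tendsto_lowerbound[OF update_limit])
    (auto simp: mean_def last_update_def intro!: always_eventually divide_nonneg_nonneg sum_nonneg)

lemma sum_p_eq_1: "(\<Sum>s<Suc t. p (Suc t) s) = 1"
proof (rule LIMSEQ_unique)
  show "(\<lambda>n. \<Sum>s<Suc t. mean n (last_update \<delta> (Suc t) s n)) \<longlonglongrightarrow> (\<Sum>s<Suc t. p (Suc t) s)"
    by (intro tendsto_sum update_limit) simp
  have "(\<Sum>s<Suc t. mean n (last_update \<delta> (Suc t) s n)) = 1" if n_ge_1: "n \<ge> 1" for n
  proof -
    have "(\<Sum>s<Suc t. mean n (last_update \<delta> (Suc t) s n))
        = (\<Sum>i<n. \<Sum>s<Suc t. last_update \<delta> (Suc t) s n i * 1) / real n"
      unfolding mean_def sum_divide_distrib[symmetric] mult_1_right by (subst sum.swap) (rule refl)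
    then show ?thesis
      using n_ge_1 sum_last_update_mult[of \<delta> n _ t "\<lambda>_. 1"] \<delta>_0 by (simp del: sum.lessThan_Suc)
  qed
  then show "(\<lambda>n. \<Sum>s<Suc t. mean n (last_update \<delta> (Suc t) s n)) \<longlonglongrightarrow> 1"
    by (intro tendsto_eventually eventually_sequentiallyI[of 1]) auto
qed

lemma norm_bounded_\<theta>: "norm_bounded \<theta>"
proof (rule norm_bounded_of_tendsto)
  have "mean n (last_update \<delta> (Suc 0) 0 n * (\<theta> n * \<theta> n)) = mean n (\<theta> n * \<theta> n)" for n
    using tau_Suc_True[of "\<delta> n" 0] \<delta>_0 by (intro mean_cong) (simp add: last_update_def)
  then show "(\<lambda>n. mean n (\<theta> n * \<theta> n)) \<longlonglongrightarrow> p (Suc 0) 0"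
    using signal_update_limit[of 0 0] by simp
qed

lemma mean_h0_square: "(\<lambda>n. mean n (h0 n * h0 n)) \<longlonglongrightarrow> 1"
proof (intro tendsto_eventually eventually_sequentiallyI[of 1])
  fix n :: nat assume "1 \<le> n"
  then show "mean n (h0 n * h0 n) = 1"
    using h0_norm[of n] by (simp add: mean_mult_self sqnorm_eq_vnorm_square)
qed

definition state_limit :: "nat \<Rightarrow> bool" where
  "state_limit t \<longleftrightarrow> creation (estimate t) (noise t) \<and> (overlap t \<longlongrightarrow> rho lam r0 p t) F
     \<and> (avg (estimate t * estimate t) \<longlongrightarrow> 1) F"

definition energy :: "nat \<Rightarrow> real" where
  "energy t = (\<Sum>s<Suc t. (lam\<^sup>2 * (rho lam r0 p s)\<^sup>2 + 1) * p (Suc t) s)"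

lemma energy_pos: "energy t > 0"
proof -
  have "energy t = (\<Sum>s<Suc t. lam\<^sup>2 * (rho lam r0 p s)\<^sup>2 * p (Suc t) s) + 1"
    unfolding energy_def using sum_p_eq_1[of t] by (simp only: distrib_right sum.distrib mult_1)
  moreover have "0 \<le> (\<Sum>s<Suc t. lam\<^sup>2 * (rho lam r0 p s)\<^sup>2 * p (Suc t) s)"
    by (intro sum_nonneg mult_nonneg_nonneg p_nonneg) auto
  ultimately show ?thesis by linarith
qed

context
  fixes s t :: nat
  assumes s_le: "s \<le> t" and limit: "state_limit s"
begin

lemma updated_signal_limit: "(avg (updated (Suc t) s * (lift \<theta> * lift \<theta>)) \<longlongrightarrow> p (Suc t) s) F"
  using tendsto_avg_lift[of "last_update \<delta> (Suc t) s * (\<theta> * \<theta>)"] signal_update_limit[OF s_le]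
  by (simp add: lift_mult)

lemma updated_cross_limit: "(avg (updated (Suc t) s * lift \<theta> * noise s) \<longlongrightarrow> 0) F"
  using limit creation_limit[of "estimate s" "noise s" "last_update \<delta> (Suc t) s * \<theta>"]
  by (simp add: state_limit_def lift_mult norm_bounded_contractions_mult contractions_last_update
    norm_bounded_\<theta>)

lemma updated_noise_limit: "(avg (noise s * (updated (Suc t) s * noise s)) \<longlongrightarrow> p (Suc t) s) F"
proof -
  let ?a = "avg (updated (Suc t) s)"
  have avg_tendsto: "(?a \<longlongrightarrow> p (Suc t) s) F"
    by (rule tendsto_avg_lift[OF update_limit[OF s_le]])
  have "((\<lambda>x. (avg (noise s * (updated (Suc t) s * noise s)) x - ?a x * avg (estimate s * estimate s) x)
      + ?a x * avg (estimate s * estimate s) x) \<longlongrightarrow> 0 + p (Suc t) s * 1) F"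
    using limit unfolding state_limit_def
    by (intro tendsto_add tendsto_mult avg_tendsto creation_isometry contractions_last_update) auto
  then show ?thesis by simp
qed

lemma observation_signal_limit:
  "(avg (updated (Suc t) s * (lift \<theta> * observation s)) \<longlongrightarrow> lam * rho lam r0 p s * p (Suc t) s) F"
proof -
  let ?c = "\<lambda>x. lam * overlap s x"
  let ?T = "updated (Suc t) s * (lift \<theta> * lift \<theta>)" and ?I = "updated (Suc t) s * lift \<theta> * noise s"
  have "updated (Suc t) s * (lift \<theta> * observation s) = scalar ?c * ?T + ?I"
    unfolding observation_def by (simp only: distrib_left mult_ac)
  then have "avg (updated (Suc t) s * (lift \<theta> * observation s)) = (\<lambda>x. ?c x * avg ?T x + avg ?I x)"
    by (intro ext) (simp only: avg_add avg_scalar)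
  moreover have "((\<lambda>x. ?c x * avg ?T x + avg ?I x) \<longlongrightarrow> lam * rho lam r0 p s * p (Suc t) s + 0) F"
    using limit unfolding state_limit_def
    by (intro tendsto_intros updated_signal_limit updated_cross_limit) auto
  ultimately show ?thesis by simp
qed

lemma observation_energy_limit:
  "(avg (updated (Suc t) s * (observation s * observation s))
    \<longlongrightarrow> (lam\<^sup>2 * (rho lam r0 p s)\<^sup>2 + 1) * p (Suc t) s) F"
proof -
  let ?c = "\<lambda>x. lam * overlap s x" and ?r = "lam * rho lam r0 p s"
  let ?T = "updated (Suc t) s * (lift \<theta> * lift \<theta>)" and ?I = "updated (Suc t) s * lift \<theta> * noise s"
  let ?Q = "noise s * (updated (Suc t) s * noise s)"
  have "updated (Suc t) s * (observation s * observation s)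
      = scalar ?c * (scalar ?c * ?T) + scalar ?c * ?I + scalar ?c * ?I + ?Q"
    unfolding observation_def by (simp only: distrib_left distrib_right mult_ac add_ac)
  then have "avg (updated (Suc t) s * (observation s * observation s))
      = (\<lambda>x. ?c x * (?c x * avg ?T x) + ?c x * avg ?I x + ?c x * avg ?I x + avg ?Q x)"
    by (intro ext) (simp only: avg_add avg_scalar)
  moreover have "((\<lambda>x. ?c x * (?c x * avg ?T x) + ?c x * avg ?I x + ?c x * avg ?I x + avg ?Q x)
      \<longlongrightarrow> ?r * (?r * p (Suc t) s) + ?r * 0 + ?r * 0 + p (Suc t) s) F"
    using limit unfolding state_limit_def
    by (intro tendsto_intros updated_signal_limit updated_cross_limit updated_noise_limit) auto
  moreover have "?r * (?r * p (Suc t) s) + ?r * 0 + ?r * 0 + p (Suc t) s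
      = (lam\<^sup>2 * (rho lam r0 p s)\<^sup>2 + 1) * p (Suc t) s"
    by (simp add: power2_eq_square distrib_right)
  ultimately show ?thesis by (simp only: )
qed

lemma creation_updated_observation:
  "creation (updated (Suc t) s * observation s)
    (Zmul (updated (Suc t) s * observation s) - scalar (avg (updated (Suc t) s)) * estimate s)"
proof -
  let ?c = "\<lambda>x. lam * overlap s x" and ?D = "last_update \<delta> (Suc t) s"
  have "creation (scalar ?c * (lift ?D * free [] \<theta>) + lift ?D * noise s)
      (scalar ?c * free [?D] \<theta> + (Zmul (lift ?D * noise s) - scalar (avg (lift ?D)) * estimate s))"
  proof (rule creation_add)
    have "(?c \<longlongrightarrow> lam * rho lam r0 p s) F"
      using limit by (intro tendsto_intros) (simp add: state_limit_def)
    then show "creation (scalar ?c * (lift ?D * free [] \<theta>)) (scalar ?c * free [?D] \<theta>)"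
      by (intro creation_scalar creation_free contractions_last_update norm_bounded_\<theta>) auto
    show "creation (lift ?D * noise s)
        (Zmul (lift ?D * noise s) - scalar (avg (lift ?D)) * estimate s)"
      using limit by (intro creation_Zmul contractions_last_update) (simp add: state_limit_def)
  qed
  moreover have "lift ?D * observation s = scalar ?c * (lift ?D * free [] \<theta>) + lift ?D * noise s"
    by (simp add: observation_def distrib_left mult.left_commute)
  ultimately show ?thesis
    by (simp add: Zmul_add Zmul_scalar add_diff_eq)
qed

end

context
  fixes t :: nat
  assumes limits: "\<And>s. s \<le> t \<Longrightarrow> state_limit s"
begin

lemma iterate_signal_limit:
  "(avg (lift \<theta> * iterate t) \<longlongrightarrow> lam * (\<Sum>s<Suc t. rho lam r0 p s * p (Suc t) s)) F"
  unfolding avg_mult_iterate sum_distrib_left mult.assoc[symmetric]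
  by (intro tendsto_sum observation_signal_limit[unfolded mult.assoc[symmetric]] limits) auto

lemma iterate_energy_limit: "(avg (iterate t * iterate t) \<longlongrightarrow> energy t) F"
  unfolding avg_iterate_square energy_def
  by (intro tendsto_sum observation_energy_limit limits) auto

lemma gain_limit: "(gain t \<longlongrightarrow> 1 / sqrt (energy t)) F"
  unfolding gain_eq using energy_pos[of t] by (intro tendsto_intros iterate_energy_limit) auto

lemma creation_estimate_Suc: "creation (estimate (Suc t)) (noise (Suc t))"
proof (rule creation_cong)
  let ?U = "\<lambda>s. updated (Suc t) s"
  let ?h = "\<Sum>s<Suc t. ?U s * observation s"
  let ?u = "\<Sum>s<Suc t. Zmul (?U s * observation s) - scalar (avg (?U s)) * estimate s"
  show "creation (scalar (gain t) * ?h) (scalar (gain t) * ?u)"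
    by (intro creation_scalar[OF gain_limit] creation_sum creation_updated_observation limits) auto
  show agree: "scalar (gain t) * ?h \<simeq> estimate (Suc t)"
    by (rule agree_sym[OF estimate_Suc_agree])
  have "scalar (gain t) * ?u = Zmul (scalar (gain t) * ?h) - onsager (Suc t)"
    by (simp only: onsager_def nat.case Zmul_scalar Zmul_sum sum_subtractf right_diff_distrib)
  then show "scalar (gain t) * ?u \<simeq> noise (Suc t)"
    unfolding noise_def Zmul_cong[OF agree] by (simp only: agree_refl)
qed

lemma state_limit_Suc: "state_limit (Suc t)"
  unfolding state_limit_def
proof (intro conjI creation_estimate_Suc)
  have "overlap (Suc t) = (\<lambda>x. gain t x * avg (lift \<theta> * iterate t) x)"
    by (intro ext) (simp only: overlap_def estimate_Suc mult.left_commute[of _ "scalar _"] avg_scalar)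
  moreover have "((\<lambda>x. gain t x * avg (lift \<theta> * iterate t) x)
      \<longlongrightarrow> 1 / sqrt (energy t) * (lam * (\<Sum>s<Suc t. rho lam r0 p s * p (Suc t) s))) F"
    by (intro tendsto_mult gain_limit iterate_signal_limit)
  ultimately show "(overlap (Suc t) \<longlongrightarrow> rho lam r0 p (Suc t)) F"
    by (simp add: rho_Suc energy_def del: sum.lessThan_Suc)
  have "estimate (Suc t) * estimate (Suc t)
      = scalar (gain t) * (scalar (gain t) * (iterate t * iterate t))"
    by (simp only: estimate_Suc mult_ac)
  then have "avg (estimate (Suc t) * estimate (Suc t))
      = (\<lambda>x. gain t x * (gain t x * avg (iterate t * iterate t) x))"
    by (intro ext) (simp only: avg_scalar)
  moreover have "((\<lambda>x. gain t x * (gain t x * avg (iterate t * iterate t) x))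
      \<longlongrightarrow> 1 / sqrt (energy t) * (1 / sqrt (energy t) * energy t)) F"
    by (intro tendsto_mult gain_limit iterate_energy_limit)
  ultimately show "(avg (estimate (Suc t) * estimate (Suc t)) \<longlongrightarrow> 1) F"
    using energy_pos[of t] by simp
qed

end

lemma state_limit_0: "state_limit 0"
  unfolding state_limit_def
proof (intro conjI)
  have "contractions 1" by (simp add: contractions_def contraction_def)
  then show "creation (estimate 0) (noise 0)"
    using creation_free[of 1 "[]" h0] norm_bounded_of_tendsto[OF mean_h0_square]
    by (simp add: estimate_0 noise_def onsager_def)
  show "(overlap 0 \<longlongrightarrow> rho lam r0 p 0) F"
    using tendsto_avg_lift[of "\<theta> * h0"] initial_overlap_limit
    by (simp add: overlap_def estimate_0 rho_0 lift_mult)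
  show "(avg (estimate 0 * estimate 0) \<longlongrightarrow> 1) F"
    using tendsto_avg_lift[of "h0 * h0"] mean_h0_square by (simp add: estimate_0 lift_mult)
qed

theorem state_evolution: "state_limit t"
proof (induction t rule: less_induct)
  case (less t)
  then show ?case
    by (cases t) (auto intro: state_limit_0 state_limit_Suc)
qed

end

section \<open>Consequences of Wasserstein convergence\<close>

lemma couplings_marginal:
  fixes f g :: "'a \<Rightarrow> real"
  assumes "\<pi> \<in> couplings P Q" and "integrable P f" "integrable Q g"
  shows integrable_coupling_fst: "integrable \<pi> (\<lambda>z. f (fst z))"
    and integrable_coupling_snd: "integrable \<pi> (\<lambda>z. g (snd z))"
    and integral_coupling_fst: "(\<integral>z. f (fst z) \<partial>\<pi>) = (\<integral>x. f x \<partial>P)"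
    and integral_coupling_snd: "(\<integral>z. g (snd z) \<partial>\<pi>) = (\<integral>x. g x \<partial>Q)"
proof -
  have sets_\<pi>: "sets \<pi> = sets (P \<Otimes>\<^sub>M Q)" and marginals: "distr \<pi> P fst = P" "distr \<pi> Q snd = Q"
    using assms(1) by (auto simp: couplings_def)
  have projections: "fst \<in> measurable \<pi> P" "snd \<in> measurable \<pi> Q"
    using sets_\<pi> by (auto cong: measurable_cong_sets)
  show "integrable \<pi> (\<lambda>z. f (fst z))" "integrable \<pi> (\<lambda>z. g (snd z))"
    using assms(2,3) integrable_distr_eq[OF projections(1), of f]
      integrable_distr_eq[OF projections(2), of g]
      marginals by auto
  show "(\<integral>z. f (fst z) \<partial>\<pi>) = (\<integral>x. f x \<partial>P)" "(\<integral>z. g (snd z) \<partial>\<pi>) = (\<integral>x. g x \<partial>Q)"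
    using assms(2,3) integral_distr[OF projections(1), of f]
      integral_distr[OF projections(2), of g]
      marginals by auto
qed

lemma W2sq_integral_diff_le:
  fixes c :: "'a \<Rightarrow> 'a \<Rightarrow> real"
  assumes W2sq_less: "W2sq c P Q < ennreal r"
    and cost_measurable: "(\<lambda>z. c (fst z) (snd z)) \<in> borel_measurable (P \<Otimes>\<^sub>M Q)"
    and cost_nonneg: "\<And>x y. 0 \<le> c x y"
    and f_integrable: "integrable P f" "integrable Q f" and g_integrable: "integrable Q g" and "C \<ge> 0"
    and f_diff_le: "\<And>x y. \<bar>f x - f y\<bar> \<le> C * c x y + g y"
  shows "\<bar>(\<integral>x. f x \<partial>P) - (\<integral>x. f x \<partial>Q)\<bar> \<le> C * r + (\<integral>x. g x \<partial>Q)"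
proof -
  obtain \<pi> where \<pi>: "\<pi> \<in> couplings P Q"
    and cost: "(\<integral>\<^sup>+ z. ennreal (c (fst z) (snd z)) \<partial>\<pi>) < ennreal r"
    using W2sq_less unfolding W2sq_def INF_less_iff by blast
  have sets_\<pi>: "sets \<pi> = sets (P \<Otimes>\<^sub>M Q)" using \<pi> by (auto simp: couplings_def)
  note integrable_f = couplings_marginal(1,2)[OF \<pi> f_integrable]
    and integrable_g = integrable_coupling_snd[OF \<pi> f_integrable(1) g_integrable]
  note integral_f = couplings_marginal(3,4)[OF \<pi> f_integrable]
    and integral_g = integral_coupling_snd[OF \<pi> f_integrable(1) g_integrable]
  have integrable_cost: "integrable \<pi> (\<lambda>z. c (fst z) (snd z))"
    using cost_measurable order_less_trans[OF cost]
    by (intro integrableI_nonneg) (auto simp: cost_nonneg measurable_cong_sets[OF sets_\<pi> refl])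
  have "ennreal (\<integral>z. c (fst z) (snd z) \<partial>\<pi>) < ennreal r"
    using cost nn_integral_eq_integral[OF integrable_cost] cost_nonneg by simp
  then have cost_le: "(\<integral>z. c (fst z) (snd z) \<partial>\<pi>) \<le> r"
    using cost_nonneg by (simp add: ennreal_less_iff integral_nonneg)
  have "\<bar>(\<integral>x. f x \<partial>P) - (\<integral>x. f x \<partial>Q)\<bar> = \<bar>\<integral>z. f (fst z) - f (snd z) \<partial>\<pi>\<bar>"
    using integrable_f by (simp add: integral_f)
  also have "\<dots> \<le> (\<integral>z. \<bar>f (fst z) - f (snd z)\<bar> \<partial>\<pi>)" by (rule integral_abs_bound)
  also have "\<dots> \<le> (\<integral>z. C * c (fst z) (snd z) + g (snd z) \<partial>\<pi>)"
    using integrable_f integrable_g integrable_cost f_diff_le by (intro integral_mono) auto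
  also have "\<dots> = C * (\<integral>z. c (fst z) (snd z) \<partial>\<pi>) + (\<integral>x. g x \<partial>Q)"
    using integrable_g integrable_cost by (simp add: integral_g)
  also have "\<dots> \<le> C * r + (\<integral>x. g x \<partial>Q)"
    using cost_le \<open>C \<ge> 0\<close> by (intro add_mono mult_left_mono) auto
  finally show ?thesis .
qed

lemma W2sq_tendsto_integral:
  fixes c :: "'a \<Rightarrow> 'a \<Rightarrow> real"
  assumes W2sq_small: "(\<lambda>n. W2sq c (P n) Q) \<longlonglongrightarrow> 0"
    and cost: "\<And>n. (\<lambda>z. c (fst z) (snd z)) \<in> borel_measurable (P n \<Otimes>\<^sub>M Q)" "\<And>x y. 0 \<le> c x y"
    and f_integrable: "\<forall>\<^sub>F n in sequentially. integrable (P n) f" "integrable Q f"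
    and f_diff_le: "\<And>e. e > 0 \<Longrightarrow> \<exists>C\<ge>0. \<exists>g. integrable Q g \<and> (\<integral>x. g x \<partial>Q) \<le> e \<and>
       (\<forall>x y. \<bar>f x - f y\<bar> \<le> C * c x y + g y)"
  shows "(\<lambda>n. \<integral>x. f x \<partial>P n) \<longlonglongrightarrow> (\<integral>x. f x \<partial>Q)"
proof (rule tendstoI)
  fix e :: real assume e_pos: "e > 0"
  then obtain C g where C_nonneg: "C \<ge> 0" and g_integral: "integrable Q g" "(\<integral>x. g x \<partial>Q) \<le> e / 3"
    and f_diff: "\<And>x y. \<bar>f x - f y\<bar> \<le> C * c x y + g y"
    using f_diff_le[of "e / 3"] by auto
  let ?r = "e / (3 * (C + 1))"
  have r_pos: "?r > 0" "C * ?r \<le> e / 3" using e_pos C_nonneg by (auto simp: field_simps)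
  then have "\<forall>\<^sub>F n in sequentially. W2sq c (P n) Q < ennreal ?r"
    using W2sq_small by (intro order_tendstoD) auto
  with f_integrable(1) show "\<forall>\<^sub>F n in sequentially. dist (\<integral>x. f x \<partial>P n) (\<integral>x. f x \<partial>Q) < e"
  proof eventually_elim
    case (elim n)
    have "dist (\<integral>x. f x \<partial>P n) (\<integral>x. f x \<partial>Q) \<le> C * ?r + (\<integral>x. g x \<partial>Q)"
      unfolding dist_real_def
      by (rule W2sq_integral_diff_le[OF elim(2) cost elim(1) f_integrable(2) g_integral(1)
        C_nonneg f_diff])
    also have "\<dots> < e" using r_pos(2) g_integral(2) e_pos by linarith
    finally show ?case .
  qed
qed

lemma uniform_tail:
  assumes integrable_f: "integrable M (f :: 'a \<Rightarrow> real)" and f_nonneg: "\<And>x. 0 \<le> f x" and "e > 0"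
  obtains K where "K \<ge> 0" "integrable M (\<lambda>x. f x * of_bool (f x > K))"
    "(\<integral>x. f x * of_bool (f x > K) \<partial>M) \<le> e"
proof -
  have [measurable]: "f \<in> borel_measurable M" using integrable_f by auto
  have "(\<lambda>k. \<integral>x. f x * of_bool (f x > real k) \<partial>M) \<longlonglongrightarrow> (\<integral>x. 0 \<partial>M)"
  proof (rule integral_dominated_convergence[where w = f])
    show "AE x in M. (\<lambda>k. f x * of_bool (f x > real k)) \<longlonglongrightarrow> 0"
    proof (intro AE_I2 tendsto_eventually)
      fix x
      obtain k0 :: nat where "f x < real k0" using reals_Archimedean2 by blast
      then show "\<forall>\<^sub>F k in sequentially. f x * of_bool (f x > real k) = 0"
        by (intro eventually_sequentiallyI[of k0]) auto
    qed
    show "AE x in M. norm (f x * of_bool (f x > real k)) \<le> f x" for k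
      using f_nonneg by (intro AE_I2) auto
  qed (use integrable_f in auto)
  then have "\<forall>\<^sub>F k in sequentially. (\<integral>x. f x * of_bool (f x > real k) \<partial>M) < e"
    using \<open>e > 0\<close> by (intro order_tendstoD) auto
  then obtain k :: nat where "(\<integral>x. f x * of_bool (f x > real k) \<partial>M) < e"
    by (meson eventually_happens sequentially_bot)
  moreover have "integrable M (\<lambda>x. f x * of_bool (f x > real k))"
    by (rule Bochner_Integration.integrable_bound[OF integrable_f]) auto
  ultimately show thesis by (intro that[of "real k"]) auto
qed

definition quadratically_continuous :: "('a::real_normed_vector \<Rightarrow> real) \<Rightarrow> bool" where
  "quadratically_continuous q \<longleftrightarrow>
     (\<forall>\<eta>>0. \<exists>C\<ge>0. \<forall>a b. \<bar>q a - q b\<bar> \<le> C * (dist a b)\<^sup>2 + \<eta> * (norm b)\<^sup>2)"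

lemma quadratically_continuous_const: "quadratically_continuous (\<lambda>_. k)"
  by (auto simp: quadratically_continuous_def intro!: exI[of _ 0])

lemma quadratically_continuous_mult:
  fixes f g :: "'a::real_normed_vector \<Rightarrow> real"
  assumes f_Lipschitz: "\<And>a b. \<bar>f a - f b\<bar> \<le> dist a b" "f 0 = 0"
    and g_Lipschitz: "\<And>a b. \<bar>g a - g b\<bar> \<le> dist a b" "g 0 = 0"
  shows "quadratically_continuous (\<lambda>a. f a * g a)"
  unfolding quadratically_continuous_def
proof (intro allI impI exI conjI)
  fix \<eta> :: real and a b :: 'a assume \<eta>: "\<eta> > 0"
  then show "0 \<le> 1 + 1 / \<eta>" by simp
  have le_norm: "\<bar>f b\<bar> \<le> norm b" "\<bar>g b\<bar> \<le> norm b"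
    using f_Lipschitz(1)[of b 0] g_Lipschitz(1)[of b 0] f_Lipschitz(2) g_Lipschitz(2) by auto
  have "0 \<le> (dist a b / sqrt \<eta> - sqrt \<eta> * norm b)\<^sup>2" by simp
  also have "\<dots> = (dist a b)\<^sup>2 / \<eta> + \<eta> * (norm b)\<^sup>2 - 2 * (dist a b * norm b)"
    using \<eta> by (simp add: power2_diff power_divide power_mult_distrib)
  finally have young: "2 * (dist a b * norm b) \<le> (dist a b)\<^sup>2 / \<eta> + \<eta> * (norm b)\<^sup>2" by simp
  have "f a * g a - f b * g b = (f a - f b) * (g a - g b) + (f a - f b) * g b + (g a - g b) * f b"
    by (simp add: algebra_simps)
  then have "\<bar>f a * g a - f b * g b\<bar>
      \<le> \<bar>f a - f b\<bar> * \<bar>g a - g b\<bar> + \<bar>f a - f b\<bar> * \<bar>g b\<bar> + \<bar>g a - g b\<bar> * \<bar>f b\<bar>"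
    by (simp add: abs_mult[symmetric])
  also have "\<dots> \<le> dist a b * dist a b + dist a b * norm b + dist a b * norm b"
    by (intro add_mono mult_mono f_Lipschitz(1) g_Lipschitz(1) le_norm) auto
  also have "\<dots> = (dist a b)\<^sup>2 + 2 * (dist a b * norm b)" by (simp add: power2_eq_square)
  also have "\<dots> \<le> (1 + 1 / \<eta>) * (dist a b)\<^sup>2 + \<eta> * (norm b)\<^sup>2"
    using young by (simp add: distrib_right)
  finally show "\<bar>f a * g a - f b * g b\<bar> \<le> (1 + 1 / \<eta>) * (dist a b)\<^sup>2 + \<eta> * (norm b)\<^sup>2" .
qed

lemma cost_eq: "cost t z z' = (dist (fst z) (fst z'))\<^sup>2
    + (\<Sum>s\<le>t. (of_bool (snd z s) - of_bool (snd z' s) :: real)\<^sup>2)"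
  by (simp add: cost_def dist_prod_def dist_real_def)

lemma cost_nonneg: "0 \<le> cost t z z'"
  unfolding cost_eq by (intro add_nonneg_nonneg sum_nonneg) auto

lemma dist_square_le_cost: "(dist (fst z) (fst z'))\<^sup>2 \<le> cost t z z'"
  unfolding cost_eq by (simp add: sum_nonneg)

lemma dist_square_add_1_le_cost:
  assumes "r \<le> t" and "snd z r \<noteq> snd z' r"
  shows "(dist (fst z) (fst z'))\<^sup>2 + 1 \<le> cost t z z'"
proof -
  let ?f = "\<lambda>s. (of_bool (snd z s) - of_bool (snd z' s) :: real)\<^sup>2"
  have "1 = ?f r" using assms(2) by auto
  also have "\<dots> \<le> (\<Sum>s\<le>t. ?f s)" using assms(1) by (intro member_le_sum) auto
  finally show ?thesis unfolding cost_eq by simp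
qed

lemma mult_of_bool_diff_le_cost:
  fixes q :: "real \<times> real \<Rightarrow> real"
  assumes B_local: "\<And>b b'. (\<forall>r\<le>t. b r = b' r) \<Longrightarrow> B b = B b'"
    and q_diff: "\<bar>q (fst z) - q (fst z')\<bar> \<le> C * (dist (fst z) (fst z'))\<^sup>2 + \<epsilon>"
    and "C \<ge> 0" "K \<ge> 0"
  shows "\<bar>q (fst z) * of_bool (B (snd z)) - q (fst z') * of_bool (B (snd z'))\<bar>
    \<le> (C + K) * cost t z z' + (\<epsilon> + \<bar>q (fst z')\<bar> * of_bool (\<bar>q (fst z')\<bar> > K))"
proof -
  let ?d = "(dist (fst z) (fst z'))\<^sup>2" and ?q = "q (fst z)" and ?q' = "q (fst z')"
  let ?tail = "\<bar>?q'\<bar> * of_bool (\<bar>?q'\<bar> > K)"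
  have tail_bounds: "0 \<le> ?tail" "\<bar>?q'\<bar> \<le> K + ?tail" using \<open>K \<ge> 0\<close> by auto
  show ?thesis
  proof (cases "\<forall>r\<le>t. snd z r = snd z' r")
    case True
    then have "B (snd z) = B (snd z')" by (rule B_local)
    then have "\<bar>?q * of_bool (B (snd z)) - ?q' * of_bool (B (snd z'))\<bar> \<le> \<bar>?q - ?q'\<bar>" by simp
    moreover have "C * ?d \<le> (C + K) * cost t z z'"
      using \<open>C \<ge> 0\<close> \<open>K \<ge> 0\<close> dist_square_le_cost[of z z' t] cost_nonneg[of t z z']
      by (intro mult_mono) auto
    ultimately show ?thesis using q_diff tail_bounds by linarith
  next
    case False
    then obtain r where "r \<le> t" "snd z r \<noteq> snd z' r" by blast
    then have "?d + 1 \<le> cost t z z'" by (rule dist_square_add_1_le_cost)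
    then have "(C + K) * (?d + 1) \<le> (C + K) * cost t z z'"
      using \<open>C \<ge> 0\<close> \<open>K \<ge> 0\<close> by (intro mult_left_mono) auto
    moreover have "C * ?d + K \<le> (C + K) * (?d + 1)"
      using \<open>C \<ge> 0\<close> \<open>K \<ge> 0\<close> by (simp add: algebra_simps)
    moreover have "\<bar>?q * of_bool (B (snd z)) - ?q' * of_bool (B (snd z'))\<bar> \<le> \<bar>?q - ?q'\<bar> + \<bar>?q'\<bar>"
      by (cases "B (snd z)"; cases "B (snd z')") auto
    ultimately show ?thesis using q_diff tail_bounds by linarith
  qed
qed

lemma quadratically_continuous_cost_bound:
  fixes q :: "real \<times> real \<Rightarrow> real"
  assumes q_continuous: "quadratically_continuous q" "\<eta> > 0" and "K \<ge> 0"
    and B_local: "\<And>b b'. (\<forall>r\<le>t. b r = b' r) \<Longrightarrow> B b = B b'"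
  shows "\<exists>C\<ge>0. \<forall>z z'. \<bar>q (fst z) * of_bool (B (snd z)) - q (fst z') * of_bool (B (snd z'))\<bar>
    \<le> C * cost t z z' + (\<eta> * (norm (fst z'))\<^sup>2 + \<bar>q (fst z')\<bar> * of_bool (\<bar>q (fst z')\<bar> > K))"
proof -
  obtain C where q_diff_le: "C \<ge> 0" "\<And>a b. \<bar>q a - q b\<bar> \<le> C * (dist a b)\<^sup>2 + \<eta> * (norm b)\<^sup>2"
    using q_continuous unfolding quadratically_continuous_def by blast
  show ?thesis
    using q_diff_le \<open>K \<ge> 0\<close> B_local
    by (intro exI[of _ "C + K"] conjI allI mult_of_bool_diff_le_cost) auto
qed

lemma PiM_bool_eq_count_space:
  "(PiM {..t::nat} (\<lambda>_. count_space UNIV) :: (nat \<Rightarrow> bool) measure) = count_space ({..t} \<rightarrow>\<^sub>E UNIV)"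
  by (rule count_space_PiM_finite) auto

lemma measurable_Xsp_product:
  assumes [measurable]: "q \<in> borel_measurable borel"
  shows "(\<lambda>z. q (fst z) * of_bool (B (snd z)) :: real) \<in> borel_measurable (Xsp t)"
proof -
  have [measurable]: "Measurable.pred (count_space ({..t} \<rightarrow>\<^sub>E UNIV)) B" by simp
  show ?thesis unfolding Xsp_def PiM_bool_eq_count_space by measurable
qed

lemma measurable_cost: "(\<lambda>z. cost t (fst z) (snd z)) \<in> borel_measurable (Xsp t \<Otimes>\<^sub>M Xsp t)"
proof -
  have [measurable]: "(\<lambda>b. of_bool (b s) :: real) \<in> borel_measurable (count_space ({..t} \<rightarrow>\<^sub>E UNIV))"
    for s
    by simp
  have [measurable]: "(\<lambda>z. of_bool (snd z s) :: real) \<in> borel_measurable (Xsp t)" for s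
    unfolding Xsp_def PiM_bool_eq_count_space by measurable
  have [measurable]: "(\<lambda>z. fst z) \<in> borel_measurable (Xsp t)"
    unfolding Xsp_def by measurable
  show ?thesis unfolding cost_eq by measurable
qed

lemma integral_emp:
  assumes f_measurable: "f \<in> borel_measurable (Xsp t)" and n_ge_1: "n \<ge> 1"
  shows "(\<integral>z. f z \<partial>emp n t \<theta> h0 \<delta>) = mean n (\<lambda>i. f ((\<theta> i, h0 i), restrict (\<lambda>s. \<delta> s i) {..t}))"
    and "integrable (emp n t \<theta> h0 \<delta>) f"
proof -
  have point: "(\<lambda>i. ((\<theta> i, h0 i), restrict (\<lambda>s. \<delta> s i) {..t})) \<in> measurable (measure_pmf q) (Xsp t)"
    for q
    by (rule measurableI) (auto simp: Xsp_def space_pair_measure space_PiM)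
  have finite_support: "finite (set_pmf (pmf_of_set {..<n}))" "{..<n} \<noteq> {}"
    using n_ge_1 by (auto simp: lessThan_empty_iff)
  show "(\<integral>z. f z \<partial>emp n t \<theta> h0 \<delta>) = mean n (\<lambda>i. f ((\<theta> i, h0 i), restrict (\<lambda>s. \<delta> s i) {..t}))"
    unfolding emp_def mean_def using finite_support
    by (subst integral_distr[OF point f_measurable]) (simp add: integral_pmf_of_set)
  show "integrable (emp n t \<theta> h0 \<delta>) f"
    unfolding emp_def using finite_support
    by (subst integrable_distr_eq[OF point f_measurable]) (rule integrable_measure_pmf_finite)
qed

locale wasserstein_limit =
  fixes \<theta> h0 :: "nat \<Rightarrow> nat \<Rightarrow> real" and \<delta> :: "nat \<Rightarrow> nat \<Rightarrow> nat \<Rightarrow> bool"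
    and \<mu> :: "(real \<times> real) measure" and \<nu> :: "(nat \<Rightarrow> bool) measure"
  assumes \<mu>_prob: "prob_space \<mu>" and \<mu>_sets: "sets \<mu> = sets borel"
    and \<nu>_prob: "prob_space \<nu>"
    and \<nu>_sets: "sets \<nu> = sets (PiM (UNIV :: nat set) (\<lambda>_. count_space (UNIV :: bool set)))"
    and fst_square: "integrable \<mu> (\<lambda>z. (fst z)\<^sup>2)" "(\<integral>z. (fst z)\<^sup>2 \<partial>\<mu>) = 1"
    and snd_square: "integrable \<mu> (\<lambda>z. (snd z)\<^sup>2)"
    and \<delta>_0: "\<And>n i. i < n \<Longrightarrow> \<delta> n 0 i"
    and W2conv: "(\<lambda>n. W2sq (cost t) (emp n t (\<theta> n) (h0 n) (\<delta> n)) (lim_meas t \<mu> \<nu>)) \<longlonglongrightarrow> 0"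
begin

lemma norm_square_integrable: "integrable \<mu> (\<lambda>z. (norm z)\<^sup>2)"
  using fst_square(1) snd_square by (simp add: norm_prod_def)

definition \<nu>_upto :: "nat \<Rightarrow> (nat \<Rightarrow> bool) measure" where
  "\<nu>_upto t = distr \<nu> (PiM {..t} (\<lambda>_. count_space UNIV)) (\<lambda>\<omega>. restrict \<omega> {..t})"

lemma measurable_restrict_\<nu>:
  "(\<lambda>\<omega>. restrict \<omega> {..t}) \<in> measurable \<nu> (PiM {..t} (\<lambda>_. count_space UNIV))"
  unfolding measurable_cong_sets[OF \<nu>_sets refl] by (rule measurable_restrict_subset) simp

lemma lim_meas_eq: "lim_meas t \<mu> \<nu> = \<mu> \<Otimes>\<^sub>M \<nu>_upto t"
  by (simp add: lim_meas_def \<nu>_upto_def)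

lemma sets_lim_meas: "sets (lim_meas t \<mu> \<nu>) = sets (Xsp t)"
  unfolding lim_meas_eq Xsp_def by (intro sets_pair_measure_cong \<mu>_sets) (simp add: \<nu>_upto_def)

lemma prob_\<nu>_upto:
  assumes "\<And>\<omega>. B (restrict \<omega> {..t}) = B \<omega>"
  shows "(\<integral>b. of_bool (B b) \<partial>\<nu>_upto t) = measure \<nu> {\<omega> \<in> space \<nu>. B \<omega>}"
proof -
  have "(\<integral>b. of_bool (B b) \<partial>\<nu>_upto t) = (\<integral>\<omega>. of_bool (B (restrict \<omega> {..t})) \<partial>\<nu> :: real)"
    unfolding \<nu>_upto_def
    by (rule integral_distr[OF measurable_restrict_\<nu>]) (simp add: PiM_bool_eq_count_space)
  also have "\<dots> = (\<integral>\<omega>. indicator {\<omega> \<in> space \<nu>. B \<omega>} \<omega> \<partial>\<nu>)"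
    by (intro Bochner_Integration.integral_cong) (auto simp: assms indicator_def)
  also have "\<dots> = measure \<nu> {\<omega> \<in> space \<nu>. B \<omega>}"
    by (simp add: Int_def conj_commute cong: conj_cong)
  finally show ?thesis .
qed

lemma lim_meas_product:
  fixes q :: "real \<times> real \<Rightarrow> real"
  assumes q_integrable: "integrable \<mu> q"
  shows integrable_lim_meas: "integrable (lim_meas t \<mu> \<nu>) (\<lambda>z. q (fst z) * of_bool (B (snd z)))"
    and integral_lim_meas: "(\<integral>z. q (fst z) * of_bool (B (snd z)) \<partial>lim_meas t \<mu> \<nu>)
      = (\<integral>y. q y \<partial>\<mu>) * (\<integral>b. of_bool (B b) \<partial>\<nu>_upto t)"
proof -
  interpret \<mu>: prob_space \<mu> by (rule \<mu>_prob)
  interpret \<nu>: prob_space \<nu> by (rule \<nu>_prob)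
  interpret upto: prob_space "\<nu>_upto t"
    unfolding \<nu>_upto_def by (rule \<nu>.prob_space_distr[OF measurable_restrict_\<nu>])
  interpret pair_prob_space \<mu> "\<nu>_upto t" ..
  have [measurable]: "Measurable.pred (\<nu>_upto t) B" by (simp add: \<nu>_upto_def PiM_bool_eq_count_space)
  have [measurable]: "q \<in> borel_measurable \<mu>" using q_integrable by auto
  have "integrable (\<mu> \<Otimes>\<^sub>M \<nu>_upto t) (\<lambda>z. q (fst z))"
    using integrable_distr_eq[of fst "\<mu> \<Otimes>\<^sub>M \<nu>_upto t" \<mu> q] q_integrable upto.distr_pair_fst[of \<mu>]
    by simp
  then have integrable_product: "integrable (\<mu> \<Otimes>\<^sub>M \<nu>_upto t) (\<lambda>z. q (fst z) * of_bool (B (snd z)))"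
    by (rule Bochner_Integration.integrable_bound) auto
  then show "integrable (lim_meas t \<mu> \<nu>) (\<lambda>z. q (fst z) * of_bool (B (snd z)))"
    unfolding lim_meas_eq .
  show "(\<integral>z. q (fst z) * of_bool (B (snd z)) \<partial>lim_meas t \<mu> \<nu>)
      = (\<integral>y. q y \<partial>\<mu>) * (\<integral>b. of_bool (B b) \<partial>\<nu>_upto t)"
    unfolding lim_meas_eq using integral_fst'[OF integrable_product] by simp
qed

lemma lim_meas_cost_bound:
  fixes q :: "real \<times> real \<Rightarrow> real"
  assumes q_continuous: "quadratically_continuous q" "integrable \<mu> q" and e_pos: "e > 0"
    and B_local: "\<And>b b'. (\<forall>r\<le>t. b r = b' r) \<Longrightarrow> B b = B b'"
  shows "\<exists>C\<ge>0. \<exists>g. integrable (lim_meas t \<mu> \<nu>) g \<and> (\<integral>z. g z \<partial>lim_meas t \<mu> \<nu>) \<le> e \<and>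
    (\<forall>z z'. \<bar>q (fst z) * of_bool (B (snd z)) - q (fst z') * of_bool (B (snd z'))\<bar>
      \<le> C * cost t z z' + g z')"
proof -
  define I where "I = (\<integral>y. (norm y)\<^sup>2 \<partial>\<mu>) + 1"
  have "I > 0" unfolding I_def by (intro add_nonneg_pos) auto
  define \<eta> where "\<eta> = e / 2 / I"
  have \<eta>: "\<eta> > 0" using e_pos \<open>I > 0\<close> by (simp add: \<eta>_def)
  have "\<eta> * (\<integral>y. (norm y)\<^sup>2 \<partial>\<mu>) \<le> \<eta> * I" using \<eta> by (simp add: I_def)
  also have "\<dots> = e / 2" using \<open>I > 0\<close> by (simp add: \<eta>_def)
  finally have moment: "\<eta> * (\<integral>y. (norm y)\<^sup>2 \<partial>\<mu>) \<le> e / 2" .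
  obtain K where tail: "K \<ge> 0" "integrable \<mu> (\<lambda>y. \<bar>q y\<bar> * of_bool (\<bar>q y\<bar> > K))"
    "(\<integral>y. \<bar>q y\<bar> * of_bool (\<bar>q y\<bar> > K) \<partial>\<mu>) \<le> e / 2"
    by (rule uniform_tail[of \<mu> "\<lambda>y. \<bar>q y\<bar>" "e / 2"]) (use q_continuous(2) e_pos in auto)
  let ?g = "\<lambda>y. \<eta> * (norm y)\<^sup>2 + \<bar>q y\<bar> * of_bool (\<bar>q y\<bar> > K)"
  have g_bounds: "integrable \<mu> ?g" "(\<integral>y. ?g y \<partial>\<mu>) \<le> e"
    using norm_square_integrable tail moment by auto
  have "integrable (lim_meas t \<mu> \<nu>) (\<lambda>z. ?g (fst z))" "(\<integral>z. ?g (fst z) \<partial>lim_meas t \<mu> \<nu>) \<le> e"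
    using lim_meas_product[OF g_bounds(1), where B = "\<lambda>_. True"]
      prob_\<nu>_upto[where B = "\<lambda>_. True"] g_bounds(2)
      prob_space.prob_space[OF \<nu>_prob] by simp_all
  then show ?thesis
    using quadratically_continuous_cost_bound[of q \<eta> K t B, OF q_continuous(1) \<eta> tail(1) B_local]
    by blast
qed

lemma empirical_limit:
  fixes q :: "real \<times> real \<Rightarrow> real"
  assumes q_continuous: "quadratically_continuous q" "integrable \<mu> q"
    and B_local: "\<And>b b'. (\<forall>r\<le>t. b r = b' r) \<Longrightarrow> B b = B b'"
  shows "(\<lambda>n. mean n (\<lambda>i. q (\<theta> n i, h0 n i) * of_bool (B (\<lambda>s. \<delta> n s i))))
    \<longlonglongrightarrow> (\<integral>y. q y \<partial>\<mu>) * measure \<nu> {\<omega> \<in> space \<nu>. B \<omega>}"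
proof -
  let ?f = "\<lambda>z :: (real \<times> real) \<times> (nat \<Rightarrow> bool). q (fst z) * of_bool (B (snd z))"
  let ?L = "lim_meas t \<mu> \<nu>" and ?E = "\<lambda>n. emp n t (\<theta> n) (h0 n) (\<delta> n)"
  have restrict: "B (restrict b {..t}) = B b" for b by (rule B_local) simp
  have "q \<in> borel_measurable borel" using q_continuous(2) measurable_cong_sets[OF \<mu>_sets refl] by auto
  then have measurable_product: "?f \<in> borel_measurable (Xsp t)" by (rule measurable_Xsp_product)
  have "(\<lambda>n. \<integral>z. ?f z \<partial>?E n) \<longlonglongrightarrow> (\<integral>z. ?f z \<partial>?L)"
  proof (rule W2sq_tendsto_integral[OF W2conv _ cost_nonneg])
    show "(\<lambda>z. cost t (fst z) (snd z)) \<in> borel_measurable (?E n \<Otimes>\<^sub>M ?L)" for n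
      using measurable_cost
      by (simp add: emp_def sets_lim_meas cong: measurable_cong_sets sets_pair_measure_cong)
    show "\<forall>\<^sub>F n in sequentially. integrable (?E n) ?f"
      by (intro eventually_sequentiallyI[of 1] integral_emp(2) measurable_product)
    show "integrable ?L ?f" by (rule integrable_lim_meas[OF q_continuous(2)])
    show "\<exists>C\<ge>0. \<exists>g. integrable ?L g \<and> (\<integral>z. g z \<partial>?L) \<le> e \<and>
        (\<forall>z z'. \<bar>?f z - ?f z'\<bar> \<le> C * cost t z z' + g z')"
      if "e > 0" for e
      by (rule lim_meas_cost_bound[OF q_continuous that B_local])
  qed
  then have "(\<lambda>n. \<integral>z. ?f z \<partial>?E n) \<longlonglongrightarrow> (\<integral>y. q y \<partial>\<mu>) * measure \<nu> {\<omega> \<in> space \<nu>. B \<omega>}"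
    by (simp add: integral_lim_meas[OF q_continuous(2)] prob_\<nu>_upto[of B t, OF restrict])
  moreover have "\<forall>\<^sub>F n in sequentially.
      (\<integral>z. ?f z \<partial>?E n) = mean n (\<lambda>i. q (\<theta> n i, h0 n i) * of_bool (B (\<lambda>s. \<delta> n s i)))"
    by (intro eventually_sequentiallyI[of 1])
      (simp add: integral_emp(1)[OF measurable_product] restrict)
  ultimately show ?thesis by (rule Lim_transform_eventually)
qed

lemma last_update_limit:
  fixes q :: "real \<times> real \<Rightarrow> real"
  assumes q_continuous: "quadratically_continuous q" "integrable \<mu> q" and "s \<le> t"
  shows "(\<lambda>n. mean n (last_update \<delta> (Suc t) s n * (\<lambda>i. q (\<theta> n i, h0 n i))))
    \<longlonglongrightarrow> (\<integral>y. q y \<partial>\<mu>) * pt \<nu> (Suc t) s"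
proof -
  let ?B = "\<lambda>b. b s \<and> (\<forall>r. s < r \<and> r < Suc t \<longrightarrow> \<not> b r)"
  have "(\<lambda>n. mean n (\<lambda>i. q (\<theta> n i, h0 n i) * of_bool (?B (\<lambda>s. \<delta> n s i))))
      \<longlonglongrightarrow> (\<integral>y. q y \<partial>\<mu>) * measure \<nu> {\<omega> \<in> space \<nu>. ?B \<omega>}"
    using \<open>s \<le> t\<close> by (intro empirical_limit[OF q_continuous, of t]) (auto simp: less_Suc_eq_le)
  moreover have "mean n (\<lambda>i. q (\<theta> n i, h0 n i) * of_bool (?B (\<lambda>s. \<delta> n s i)))
      = mean n (last_update \<delta> (Suc t) s n * (\<lambda>i. q (\<theta> n i, h0 n i)))" for n
    using \<open>s \<le> t\<close> \<delta>_0
    by (intro mean_cong) (simp add: last_update_def tau_eq_iff[of "\<delta> n"] less_Suc_eq_le)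
  ultimately show ?thesis by (simp add: pt_def)
qed

lemma update_frequency_limit:
  assumes "s \<le> t"
  shows "(\<lambda>n. mean n (last_update \<delta> (Suc t) s n)) \<longlonglongrightarrow> pt \<nu> (Suc t) s"
proof -
  interpret prob_space \<mu> by (rule \<mu>_prob)
  show ?thesis
    using last_update_limit[OF quadratically_continuous_const[of 1] _ assms]
    by (simp add: times_fun_def prob_space)
qed

lemma update_signal_limit:
  assumes "s \<le> t"
  shows "(\<lambda>n. mean n (last_update \<delta> (Suc t) s n * (\<theta> n * \<theta> n))) \<longlonglongrightarrow> pt \<nu> (Suc t) s"
proof -
  have "\<bar>fst a - fst b\<bar> \<le> dist a b" for a b :: "real \<times> real"
    using dist_fst_le[of a b] by (simp add: dist_real_def)
  then have "quadratically_continuous (\<lambda>z :: real \<times> real. fst z * fst z)"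
    by (intro quadratically_continuous_mult) auto
  then show ?thesis
    using last_update_limit[OF _ _ assms] fst_square
    by (fastforce simp: times_fun_def power2_eq_square)
qed

lemma initial_overlap_limit: "(\<lambda>n. mean n (\<theta> n * h0 n)) \<longlonglongrightarrow> (\<integral>z. fst z * snd z \<partial>\<mu>)"
proof -
  have [measurable_cong]: "sets \<mu> = sets (borel \<Otimes>\<^sub>M borel)"
    by (simp only: \<mu>_sets borel_prod)
  have "\<bar>fst a - fst b\<bar> \<le> dist a b" "\<bar>snd a - snd b\<bar> \<le> dist a b" for a b :: "real \<times> real"
    using dist_fst_le[of a b] dist_snd_le[of a b] by (simp_all add: dist_real_def)
  then have continuous_product: "quadratically_continuous (\<lambda>z :: real \<times> real. fst z * snd z)"
    by (intro quadratically_continuous_mult) auto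
  have integrable_product: "integrable \<mu> (\<lambda>z. fst z * snd z)"
  proof (rule Bochner_Integration.integrable_bound[OF norm_square_integrable])
    have "2 * \<bar>fst z * snd z\<bar> \<le> (norm z)\<^sup>2" for z :: "real \<times> real"
      using zero_le_power2[of "\<bar>fst z\<bar> - \<bar>snd z\<bar>"] by (simp add: norm_prod_def power2_diff abs_mult)
    then show "AE z in \<mu>. norm (fst z * snd z) \<le> norm ((norm z)\<^sup>2)"
      by (intro AE_I2) (smt (verit) abs_ge_zero real_norm_def)
  qed measurable
  show ?thesis
    using empirical_limit[OF continuous_product integrable_product, of 0 "\<lambda>_. True"]
      prob_space.prob_space[OF \<nu>_prob]
    by (simp add: times_fun_def)
qed

end

theorem theorem4:
  fixes P :: "'w measure"
    and Z :: "nat \<Rightarrow> 'w \<Rightarrow> nat \<Rightarrow> nat \<Rightarrow> real"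
    and \<theta> :: "nat \<Rightarrow> nat \<Rightarrow> real"
    and h0 :: "nat \<Rightarrow> nat \<Rightarrow> real"
    and \<delta> :: "nat \<Rightarrow> nat \<Rightarrow> nat \<Rightarrow> bool"
    and \<mu> :: "(real \<times> real) measure"
    and \<nu> :: "(nat \<Rightarrow> bool) measure"
    and lam :: real
    and t :: nat
  assumes lam: "lam \<ge> 0"
    and P: "prob_space P"
    and Z_sym: "\<And>n \<omega> i j. i < n \<Longrightarrow> j < n \<Longrightarrow> Z n \<omega> i j = Z n \<omega> j i"
    and Z_indep: "\<And>n. n \<ge> 1 \<Longrightarrow>
          prob_space.indep_vars P (\<lambda>_. borel) (\<lambda>(i, j) \<omega>. Z n \<omega> i j) {(i, j). i \<le> j \<and> j < n}"
    and Z_off: "\<And>n i j. n \<ge> 1 \<Longrightarrow> i < j \<Longrightarrow> j < n \<Longrightarrow>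
          distributed P lborel (\<lambda>\<omega>. Z n \<omega> i j) (normal_density 0 (sqrt (1 / real n)))"
    and Z_diag: "\<And>n i. n \<ge> 1 \<Longrightarrow> i < n \<Longrightarrow>
          distributed P lborel (\<lambda>\<omega>. Z n \<omega> i i) (normal_density 0 (sqrt (2 / real n)))"
    and h0_norm: "\<And>n. n \<ge> 1 \<Longrightarrow> vnorm n (h0 n) = sqrt (real n)"
    and \<delta>0: "\<And>n i. n \<ge> 1 \<Longrightarrow> i < n \<Longrightarrow> \<delta> n 0 i"
    and \<mu>_prob: "prob_space \<mu>" and \<mu>_sets: "sets \<mu> = sets borel"
    and \<mu>_int1: "integrable \<mu> (\<lambda>z. (fst z)\<^sup>2)" and \<mu>_mom1: "(\<integral>z. (fst z)\<^sup>2 \<partial>\<mu>) = 1"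
    and \<mu>_int2: "integrable \<mu> (\<lambda>z. (snd z)\<^sup>2)" and \<mu>_mom2: "(\<integral>z. (snd z)\<^sup>2 \<partial>\<mu>) = 1"
    and \<nu>_prob: "prob_space \<nu>"
    and \<nu>_sets: "sets \<nu> = sets (PiM (UNIV :: nat set) (\<lambda>_. count_space (UNIV :: bool set)))"
    and W2conv: "\<And>s. (\<lambda>n. W2sq (cost s) (emp n s (\<theta> n) (h0 n) (\<delta> n)) (lim_meas s \<mu> \<nu>))
                       \<longlonglongrightarrow> 0"
    and t: "t \<ge> 1"
  shows "\<forall>\<epsilon>>0. (\<lambda>n. measure P {\<omega> \<in> space P.
            \<bar>vinner n (\<theta> n)
                 (theta_hat n (\<lambda>i j. lam / real n * \<theta> n i * \<theta> n j + Z n \<omega> i j) (\<delta> n) (h0 n) t) / real n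
             - rho lam (\<integral>z. fst z * snd z \<partial>\<mu>) (pt \<nu>) t\<bar> > \<epsilon>}) \<longlonglongrightarrow> 0"
proof -
  interpret goe_sequence P Z
    using P Z_sym Z_indep Z_off Z_diag
    by (intro goe_sequence.intro goe_sequence_axioms.intro goe.intro goe_axioms.intro)
      (auto simp: symmetric_def)
  have \<delta>_0: "\<delta> n 0 i" if "i < n" for n i using \<delta>0[of n i] that by simp
  interpret W2: wasserstein_limit \<theta> h0 \<delta> \<mu> \<nu>
    by (intro wasserstein_limit.intro \<mu>_prob \<mu>_sets \<nu>_prob \<nu>_sets \<mu>_int1 \<mu>_mom1 \<mu>_int2 \<delta>_0 W2conv)
  interpret amp "prob_filter P" fst "case_prod Z" \<theta> h0 \<delta> lam "\<integral>z. fst z * snd z \<partial>\<mu>" "pt \<nu>"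
    by (intro amp.intro asymptotically_free_axioms amp_axioms.intro h0_norm \<delta>_0
        W2.update_frequency_limit W2.update_signal_limit W2.initial_overlap_limit)
  have "(overlap t \<longlongrightarrow> rho lam (\<integral>z. fst z * snd z \<partial>\<mu>) (pt \<nu>) t) (prob_filter P)"
    using state_evolution[of t] by (simp add: state_limit_def)
  from tendsto_prob_filterD[OF this] show ?thesis
    by (simp add: overlap_def avg_def mean_mult lift_def estimate_def spiked_def)
qed

end
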